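(* Let $P(z)=\prod_{j=1}^d (z-\lambda_j)^{\alpha_j}$ with distinct $\lambda_1,\dots,\lambda_d\in\mathbb{C}$, multiplicities $\alpha_j\in\mathbb{N}$, and $\alpha=\sum_{j=1}^d\alpha_j$. For each fixed $t\in\mathbb{C}$, the empirical zero distribution $\mu_{n,t}$ of the heat-evolved power $P_t^n$ converges weakly, as $n\to\infty$, to some compactly supported probability measure $\mu_t$ on $\mathbb{C}$. The limiting measure $\mu_t$ is singular with respect to the Lebesgue measure on $\mathbb{C}$. Moreover, if $t=|t|e^{i\theta}\in\mathbb{C}$ and $\tilde P^n(z):=P^n(e^{i\theta/2}z)$ is the initial polynomial power with rotated zeros, then $\mu_t$ is the push-forward of $\tilde\mu_{|t|}$ under the rotation map $z\mapsto z e^{i\theta/2}$, where $\tilde\mu_{|t|}$ is the limiting zero distribution (weak limit as $n\to\infty$ of the empirical zero distributions) of $\tilde P^n_{|t|}:=e^{-\frac{|t|}{2\alpha n}\partial_z^2}\tilde P^n$.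
   Context: $\mathbb{N}=\{1,2,\dots\}$ and $d\in\mathbb{N}$. $P^n$ denotes the $n$-th power of $P$, i.e. $P^n(z)=\prod_{j=1}^d(z-\lambda_j)^{n\alpha_j}$, a polynomial of degree $\alpha n$. Its heat evolution at "time" $t\in\mathbb{C}$ is the polynomial $$P_t^n(z)=e^{-\frac{t}{2\alpha n}\partial_z^2}P^n(z):=\sum_{k=0}^\infty \frac{(-\frac{t}{2\alpha n})^k}{k!}\,\partial_z^{2k}P^n(z)$$ (a terminating sum), where $\partial_z$ is the complex derivative. The empirical zero distribution is $\mu_{n,t}=\frac{1}{\alpha n}\sum_{\lambda:\,P_t^n(\lambda)=0}\delta_\lambda$, zeros counted with multiplicity; the same definitions apply to $\tilde P^n$. *)

theory Defs
  imports "HOL-Probability.Probability" "HOL-Computational_Algebra.Polynomial"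
begin

text \<open>The operator \<open>exp (- s \<partial>\<^sup>2)\<close> on polynomials: the terms of the exponential series with
  \<open>k > degree p\<close> vanish, so the finite sum below is the whole series.\<close>

definition heat_evolution :: "complex \<Rightarrow> complex poly \<Rightarrow> complex poly" where
  "heat_evolution s p = (\<Sum>k\<le>degree p. smult ((- s) ^ k / fact k) ((pderiv ^^ (2 * k)) p))"

text \<open>The Borel measure \<open>(1/N) \<Sum> \<delta>\<^sub>z\<close>, summed over the zeros \<open>z\<close> of \<open>p\<close> repeated according to
  multiplicity (\<open>order z p\<close>).\<close>

definition zero_distribution :: "nat \<Rightarrow> complex poly \<Rightarrow> complex measure" where
  "zero_distribution N p =
     distr (point_measure {z. poly p z = 0} (\<lambda>z. ennreal (real (order z p) / real N)))
       borel (\<lambda>z. z)"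

text \<open>With \<open>Q\<close> the sequence of polynomials \<open>n \<mapsto> P\<^sup>n\<close> and \<open>a = degree P\<close>, this is the
  distribution \<open>\<mu>\<^bsub>n,t\<^esub>\<close>. The time is rescaled by \<open>2 a n\<close>; the value at \<open>n = 0\<close> is irrelevant.\<close>

definition empirical_zeros :: "nat \<Rightarrow> (nat \<Rightarrow> complex poly) \<Rightarrow> complex \<Rightarrow> nat \<Rightarrow> complex measure" where
  "empirical_zeros a Q t n =
     zero_distribution (a * n) (heat_evolution (t / (2 * of_nat a * of_nat n)) (Q n))"

definition borel_prob :: "'a::topological_space measure \<Rightarrow> bool" where
  "borel_prob M \<longleftrightarrow> prob_space M \<and> sets M = sets borel"

text \<open>Weak convergence to a Borel probability measure, tested against bounded continuous functions;
  the library notion \<^const>\<open>weak_conv_m\<close> only covers measures on the real line.\<close>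

definition weakly_converges ::
    "(nat \<Rightarrow> 'a::topological_space measure) \<Rightarrow> 'a measure \<Rightarrow> bool" where
  "weakly_converges M L \<longleftrightarrow> borel_prob L \<and>
     (\<forall>f::'a \<Rightarrow> real. continuous_on UNIV f \<longrightarrow> bounded (range f) \<longrightarrow>
        (\<lambda>n. \<integral>x. f x \<partial>M n) \<longlonglongrightarrow> (\<integral>x. f x \<partial>L))"

definition measure_support :: "'a::topological_space measure \<Rightarrow> 'a set" where
  "measure_support M = {x. \<forall>U. open U \<longrightarrow> x \<in> U \<longrightarrow> emeasure M U > 0}"

definition mutually_singular :: "'a measure \<Rightarrow> 'a measure \<Rightarrow> bool" where
  "mutually_singular M N \<longleftrightarrow> sets M = sets N \<and>
     (\<exists>A\<in>sets M. emeasure M A = 0 \<and> emeasure N (space N - A) = 0)"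

end

theory Submission
  imports Defs "HOL-Computational_Algebra.Computational_Algebra"
    "HOL-Complex_Analysis.Complex_Analysis"
begin

text \<open>Formally \<open>P\<^sub>t\<^sup>n(z)\<close> is a Gaussian integral \<open>\<integral> F z y ^ n dy\<close> with
  \<open>F z y = P(y) exp (a (y - z)\<^sup>2 / (2 t))\<close>, but no contour has to be deformed. Let \<open>y\<^sub>0, \<dots>, y\<^sub>d\<close>
  be the saddle points, i.e. the critical points of \<open>F z\<close> other than the zeros of \<open>P\<close>, and let
  \<open>\<ell>\<^sub>j\<close> be their Lagrange polynomials. The value \<open>x\<^sub>j(n)\<close> at \<open>z\<close> of the heat evolution of
  \<open>\<ell>\<^sub>j P\<^sup>n\<close> satisfies \<open>x\<^sub>j(n + 1) = F z y\<^sub>j x\<^sub>j(n) + O(1/n) \<bar>x(n)\<bar>\<close>, so if the moduli of the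
  \<open>F z y\<^sub>j\<close> differ, then by Poincare's theorem on perturbed linear recurrences one saddle
  dominates and the logarithmic derivatives of \<open>P\<^sub>t\<^sup>n\<close> converge at \<open>z\<close>. This covers an open set
  with negligible complement. The zeros are uniformly bounded by the coincidence theorem of Grace
  and Walsh. Averaging contour integrals of these Cauchy transforms over translates of small
  squares turns their almost everywhere convergence into weak convergence of the zero
  distributions. The limits of the Cauchy transforms are holomorphic on the open set, which
  therefore has measure zero under the limiting distribution: hence singularity.\<close>

section \<open>Heat evolution of polynomials\<close>

text \<open>The recurrence rests on one identity, \<open>poly_heat_shift_mult\<close>, the algebraic
  form of integration by parts. Applied to multiples of \<open>q\<close>, it shows that multiples of
  the saddle polynomial contribute only O(1/n). Multiplication by a polynomial thus acts, up to that
  error, on a quotient of dimension d + 1 in which the Lagrange polynomials are simultaneous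
  eigenvectors.

  Poincare's theorem works at one z at a time and does not tell which saddle dominates, so
  holomorphy of the limit needs its own argument: (1/n) ln V is Lipschitz in z uniformly in n, hence
  the dominating branch cannot switch as long as the moduli of F stay distinct.

  The exceptional set is small because the logarithmic derivative of F along a branch y of saddle
  points is -(a/t)(y - z). The quotient of the values of F on two distinct branches therefore has a
  nonvanishing derivative.

  Cauchy transforms of the zero distributions have no common integrable majorant; the local
  integrability of 1/z in the plane, in the form of uniform tail bounds, is what allows passing to
  the limit under the integrals.\<close>

lemma higher_pderiv_eq_0: "degree p < k \<Longrightarrow> (pderiv ^^ k) p = (0::complex poly)"
proof (induction k arbitrary: p)
  case (Suc k)
  show ?case
  proof (cases "degree p = 0")
    case True
    then have "pderiv p = 0" by (simp add: pderiv_eq_0_iff)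
    then show ?thesis by (simp add: funpow_Suc_right del: funpow.simps)
  next
    case False
    then have "degree (pderiv p) < k" using Suc.prems by (simp add: degree_pderiv)
    then show ?thesis using Suc.IH[of "pderiv p"] by (simp add: funpow_Suc_right del: funpow.simps)
  qed
qed auto

text \<open>Leibniz's rule with a linear factor, whose second derivative vanishes. At
  \<open>k = 0\<close> the truncated \<open>k - 1\<close> is harmless because its coefficient is
  0.\<close>

lemma higher_pderiv_x_mult:
  "(pderiv ^^ k) ([:0,1:] * p) = [:0,1:] * (pderiv ^^ k) p + smult (of_nat k) ((pderiv ^^ (k - 1)) (p::complex poly))"
proof (induction k)
  case (Suc k)
  show ?case
  proof (cases k)
    case 0 then show ?thesis by (simp add: pderiv_mult pderiv_pCons)
  next
    case (Suc l)
    have "pderiv (smult (of_nat k) ((pderiv ^^ (k - 1)) p)) = smult (of_nat k) ((pderiv ^^ k) p)"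
      using Suc by (simp add: pderiv_smult)
    moreover have "pderiv ([:0,1:] * (pderiv ^^ k) p) = [:0,1:] * (pderiv ^^ Suc k) p + (pderiv ^^ k) p"
      by (simp add: pderiv_mult pderiv_pCons)
    ultimately show ?thesis using Suc.IH
      by (simp add: pderiv_add smult_add_left algebra_simps)
  qed
qed simp

text \<open>The bound of the defining sum depends on the polynomial. A common larger bound makes
  additivity and commutation with \<open>pderiv\<close> termwise identities.\<close>

lemma heat_evolution_eq_sum:
  assumes "degree p \<le> K"
  shows "heat_evolution s p = (\<Sum>k\<le>K. smult ((- s) ^ k / fact k) ((pderiv ^^ (2 * k)) p))"
proof -
  have "(\<Sum>k\<le>K. smult ((- s) ^ k / fact k) ((pderiv ^^ (2 * k)) p)) =
    (\<Sum>k\<le>degree p. smult ((- s) ^ k / fact k) ((pderiv ^^ (2 * k)) p))"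
    by (rule sum.mono_neutral_right) (use assms in \<open>auto simp: higher_pderiv_eq_0\<close>)
  then show ?thesis by (simp add: heat_evolution_def)
qed

lemma heat_evolution_add: "heat_evolution s (p + q) = heat_evolution s p + heat_evolution s q"
proof -
  define K where "K = max (degree p) (degree q)"
  have "degree (p+q) \<le> K" "degree p \<le> K" "degree q \<le> K"
    by (auto simp: K_def degree_add_le_max)
  then show ?thesis
    by (simp add: heat_evolution_eq_sum[of _ K] higher_pderiv_add smult_add_right sum.distrib)
qed

lemma smult_sum_right: "smult c (\<Sum>i\<in>I. f i) = (\<Sum>i\<in>I. smult c (f i))"
  by (induction I rule: infinite_finite_induct) (auto simp: smult_add_right)

lemma heat_evolution_smult: "heat_evolution s (smult c p) = smult c (heat_evolution s p)"
proof -
  have "degree (smult c p) \<le> degree p" by simp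
  then show ?thesis
    by (simp add: heat_evolution_eq_sum[of _ "degree p"] higher_pderiv_smult smult_sum_right mult.commute)
qed

lemma heat_evolution_0 [simp]: "heat_evolution s 0 = 0"
  by (simp add: heat_evolution_def)

lemma heat_evolution_sum: "heat_evolution s (\<Sum>i\<in>I. f i) = (\<Sum>i\<in>I. heat_evolution s (f i))"
  by (induction I rule: infinite_finite_induct) (auto simp: heat_evolution_add)

lemma pderiv_sum': "pderiv (\<Sum>i\<in>I. f i) = (\<Sum>i\<in>I. pderiv (f i))"
  by (induction I rule: infinite_finite_induct) (auto simp: pderiv_add)

lemma heat_evolution_pderiv: "heat_evolution s (pderiv p) = pderiv (heat_evolution s p)"
proof -
  have "degree (pderiv p) \<le> degree p" by (simp add: degree_pderiv)
  then have "heat_evolution s (pderiv p) = (\<Sum>k\<le>degree p. smult ((- s) ^ k / fact k) ((pderiv ^^ (2 * k)) (pderiv p)))"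
    by (rule heat_evolution_eq_sum)
  also have "\<dots> = pderiv (heat_evolution s p)"
    by (simp add: heat_evolution_def pderiv_sum' pderiv_smult flip: funpow_swap1)
  finally show ?thesis .
qed

text \<open>The commutator of D^2 with multiplication by x is 2 D, so conjugating multiplication by
  x with exp(-s D^2) turns it into x - 2 s D.\<close>

lemma heat_evolution_x_mult:
  "heat_evolution s ([:0,1:] * p) = [:0,1:] * heat_evolution s p - smult (2 * s) (pderiv (heat_evolution s p))"
proof -
  define K where "K = Suc (degree p)"
  have d: "degree ([:0,1:] * p) \<le> Suc K" "degree p \<le> K" "degree p \<le> Suc K" "degree (pderiv p) \<le> K"
    by (auto simp: K_def degree_pderiv intro!: order.trans[OF degree_mult_le])
  have "heat_evolution s ([:0,1:] * p) = [:0,1:] * heat_evolution s p +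
     (\<Sum>k\<le>Suc K. smult ((- s) ^ k / fact k * of_nat (2 * k)) ((pderiv ^^ (2 * k - 1)) p))"
    using d by (simp only: heat_evolution_eq_sum[of _ "Suc K"] higher_pderiv_x_mult smult_add_right
        sum.distrib sum_distrib_left mult_smult_right smult_smult)
  also have "(\<Sum>k\<le>Suc K. smult ((- s) ^ k / fact k * of_nat (2 * k)) ((pderiv ^^ (2 * k - 1)) p)) =
     (\<Sum>k\<le>K. smult ((- s) ^ Suc k / fact (Suc k) * of_nat (2 * Suc k)) ((pderiv ^^ (2 * Suc k - 1)) p))"
    by (subst sum.atMost_Suc_shift) simp
  also have "\<dots> = (\<Sum>k\<le>K. smult (- 2 * s) (smult ((- s) ^ k / fact k) ((pderiv ^^ (2 * k)) (pderiv p))))"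
  proof (rule sum.cong[OF refl])
    fix k
    have "(- s) ^ Suc k / fact (Suc k) * of_nat (2 * Suc k) = (- 2 * s) * ((- s) ^ k / fact k)"
    proof -
      have "fact (Suc k) = (of_nat (Suc k) * fact k :: complex)" by (rule fact_Suc)
      moreover have "of_nat (2 * Suc k) = (2 * of_nat (Suc k) :: complex)" by (simp only: of_nat_mult of_nat_numeral)
      moreover have "of_nat (Suc k) \<noteq> (0::complex)" by (rule of_nat_neq_0)
      ultimately show ?thesis by (simp add: field_simps del: of_nat_Suc)
    qed
    moreover have "(pderiv ^^ (2 * Suc k - 1)) p = (pderiv ^^ (2 * k)) (pderiv p)"
      by (simp add: funpow_swap1)
    ultimately show "smult ((- s) ^ Suc k / fact (Suc k) * of_nat (2 * Suc k)) ((pderiv ^^ (2 * Suc k - 1)) p) =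
      smult (- 2 * s) (smult ((- s) ^ k / fact k) ((pderiv ^^ (2 * k)) (pderiv p)))"
      by (simp only: smult_smult)
  qed
  also have "\<dots> = - smult (2 * s) (heat_evolution s (pderiv p))"
    using d by (simp only: heat_evolution_eq_sum[of _ K] smult_sum_right) (simp add: sum_negf)
  finally show ?thesis by (simp add: heat_evolution_pderiv)
qed

lemma degree_heat_diff:
  assumes "degree p > 0"
  shows "degree (heat_evolution s p - p) < degree p"
proof -
  have "heat_evolution s p - p = (\<Sum>k\<in>{1..degree p}. smult ((- s) ^ k / fact k) ((pderiv ^^ (2 * k)) p))"
  proof -
    have "{..degree p} = insert 0 {1..degree p}" by auto
    then show ?thesis by (simp add: heat_evolution_def)
  qed
  moreover have "degree \<dots> \<le> degree p - 1"
    by (intro degree_sum_le) (auto simp: degree_higher_pderiv intro!: order.trans[OF degree_smult_le])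
  ultimately show ?thesis using assms by simp
qed

lemma degree_heat_evolution [simp]: "degree (heat_evolution s p) = degree p"
proof (cases "degree p = 0")
  case True then show ?thesis by (simp add: heat_evolution_def)
next
  case False
  then show ?thesis
    using degree_add_eq_right[of "heat_evolution s p - p" p] degree_heat_diff[of p s] by simp
qed

lemma lead_coeff_heat_evolution [simp]: "lead_coeff (heat_evolution s p) = lead_coeff p"
proof (cases "degree p = 0")
  case True then show ?thesis by (simp add: heat_evolution_def)
next
  case False
  have "coeff (heat_evolution s p - p) (degree p) = 0"
    using degree_heat_diff[of p s] False by (intro coeff_eq_0) auto
  then show ?thesis by (simp add: coeff_diff)
qed

lemma heat_evolution_time_0 [simp]: "heat_evolution 0 p = p"
proof -
  have "{..degree p} = insert 0 {1..degree p}" by auto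
  moreover have "(\<Sum>k\<in>{1..degree p}. smult ((- 0) ^ k / fact k) ((pderiv ^^ (2 * k)) p)) = 0"
    by (intro sum.neutral) auto
  ultimately show ?thesis by (simp add: heat_evolution_def)
qed

lemma heat_evolution_1 [simp]: "heat_evolution s 1 = 1"
  by (simp add: heat_evolution_def)

lemma has_field_derivative_heat_time:
  "((\<lambda>s. poly (heat_evolution s p) z) has_field_derivative
     - poly (heat_evolution s (pderiv (pderiv p))) z) (at s)"
proof -
  define c where "c = (\<lambda>k. poly ((pderiv ^^ (2 * k)) p) z)"
  define K where "K = degree p"
  have eq: "(\<lambda>s. poly (heat_evolution s p) z) = (\<lambda>s. \<Sum>k\<le>Suc K. (- s) ^ k / fact k * c k)"
    by (simp add: heat_evolution_eq_sum[of p "Suc K"] K_def c_def poly_sum del: sum.atMost_Suc)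
  have summand: "((\<lambda>s. (- s) ^ k / fact k * c k) has_field_derivative
      - (of_nat k * (- s) ^ (k - 1) / fact k * c k)) (at s)" for k
    by (auto intro!: derivative_eq_intros)
  have "((\<lambda>s. \<Sum>k\<le>Suc K. (- s) ^ k / fact k * c k) has_field_derivative
      (\<Sum>k\<le>Suc K. - (of_nat k * (- s) ^ (k - 1) / fact k * c k))) (at s)"
    by (intro DERIV_sum summand)
  also have "(\<Sum>k\<le>Suc K. - (of_nat k * (- s) ^ (k - 1) / fact k * c k)) =
     (\<Sum>k\<le>K. - (of_nat (Suc k) * (- s) ^ k / fact (Suc k) * c (Suc k)))"
    by (subst sum.atMost_Suc_shift) simp
  also have "\<dots> = (\<Sum>k\<le>K. - ((- s) ^ k / fact k * c (Suc k)))"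
  proof (rule sum.cong[OF refl])
    fix k
    have "of_nat (Suc k) / fact (Suc k) = (1 / fact k :: complex)"
      using of_nat_neq_0[of k, where ?'a=complex] by (simp only: fact_Suc) (simp del: of_nat_Suc)
    then have "of_nat (Suc k) * (- s) ^ k / fact (Suc k) = (- s) ^ k / fact k"
      by (metis (no_types) mult.commute mult.right_neutral times_divide_eq_left times_divide_eq_right)
    then show "- (of_nat (Suc k) * (- s) ^ k / fact (Suc k) * c (Suc k)) = - ((- s) ^ k / fact k * c (Suc k))"
      by simp
  qed
  also have "\<dots> = - poly (heat_evolution s (pderiv (pderiv p))) z"
  proof -
    have "degree (pderiv (pderiv p)) \<le> K" by (simp add: K_def degree_pderiv)
    then show ?thesis
      by (simp add: heat_evolution_eq_sum[of "pderiv (pderiv p)" K] poly_sum sum_negf c_def funpow_swap1)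
  qed
  finally show ?thesis unfolding eq .
qed

text \<open>The factor \<open>[:-z,1:]\<close> vanishes at the evaluation point, so only the
  derivative term of \<open>heat_evolution_x_mult\<close> survives. This is integration by parts
  against a Gaussian kernel centred at z.\<close>

lemma poly_heat_shift_mult:
  "poly (heat_evolution s ([:-z,1:] * f)) z = - 2 * s * poly (heat_evolution s (pderiv f)) z"
proof -
  have "[:-z,1:] * f = [:0,1:] * f + smult (-z) f" by simp
  then have "heat_evolution s ([:-z,1:] * f) = [:0,1:] * heat_evolution s f
     - smult (2 * s) (pderiv (heat_evolution s f)) + smult (-z) (heat_evolution s f)"
    by (simp only: heat_evolution_add heat_evolution_smult heat_evolution_x_mult)
  then show ?thesis by (simp add: heat_evolution_pderiv)
qed

section \<open>Poincare's theorem for diagonal recurrences\<close>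

text \<open>Once \<open>e n\<close> stays below \<open>\<epsilon> * (1 - q)\<close>, the excess of
  \<open>u\<close> over the level \<open>\<epsilon>\<close> shrinks by the factor \<open>q\<close>
  in every step.\<close>

lemma perturbed_contraction_tendsto_0:
  fixes u e :: "nat \<Rightarrow> real"
  assumes u: "\<And>n. n \<ge> n0 \<Longrightarrow> 0 \<le> u n" and q: "0 \<le> q" "q < 1" and e: "e \<longlonglongrightarrow> 0"
    and step: "\<And>n. n \<ge> n0 \<Longrightarrow> u (Suc n) \<le> q * u n + e n"
  shows "u \<longlonglongrightarrow> 0"
proof (rule LIMSEQ_I)
  fix r :: real assume r: "0 < r"
  define \<epsilon> where "\<epsilon> = r / 2"
  have \<epsilon>: "\<epsilon> > 0" using r by (simp add: \<epsilon>_def)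
  have "eventually (\<lambda>n. e n < \<epsilon> * (1 - q)) sequentially"
    using e q \<epsilon> by (intro order_tendstoD(2)[OF e]) auto
  then obtain n1 where n1: "\<And>n. n \<ge> n1 \<Longrightarrow> e n < \<epsilon> * (1 - q)"
    by (auto simp: eventually_sequentially)
  define m where "m = max n0 n1"
  have dec: "u (m + k) - \<epsilon> \<le> q ^ k * \<bar>u m - \<epsilon>\<bar>" for k
  proof (induction k)
    case (Suc k)
    have "u (m + Suc k) - \<epsilon> \<le> q * (u (m + k) - \<epsilon>)"
    proof -
      have "n0 \<le> m + k" "n1 \<le> m + k" by (auto simp: m_def)
      then show ?thesis using step[of "m + k"] n1[of "m + k"] by (simp add: algebra_simps)
    qed
    also have "\<dots> \<le> q * (q ^ k * \<bar>u m - \<epsilon>\<bar>)"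
      using Suc q by (intro mult_left_mono) auto
    finally show ?case by (simp add: mult.assoc)
  qed simp
  have "(\<lambda>k. q ^ k * \<bar>u m - \<epsilon>\<bar>) \<longlonglongrightarrow> 0"
    using q by (intro tendsto_mult_left_zero LIMSEQ_power_zero) auto
  then have "eventually (\<lambda>k. q ^ k * \<bar>u m - \<epsilon>\<bar> < \<epsilon>) sequentially"
    using \<epsilon> by (rule order_tendstoD(2))
  then obtain k0 where k0: "\<And>k. k \<ge> k0 \<Longrightarrow> q ^ k * \<bar>u m - \<epsilon>\<bar> < \<epsilon>"
    by (auto simp: eventually_sequentially)
  show "\<exists>no. \<forall>n\<ge>no. norm (u n - 0) < r"
  proof (intro exI allI impI)
    fix n assume n: "n \<ge> m + k0"
    then have "k0 \<le> n - m" by simp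
    then have "u (m + (n - m)) - \<epsilon> < \<epsilon>" using dec[of "n - m"] k0[of "n - m"] by linarith
    then have "u n < r" using n by (simp add: \<epsilon>_def)
    moreover have "0 \<le> u n" using n u by (simp add: m_def)
    ultimately show "norm (u n - 0) < r" by simp
  qed
qed

text \<open>Boundedness forces the decay: a late value of at least \<open>r\<close> would gain more
  than \<open>\<epsilon>\<close> in every step and exceed 1. The expansion gains at least
  \<open>r * (q - 1) = 2 * \<epsilon>\<close>, and the perturbation takes less than half of
  it.\<close>

lemma perturbed_expansion_tendsto_0:
  fixes u e :: "nat \<Rightarrow> real"
  assumes u: "\<And>n. n \<ge> n0 \<Longrightarrow> 0 \<le> u n" "\<And>n. n \<ge> n0 \<Longrightarrow> u n \<le> 1" and q: "1 < q" and e: "e \<longlonglongrightarrow> 0"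
    and step: "\<And>n. n \<ge> n0 \<Longrightarrow> q * u n - e n \<le> u (Suc n)"
  shows "u \<longlonglongrightarrow> 0"
proof (rule LIMSEQ_I)
  fix r :: real assume r: "0 < r"
  define \<epsilon> where "\<epsilon> = r * (q - 1) / 2"
  have \<epsilon>: "\<epsilon> > 0" using r q by (simp add: \<epsilon>_def)
  obtain n1 where n1: "\<And>n. n \<ge> n1 \<Longrightarrow> e n < \<epsilon>"
    using order_tendstoD(2)[OF e \<epsilon>] by (auto simp: eventually_sequentially)
  have "u n < r" if n: "n \<ge> max n0 n1" for n
  proof (rule ccontr)
    assume "\<not> u n < r"
    have grow: "u (n + k) \<ge> r + real k * \<epsilon>" for k
    proof (induction k)
      case (Suc k)
      have "r * (q - 1) \<le> u (n + k) * (q - 1)"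
        using Suc q \<epsilon> by (intro mult_right_mono) (auto intro: order.trans[rotated])
      then have "q * u (n + k) \<ge> u (n + k) + 2 * \<epsilon>" by (simp add: \<epsilon>_def field_simps)
      moreover have "q * u (n + k) - e (n + k) \<le> u (n + Suc k)" "e (n + k) < \<epsilon>"
        using step[of "n + k"] n1[of "n + k"] n by auto
      moreover have "real (Suc k) * \<epsilon> = real k * \<epsilon> + \<epsilon>" by (simp add: algebra_simps)
      ultimately show ?case using Suc by linarith
    qed (use \<open>\<not> u n < r\<close> in simp)
    obtain k :: nat where "1 < real k * \<epsilon>" using reals_Archimedean3[OF \<epsilon>] by blast
    with grow[of k] u(2)[of "n + k"] n r show False by simp
  qed
  then show "\<exists>no. \<forall>n\<ge>no. norm (u n - 0) < r" using u(1) by (intro exI[of _ "max n0 n1"]) auto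
qed

text \<open>Stolz-Cesaro with denominators n; it converts limits of growth ratios into exponential
  rates.\<close>

lemma cesaro_increments:
  fixes u :: "nat \<Rightarrow> real"
  assumes "(\<lambda>n. u (Suc n) - u n) \<longlonglongrightarrow> l"
  shows "(\<lambda>n. u n / real n) \<longlonglongrightarrow> l"
proof (rule LIMSEQ_I)
  fix r :: real assume r: "0 < r"
  obtain m where m: "\<And>n. n \<ge> m \<Longrightarrow> \<bar>u (Suc n) - u n - l\<bar> < r / 2"
    using LIMSEQ_D[OF assms, of "r/2"] r by auto
  have lin: "\<bar>u (m + k) - u m - real k * l\<bar> \<le> real k * (r / 2)" for k
  proof (induction k)
    case (Suc k)
    have "real (Suc k) * l = real k * l + l" "real (Suc k) * (r / 2) = real k * (r / 2) + r / 2"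
      by (simp_all add: algebra_simps)
    moreover have "\<bar>u (m + Suc k) - u (m + k) - l\<bar> < r / 2" using m[of "m + k"] by simp
    ultimately show ?case using Suc by linarith
  qed simp
  define C where "C = \<bar>u m - real m * l\<bar>"
  obtain k0 :: nat where k0: "2 * C / r < real k0" using reals_Archimedean2 by blast
  show "\<exists>no. \<forall>n\<ge>no. norm (u n / real n - l) < r"
  proof (intro exI allI impI)
    fix n assume n: "n \<ge> max (m + 1) k0"
    have "\<bar>u n - real n * l\<bar> \<le> C + real (n - m) * (r / 2)"
    proof -
      have "real n * l = real (n - m) * l + real m * l" using n by (simp add: of_nat_diff algebra_simps)
      moreover have "m + (n - m) = n" using n by simp
      then have "\<bar>u n - u m - real (n - m) * l\<bar> \<le> real (n - m) * (r / 2)" using lin[of "n - m"] by metis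
      ultimately show ?thesis unfolding C_def by linarith
    qed
    also have "\<dots> \<le> C + real n * (r / 2)" using r by simp
    also have "C < real n * (r / 2)"
    proof -
      have "2 * C / r < real n" using k0 n by linarith
      then show ?thesis using r by (simp add: field_simps)
    qed
    finally have "\<bar>u n - real n * l\<bar> < real n * r" by linarith
    moreover have "u n / real n - l = (u n - real n * l) / real n" using n by (simp add: field_simps)
    then have "norm (u n / real n - l) = \<bar>u n - real n * l\<bar> / real n" by simp
    moreover have "real n > 0" using n by simp
    ultimately show "norm (u n / real n - l) < r"
      by (metis mult.commute pos_divide_less_eq)
  qed
qed

text \<open>Follow the index \<open>f n\<close> of a largest component. When the error is small
  compared with the gaps, the multiplier at \<open>f n\<close> cannot decrease in modulus, so the
  index stabilises at some \<open>i\<close>. Measured against component \<open>i\<close>, the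
  components with smaller multiplier contract, and those with larger multiplier expand while
  remaining bounded by 1; both kinds tend to 0. The winner need not have the largest
  multiplier.\<close>

theorem poincare_diagonal:
  fixes x :: "nat \<Rightarrow> nat \<Rightarrow> complex" and c :: "nat \<Rightarrow> complex" and \<eta> :: "nat \<Rightarrow> real"
  assumes dist: "\<And>i j. i \<le> d \<Longrightarrow> j \<le> d \<Longrightarrow> i \<noteq> j \<Longrightarrow> cmod (c i) \<noteq> cmod (c j)"
    and nz: "\<And>i. i \<le> d \<Longrightarrow> c i \<noteq> 0"
    and pos: "\<And>n. n \<ge> 1 \<Longrightarrow> \<exists>j\<le>d. x n j \<noteq> 0"
    and \<eta>: "\<eta> \<longlonglongrightarrow> 0"
    and step: "\<And>n j. n \<ge> 1 \<Longrightarrow> j \<le> d \<Longrightarrow> cmod (x (Suc n) j - c j * x n j) \<le> \<eta> n * (\<Sum>k\<le>d. cmod (x n k))"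
  shows "\<exists>i\<le>d. (\<forall>j\<le>d. j \<noteq> i \<longrightarrow> (\<lambda>n. x n j / x n i) \<longlonglongrightarrow> 0) \<and>
    eventually (\<lambda>n. x n i \<noteq> 0) sequentially \<and>
    (\<lambda>n. ln (cmod (x n i)) / real n) \<longlonglongrightarrow> ln (cmod (c i))"
proof -
  define M where "M n = Max ((\<lambda>j. cmod (x n j)) ` {..d})" for n
  have le_M: "cmod (x n j) \<le> M n" if "j \<le> d" for n j using that by (auto simp: M_def)
  have M_pos: "M n > 0" if n: "n \<ge> 1" for n
  proof -
    obtain j where "j \<le> d" "x n j \<noteq> 0" using pos n by blast
    then show ?thesis using le_M[of j n] by (meson less_le_trans zero_less_norm_iff)
  qed
  have "\<exists>j\<le>d. cmod (x n j) = M n" for n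
  proof -
    have "M n \<in> (\<lambda>j. cmod (x n j)) ` {..d}" unfolding M_def by (intro Max_in) auto
    then show ?thesis by force
  qed
  then obtain f where f: "\<And>n. f n \<le> d" "\<And>n. cmod (x n (f n)) = M n" by metis
  define e where "e n = real (Suc d) * \<bar>\<eta> n\<bar>" for n
  have e: "e \<longlonglongrightarrow> 0" unfolding e_def using \<eta> by (intro tendsto_mult_right_zero) (simp add: tendsto_rabs_zero)
  have e_nn: "e n \<ge> 0" for n by (simp add: e_def)
  have step': "cmod (x (Suc n) j - c j * x n j) \<le> e n * M n" if "n \<ge> 1" "j \<le> d" for n j
  proof -
    have "(\<Sum>k\<le>d. cmod (x n k)) \<le> (\<Sum>k\<le>d. M n)" by (intro sum_mono le_M) auto
    then have s: "(\<Sum>k\<le>d. cmod (x n k)) \<le> real (Suc d) * M n" by simp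
    have "cmod (x (Suc n) j - c j * x n j) \<le> \<eta> n * (\<Sum>k\<le>d. cmod (x n k))" using step that by blast
    also have "\<dots> \<le> \<bar>\<eta> n\<bar> * (\<Sum>k\<le>d. cmod (x n k))" by (intro mult_right_mono sum_nonneg) auto
    also have "\<dots> \<le> \<bar>\<eta> n\<bar> * (real (Suc d) * M n)" using s by (intro mult_left_mono) auto
    finally show ?thesis by (simp add: e_def mult_ac)
  qed
  have up: "cmod (x (Suc n) j) \<le> cmod (c j) * cmod (x n j) + e n * M n" if "n \<ge> 1" "j \<le> d" for n j
    using step'[OF that] norm_triangle_ineq2[of "x (Suc n) j" "c j * x n j"] by (simp add: norm_mult)
  have lo: "cmod (x (Suc n) j) \<ge> cmod (c j) * cmod (x n j) - e n * M n" if "n \<ge> 1" "j \<le> d" for n j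
    using step'[OF that] norm_triangle_ineq2[of "c j * x n j" "x (Suc n) j"] by (simp add: norm_mult norm_minus_commute)
  define G where "G = insert 1 ((\<lambda>i. cmod (c i)) ` {..d} \<union> (\<lambda>(i, j). \<bar>cmod (c i) - cmod (c j)\<bar>) ` {(i, j). i \<le> d \<and> j \<le> d \<and> i \<noteq> j})"
  have fin: "finite {(i::nat, j). i \<le> d \<and> j \<le> d \<and> i \<noteq> j}"
    by (rule finite_subset[of _ "{..d} \<times> {..d}"]) auto
  have "finite G" unfolding G_def using fin by blast
  moreover have "G \<noteq> {}" "\<forall>g\<in>G. g > 0" unfolding G_def using dist nz by auto
  ultimately have "Min G > 0" by simp
  \<comment> \<open>A third of the smallest gap or modulus: two errors below
    \<open>\<delta>\<close>, as they occur in \<open>mono\<close>, still leave a strict gap, and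
    \<open>cmod (c i) - \<delta>\<close> stays positive.\<close>
  define \<delta> where "\<delta> = Min G / 3"
  have \<delta>: "\<delta> > 0" using \<open>Min G > 0\<close> by (simp add: \<delta>_def)
  have \<delta>_le: "3 * \<delta> \<le> cmod (c i)" if "i \<le> d" for i
  proof -
    have "cmod (c i) \<in> G" using that by (auto simp: G_def)
    then have "Min G \<le> cmod (c i)" using \<open>finite G\<close> by (intro Min_le)
    then show ?thesis by (simp add: \<delta>_def)
  qed
  have \<delta>_gap: "3 * \<delta> \<le> \<bar>cmod (c i) - cmod (c j)\<bar>" if "i \<le> d" "j \<le> d" "i \<noteq> j" for i j
  proof -
    have "\<bar>cmod (c i) - cmod (c j)\<bar> \<in> G" using that by (auto simp: G_def)
    then have "Min G \<le> \<bar>cmod (c i) - cmod (c j)\<bar>" using \<open>finite G\<close> by (intro Min_le)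
    then show ?thesis by (simp add: \<delta>_def)
  qed
  obtain N where N: "N \<ge> 1" "\<And>n. n \<ge> N \<Longrightarrow> e n < \<delta>"
  proof -
    have "eventually (\<lambda>n. e n < \<delta>) sequentially" using e \<delta> by (rule order_tendstoD(2))
    then obtain N0 where "\<And>n. n \<ge> N0 \<Longrightarrow> e n < \<delta>" by (auto simp: eventually_sequentially)
    then show ?thesis using that[of "max 1 N0"] by auto
  qed
  \<comment> \<open>If the maximum passed to an index with a smaller multiplier, the old largest
    component would have grown strictly more than the new one and would still exceed it.\<close>
  have mono: "cmod (c (f n)) \<le> cmod (c (f (Suc n)))" if n: "n \<ge> N" for n
  proof (rule ccontr)
    assume "\<not> ?thesis"
    then have lt: "cmod (c (f (Suc n))) < cmod (c (f n))" by simp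
    then have ne: "f n \<noteq> f (Suc n)" by auto
    have g: "cmod (c (f (Suc n))) + 3 * \<delta> \<le> cmod (c (f n))" using \<delta>_gap[OF f(1) f(1) ne] lt by simp
    have n1: "n \<ge> 1" using n N by simp
    have "cmod (x (Suc n) (f (Suc n))) \<le> cmod (c (f (Suc n))) * M n + e n * M n"
      using up[OF n1 f(1)[of "Suc n"]] le_M[OF f(1)[of "Suc n"], of n]
      by (meson add_right_mono mult_left_mono norm_ge_zero order_trans)
    also have "\<dots> < cmod (c (f n)) * M n - e n * M n"
    proof -
      have "cmod (c (f (Suc n))) + 2 * e n < cmod (c (f n))" using g N(2)[OF n] \<delta> by linarith
      then have "(cmod (c (f (Suc n))) + 2 * e n) * M n < cmod (c (f n)) * M n"
        using M_pos[OF n1] by (intro mult_strict_right_mono)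
      then show ?thesis by (simp add: algebra_simps)
    qed
    also have "\<dots> \<le> cmod (x (Suc n) (f n))" using lo[OF n1 f(1)[of n]] f(2)[of n] by simp
    also have "\<dots> \<le> cmod (x (Suc n) (f (Suc n)))" using le_M[OF f(1)[of n], of "Suc n"] f(2)[of "Suc n"] by simp
    finally show False by simp
  qed
  have mono': "cmod (c (f m)) \<le> cmod (c (f n))" if "N \<le> m" "m \<le> n" for m n
    using that(2,1) by (induction n rule: dec_induct) (auto intro: order_trans mono)
  \<comment> \<open>A nondecreasing sequence with finitely many values is constant once it reaches
    its maximum; since the moduli are distinct, the index itself is then fixed.\<close>
  define S where "S = (\<lambda>n. cmod (c (f n))) ` {N..}"
  have "S \<subseteq> (\<lambda>i. cmod (c i)) ` {..d}" using f(1) by (auto simp: S_def)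
  then have "finite S" by (rule finite_subset) auto
  moreover have "S \<noteq> {}" by (auto simp: S_def)
  ultimately have "Max S \<in> S" by simp
  then obtain n0 where n0: "n0 \<ge> N" "cmod (c (f n0)) = Max S" by (auto simp: S_def)
  define i where "i = f n0"
  have i: "i \<le> d" using f by (simp add: i_def)
  have fi: "f n = i" if n: "n \<ge> n0" for n
  proof -
    have "cmod (c (f n)) \<le> Max S" using \<open>finite S\<close> n n0 by (auto simp: S_def)
    moreover have "Max S \<le> cmod (c (f n))" using mono'[OF n0(1) n] n0(2) by simp
    ultimately have "cmod (c (f n)) = cmod (c i)" using n0(2) by (simp add: i_def)
    then show ?thesis using dist[OF f(1) i] by blast
  qed
  have xi: "cmod (x n i) = M n" if "n \<ge> n0" for n using f(2)[of n] fi[OF that] by simp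
  have ge1: "n \<ge> 1" if "n \<ge> n0" for n using that n0 N by linarith
  have xi_pos: "cmod (x n i) > 0" if "n \<ge> n0" for n using xi[OF that] M_pos ge1[OF that] by simp
  have b3: "3 * \<delta> \<le> cmod (c i)" using \<delta>_le i by blast
  have bup: "cmod (x (Suc n) i) \<le> (cmod (c i) + e n) * cmod (x n i)" if "n \<ge> n0" for n
    using up[OF ge1[OF that] i] xi[OF that] by (simp add: algebra_simps)
  have blo: "cmod (x (Suc n) i) \<ge> (cmod (c i) - e n) * cmod (x n i)" if "n \<ge> n0" for n
    using lo[OF ge1[OF that] i] xi[OF that] by (simp add: algebra_simps)
  have e\<delta>: "e n < \<delta>" if "n \<ge> n0" for n using that n0 N by auto
  have ratio: "(\<lambda>n. x n j / x n i) \<longlonglongrightarrow> 0" if j: "j \<le> d" "j \<noteq> i" for j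
  proof -
    define u where "u n = cmod (x n j) / cmod (x n i)" for n
    have u0: "0 \<le> u n" for n by (simp add: u_def)
    have u1: "u n \<le> 1" if "n \<ge> n0" for n
      using le_M[OF j(1), of n] xi[OF that] xi_pos[OF that] by (simp add: u_def)
    have xj: "cmod (x n j) = u n * cmod (x n i)" if "n \<ge> n0" for n using xi_pos[OF that] by (simp add: u_def)
    have "u \<longlonglongrightarrow> 0"
    proof (cases "cmod (c j) < cmod (c i)")
      case True
      then have g: "cmod (c j) + 3 * \<delta> \<le> cmod (c i)" using \<delta>_gap[OF j(1) i j(2)] by simp
      define q where "q = cmod (c j) / (cmod (c i) - \<delta>)"
      have p: "cmod (c i) - \<delta> > 0" using g \<delta> norm_ge_zero[of "c j"] by linarith
      have q: "0 \<le> q" "q < 1" using g \<delta> p by (auto simp: q_def)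
      show ?thesis
      proof (rule perturbed_contraction_tendsto_0[where q = q and e = "\<lambda>n. e n / (cmod (c i) - \<delta>)" and ?n0.0 = n0])
        show "(\<lambda>n. e n / (cmod (c i) - \<delta>)) \<longlonglongrightarrow> 0" using e by (rule tendsto_divide_zero)
        fix n assume n: "n \<ge> n0"
        have p: "cmod (c i) - \<delta> > 0" using g \<delta> norm_ge_zero[of "c j"] by linarith
        have "cmod (x (Suc n) j) \<le> (cmod (c j) * u n + e n) * cmod (x n i)"
          using up[OF ge1[OF n] j(1)] xi[OF n] xj[OF n] by (simp add: algebra_simps)
        moreover have "cmod (x (Suc n) i) \<ge> (cmod (c i) - \<delta>) * cmod (x n i)"
          using blo[OF n] e\<delta>[OF n] by (meson diff_left_mono less_eq_real_def mult_right_mono norm_ge_zero order_trans)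
        ultimately have "u (Suc n) \<le> ((cmod (c j) * u n + e n) * cmod (x n i)) / ((cmod (c i) - \<delta>) * cmod (x n i))"
          unfolding u_def[of "Suc n"] using p xi_pos[OF n] u0[of n] e_nn[of n] by (intro frac_le) auto
        also have "\<dots> = q * u n + e n / (cmod (c i) - \<delta>)"
          using xi_pos[OF n] p by (simp add: q_def add_divide_distrib)
        finally show "u (Suc n) \<le> q * u n + e n / (cmod (c i) - \<delta>)" .
      qed (use q u0 in auto)
    next
      \<comment> \<open>Relative to component \<open>i\<close> this component expands by
        \<open>q > 1\<close>, yet the ratio never exceeds 1 because component \<open>i\<close> is
        largest.\<close>
      case False
      then have g: "cmod (c i) + 3 * \<delta> \<le> cmod (c j)" using \<delta>_gap[OF j(1) i j(2)] dist[OF j(1) i j(2)] by simp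
      define q where "q = cmod (c j) / (cmod (c i) + \<delta>)"
      have p: "cmod (c i) + \<delta> > 0" using \<delta> by (simp add: add_nonneg_pos)
      have q: "1 < q" using g \<delta> p by (auto simp: q_def field_simps)
      show ?thesis
      proof (rule perturbed_expansion_tendsto_0[where q = q and e = "\<lambda>n. e n / (cmod (c i) - \<delta>)" and ?n0.0 = n0])
        show "(\<lambda>n. e n / (cmod (c i) - \<delta>)) \<longlonglongrightarrow> 0" using e by (rule tendsto_divide_zero)
        fix n assume n: "n \<ge> n0"
        have p2: "cmod (c i) - \<delta> > 0" using b3 \<delta> by linarith
        have l: "cmod (x (Suc n) j) \<ge> (cmod (c j) * u n - e n) * cmod (x n i)"
          using lo[OF ge1[OF n] j(1)] xi[OF n] xj[OF n] by (simp add: algebra_simps)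
        have r: "cmod (x (Suc n) i) \<le> (cmod (c i) + \<delta>) * cmod (x n i)"
          using bup[OF n] e\<delta>[OF n] by (meson add_left_mono less_eq_real_def mult_right_mono norm_ge_zero order_trans)
        have r2: "cmod (x (Suc n) i) \<ge> (cmod (c i) - \<delta>) * cmod (x n i)"
          using blo[OF n] e\<delta>[OF n] by (meson diff_left_mono less_eq_real_def mult_right_mono norm_ge_zero order_trans)
        have n': "Suc n \<ge> n0" using n by simp
        have a1: "q * u n \<le> cmod (c j) * u n * cmod (x n i) / cmod (x (Suc n) i)"
        proof -
          have "q * u n = cmod (c j) * u n * cmod (x n i) / ((cmod (c i) + \<delta>) * cmod (x n i))"
            using xi_pos[OF n] by (simp add: q_def)
          also have "\<dots> \<le> cmod (c j) * u n * cmod (x n i) / cmod (x (Suc n) i)"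
            using r xi_pos[OF n'] p xi_pos[OF n] u0[of n] by (intro divide_left_mono mult_pos_pos mult_nonneg_nonneg) auto
          finally show ?thesis .
        qed
        have a2: "e n * cmod (x n i) / cmod (x (Suc n) i) \<le> e n / (cmod (c i) - \<delta>)"
        proof -
          have "e n * cmod (x n i) / cmod (x (Suc n) i) \<le> e n * cmod (x n i) / ((cmod (c i) - \<delta>) * cmod (x n i))"
            using r2 p2 xi_pos[OF n] xi_pos[OF n'] e_nn[of n] by (intro divide_left_mono mult_pos_pos mult_nonneg_nonneg) auto
          also have "\<dots> = e n / (cmod (c i) - \<delta>)" using xi_pos[OF n] by simp
          finally show ?thesis .
        qed
        have "(cmod (c j) * u n - e n) * cmod (x n i) / cmod (x (Suc n) i) \<le> u (Suc n)"
          unfolding u_def[of "Suc n"] using l xi_pos[OF n'] by (intro divide_right_mono) auto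
        then show "q * u n - e n / (cmod (c i) - \<delta>) \<le> u (Suc n)"
          using a1 a2 by (simp add: left_diff_distrib diff_divide_distrib)
      qed (use q u0 u1 in auto)
    qed
    then show ?thesis by (subst tendsto_norm_zero_iff[symmetric]) (simp add: u_def[abs_def] norm_divide)
  qed
  have "(\<lambda>n. ln (cmod (x (Suc n) i)) - ln (cmod (x n i))) \<longlonglongrightarrow> ln (cmod (c i))"
  proof -
    have ev: "eventually (\<lambda>n. n \<ge> n0) sequentially" by (rule eventually_ge_at_top)
    have "(\<lambda>n. cmod (x (Suc n) i) / cmod (x n i)) \<longlonglongrightarrow> cmod (c i)"
    proof (rule tendsto_sandwich)
      show "(\<lambda>n. cmod (c i) - e n) \<longlonglongrightarrow> cmod (c i)" using tendsto_diff[OF tendsto_const e] by simp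
      show "(\<lambda>n. cmod (c i) + e n) \<longlonglongrightarrow> cmod (c i)" using tendsto_add[OF tendsto_const e] by simp
      show "eventually (\<lambda>n. cmod (c i) - e n \<le> cmod (x (Suc n) i) / cmod (x n i)) sequentially"
        using ev by eventually_elim (use blo xi_pos in \<open>simp add: pos_le_divide_eq\<close>)
      show "eventually (\<lambda>n. cmod (x (Suc n) i) / cmod (x n i) \<le> cmod (c i) + e n) sequentially"
        using ev by eventually_elim (use bup xi_pos in \<open>simp add: pos_divide_le_eq\<close>)
    qed
    then have "(\<lambda>n. ln (cmod (x (Suc n) i) / cmod (x n i))) \<longlonglongrightarrow> ln (cmod (c i))"
      using nz[OF i] by (intro tendsto_ln) auto
    then show ?thesis
      by (rule Lim_transform_eventually) (use ev in eventually_elim, use xi_pos in \<open>auto simp: ln_div\<close>)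
  qed
  then have "(\<lambda>n. ln (cmod (x n i)) / real n) \<longlonglongrightarrow> ln (cmod (c i))" by (rule cesaro_increments)
  moreover have "eventually (\<lambda>n. x n i \<noteq> 0) sequentially"
    unfolding eventually_sequentially using xi_pos by (metis norm_zero less_irrefl)
  ultimately show ?thesis using i ratio by blast
qed

section \<open>Saddle point asymptotics without contours\<close>

text \<open>The squared Euclidean norm \<open>S\<close> is differentiable, unlike the sum or the
  maximum of the moduli. Each of the d + 1 summands of its derivative is at most
  \<open>2 * B * S\<close>, whence the constant \<open>K\<close>; \<open>T\<close> is
  \<open>S\<close> times the integrating factor.\<close>

lemma gronwall_l2:
  fixes f f' :: "nat \<Rightarrow> real \<Rightarrow> complex"
  assumes deriv: "\<And>k x. k \<le> d \<Longrightarrow> 0 \<le> x \<Longrightarrow> x \<le> 1 \<Longrightarrow> (f k has_vector_derivative f' k x) (at x)"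
    and bound: "\<And>k x. k \<le> d \<Longrightarrow> 0 \<le> x \<Longrightarrow> x \<le> 1 \<Longrightarrow>
       cmod (f' k x) \<le> B * sqrt (\<Sum>j\<le>d. cmod (f j x) ^ 2)"
    and s: "0 \<le> s" "s \<le> 1" and B: "0 \<le> B"
  shows "sqrt (\<Sum>j\<le>d. cmod (f j s) ^ 2) \<le> exp (real (d + 1) * B) * sqrt (\<Sum>j\<le>d. cmod (f j 0) ^ 2)"
proof -
  define S where "S x = (\<Sum>j\<le>d. cmod (f j x) ^ 2)" for x
  define K where "K = real (d + 1) * B"
  define S' where "S' x = (\<Sum>j\<le>d. 2 * (Re (f j x) * Re (f' j x) + Im (f j x) * Im (f' j x)))" for x
  have K: "0 \<le> K" using B by (simp add: K_def)
  have S_nn: "S x \<ge> 0" for x by (simp add: S_def sum_nonneg)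
  have dS: "(S has_real_derivative S' x) (at x)" if "0 \<le> x" "x \<le> 1" for x
  proof -
    have "((\<lambda>x. Re (f j x) ^ 2 + Im (f j x) ^ 2) has_real_derivative
        2 * (Re (f j x) * Re (f' j x) + Im (f j x) * Im (f' j x))) (at x)" if j: "j \<le> d" for j
    proof -
      have D: "(f j has_vector_derivative f' j x) (at x)" using deriv j \<open>0 \<le> x\<close> \<open>x \<le> 1\<close> by blast
      have "((\<lambda>x. Re (f j x)) has_real_derivative Re (f' j x)) (at x)" "((\<lambda>x. Im (f j x)) has_real_derivative Im (f' j x)) (at x)"
        using bounded_linear.has_vector_derivative[OF bounded_linear_Re D] bounded_linear.has_vector_derivative[OF bounded_linear_Im D]
        by (simp_all add: has_real_derivative_iff_has_vector_derivative)
      moreover have "((\<lambda>x. u x ^ 2 + v x ^ 2) has_real_derivative 2 * (u x * u' + v x * v')) (at x)"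
        if "(u has_real_derivative u') (at x)" "(v has_real_derivative v') (at x)" for u v :: "real \<Rightarrow> real" and u' v'
        using that by (auto intro!: derivative_eq_intros simp: algebra_simps)
      ultimately show ?thesis by blast
    qed
    then show ?thesis unfolding S_def[abs_def] S'_def cmod_power2 by (intro DERIV_sum) auto
  qed
  have S'_le: "S' x \<le> 2 * K * S x" if "0 \<le> x" "x \<le> 1" for x
  proof -
    have "2 * (Re (f j x) * Re (f' j x) + Im (f j x) * Im (f' j x)) \<le> 2 * (B * S x)" if j: "j \<le> d" for j
    proof -
      have "Re (f j x) * Re (f' j x) + Im (f j x) * Im (f' j x) = Re (cnj (f j x) * f' j x)" by simp
      also have "\<dots> \<le> cmod (f j x) * cmod (f' j x)" by (metis complex_Re_le_cmod complex_mod_cnj norm_mult)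
      also have "\<dots> \<le> sqrt (S x) * (B * sqrt (S x))"
      proof (intro mult_mono)
        have "cmod (f j x) ^ 2 \<le> S x" unfolding S_def using j by (intro member_le_sum) auto
        then show "cmod (f j x) \<le> sqrt (S x)" by (rule real_le_rsqrt)
        show "cmod (f' j x) \<le> B * sqrt (S x)" unfolding S_def using bound j that \<open>0 \<le> x\<close> \<open>x \<le> 1\<close> by blast
      qed (auto simp: S_nn)
      also have "\<dots> = B * S x" using real_sqrt_mult_self[of "S x"] S_nn[of x] by (simp add: mult_ac)
      finally show ?thesis by simp
    qed
    then have "S' x \<le> (\<Sum>j\<le>d. 2 * (B * S x))" unfolding S'_def by (intro sum_mono) auto
    then show ?thesis by (simp add: K_def algebra_simps)
  qed
  define T where "T x = S x * exp (- 2 * K * x)" for x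
  have "T s \<le> T 0"
  proof (rule DERIV_nonpos_imp_nonincreasing[of 0 s T])
    fix x assume x: "0 \<le> x" "x \<le> s"
    then have x1: "x \<le> 1" using s by simp
    have "(T has_real_derivative (S' x - 2 * K * S x) * exp (- 2 * K * x)) (at x)"
      unfolding T_def[abs_def] using dS[OF x(1) x1] by (auto intro!: derivative_eq_intros simp: algebra_simps)
    moreover have "(S' x - 2 * K * S x) * exp (- 2 * K * x) \<le> 0"
      using S'_le[OF x(1) x1] by (intro mult_nonpos_nonneg) auto
    ultimately show "\<exists>y. (T has_real_derivative y) (at x) \<and> y \<le> 0" by blast
  qed (use s in auto)
  then have "S s * exp (- 2 * K * s) \<le> S 0" by (simp add: T_def)
  then have "S s \<le> exp (2 * K * s) * S 0" by (simp add: exp_minus field_simps)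
  also have "\<dots> \<le> exp (2 * K) * S 0" using s K by (intro mult_right_mono S_nn) (auto simp: mult_left_le)
  finally have "sqrt (S s) \<le> sqrt (exp (2 * K) * S 0)" by simp
  also have "\<dots> = exp K * sqrt (S 0)"
  proof -
    have "exp (2 * K) = exp K ^ 2" by (simp add: power2_eq_square flip: exp_add)
    then show ?thesis by (simp add: real_sqrt_mult)
  qed
  finally show ?thesis by (simp add: S_def K_def)
qed

section \<open>Evaluation functionals and their control by finitely many moments\<close>

text \<open>\<open>q\<close> is the radical of \<open>P\<close> and \<open>r / q\<close> its logarithmic derivative in lowest terms.\<close>

locale heat_power =
  fixes P q r :: "complex poly" and a d :: nat and t :: complex
  assumes t: "t \<noteq> 0" and a: "a \<ge> 1" and deg_P: "degree P = a" and lead_P: "lead_coeff P = 1"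
    and deg_q: "degree q = d" and lead_q: "lead_coeff q = 1" and deg_r: "degree r < d"
    and log_deriv: "q * pderiv P = r * P"
    and coprime: "\<And>y. poly q y = 0 \<Longrightarrow> poly r y \<noteq> 0"
    and zero_P: "\<And>y. poly P y = 0 \<Longrightarrow> poly q y = 0"
begin

lemma q_nz: "q \<noteq> 0" using lead_q by auto
lemma P_nz: "P \<noteq> 0" using lead_P by auto

text \<open>The real shift \<open>s\<close> interpolates between the times belonging to \<open>n\<close> and \<open>n + 1\<close>: the recurrence
  in \<open>n\<close> combines multiplication by \<open>P\<close> with this change of time.\<close>

definition ev :: "nat \<Rightarrow> real \<Rightarrow> complex \<Rightarrow> complex poly \<Rightarrow> complex" where
  "ev n s z g = poly (heat_evolution (t / (2 * of_nat a * of_real (real n + s))) (g * P ^ n)) z"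

lemma ev_add: "ev n s z (g + h) = ev n s z g + ev n s z h"
  by (simp add: ev_def distrib_right heat_evolution_add)

lemma ev_smult: "ev n s z (smult c g) = c * ev n s z g"
  by (simp add: ev_def heat_evolution_smult)

lemma ev_diff: "ev n s z (g - h) = ev n s z g - ev n s z h"
  using ev_add[of n s z "g - h" h] by simp

lemma ev_sum: "ev n s z (\<Sum>i\<in>I. g i) = (\<Sum>i\<in>I. ev n s z (g i))"
  by (simp add: ev_def sum_distrib_right heat_evolution_sum poly_sum)

lemma ev_shift: "ev n s z ([:-z, 1:] * g) = ev n s z ([:0, 1:] * g) - z * ev n s z g"
proof -
  have "[:-z, 1:] * g = [:0, 1:] * g - smult z g" by simp
  then show ?thesis by (simp only: ev_diff ev_smult)
qed

text \<open>Integration by parts in the formal integral. The factor \<open>q\<close> clears the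
  denominator of the logarithmic derivative of \<open>P\<close>, so that differentiating
  \<open>q * u * P ^ n\<close> leaves a polynomial times \<open>P ^ n\<close>. The terms of order n
  add up to the saddle polynomial times \<open>u\<close>.\<close>

lemma ev_parts:
  assumes n: "n \<ge> 1" and s: "s \<ge> 0"
  shows "of_nat a * of_real (real n + s) * ev n s z ([:-z, 1:] * (q * u)) + t * ev n s z (pderiv (q * u))
     + t * of_nat n * ev n s z (r * u) = 0"
proof -
  define \<nu> where "\<nu> = (of_real (real n + s) :: complex)"
  have \<nu>: "\<nu> \<noteq> 0" using n s unfolding \<nu>_def by (subst of_real_eq_0_iff) linarith
  obtain m where m: "n = Suc m" using n by (cases n) auto
  have "pderiv (q * u * P ^ n) = pderiv (q * u) * P ^ n + q * u * (smult (of_nat n) (P ^ m * pderiv P))"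
    unfolding m pderiv_mult[of "q * u"] pderiv_power_Suc by (simp add: algebra_simps)
  also have "q * u * (smult (of_nat n) (P ^ m * pderiv P)) = smult (of_nat n) (u * P ^ m * (q * pderiv P))"
    by (simp add: mult_ac)
  also have "\<dots> = smult (of_nat n) (r * u) * P ^ n"
    unfolding log_deriv m by (simp add: mult_ac)
  finally have der: "pderiv (q * u * P ^ n) = (pderiv (q * u) + smult (of_nat n) (r * u)) * P ^ n"
    by (simp only: distrib_right)
  have "ev n s z ([:-z, 1:] * (q * u)) = - 2 * (t / (2 * of_nat a * \<nu>)) * ev n s z (pderiv (q * u) + smult (of_nat n) (r * u))"
    unfolding ev_def \<nu>_def[symmetric] der[symmetric] poly_heat_shift_mult[symmetric] by (simp only: mult.assoc)
  then have "of_nat a * \<nu> * ev n s z ([:-z, 1:] * (q * u)) = - t * (ev n s z (pderiv (q * u)) + of_nat n * ev n s z (r * u))"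
    using \<nu> a by (simp add: ev_add ev_smult)
  then show ?thesis unfolding \<nu>_def[symmetric] by (simp add: algebra_simps)
qed

lemma ev_deriv_z:
  assumes "n \<ge> 1" "s \<ge> 0"
  shows "((\<lambda>z. ev n s z g) has_field_derivative
     - (of_nat a * of_real (real n + s) / t) * ev n s z ([:-z, 1:] * g)) (at z)"
proof -
  define \<nu> where "\<nu> = (of_real (real n + s) :: complex)"
  have \<nu>: "\<nu> \<noteq> 0" using assms unfolding \<nu>_def by (subst of_real_eq_0_iff) linarith
  have "ev n s z ([:-z, 1:] * g) = - 2 * (t / (2 * of_nat a * \<nu>)) * poly (pderiv (heat_evolution (t / (2 * of_nat a * \<nu>)) (g * P ^ n))) z"
    unfolding ev_def \<nu>_def[symmetric] mult.assoc poly_heat_shift_mult heat_evolution_pderiv ..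
  then have "- (of_nat a * \<nu> / t) * ev n s z ([:-z, 1:] * g) = poly (pderiv (heat_evolution (t / (2 * of_nat a * \<nu>)) (g * P ^ n))) z"
    using \<nu> a t by (simp add: field_simps)
  moreover have "((\<lambda>z. ev n s z g) has_field_derivative poly (pderiv (heat_evolution (t / (2 * of_nat a * \<nu>)) (g * P ^ n))) z) (at z)"
    unfolding ev_def \<nu>_def[symmetric] by (rule poly_DERIV)
  ultimately show ?thesis unfolding \<nu>_def[symmetric] by (simp only:)
qed

text \<open>The kernel behind \<open>ev\<close> is a normalised Gaussian. Differentiating its
  exponent brings down the square of y - z, and its normalising factor, a multiple of the square
  root of n + s, yields the second term. The proof obtains both from the heat equation by applying
  \<open>poly_heat_shift_mult\<close> twice.\<close>

lemma ev_deriv_s: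
  assumes "n \<ge> 1" "s \<ge> 0"
  shows "((\<lambda>s. ev n s z g) has_vector_derivative
     of_nat a / (2 * t) * ev n s z ([:-z, 1:] * ([:-z, 1:] * g)) + ev n s z g / (2 * of_real (real n + s))) (at s)"
proof -
  define \<nu> where "\<nu> = (of_real (real n + s) :: complex)"
  have \<nu>0: "real n + s \<noteq> 0" using assms by linarith
  then have \<nu>: "\<nu> \<noteq> 0" unfolding \<nu>_def by (subst of_real_eq_0_iff)
  define \<tau> where "\<tau> = t / (2 * of_nat a * \<nu>)"
  have \<tau>: "\<tau> \<noteq> 0" using \<nu> t a by (simp add: \<tau>_def)
  define f where "f = g * P ^ n"
  have d\<tau>: "((\<lambda>s. t / (2 * of_nat a * of_real (real n + s))) has_vector_derivative - (\<tau> / \<nu>)) (at s)"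
  proof -
    have eq: "of_nat n + of_real s = \<nu>" by (simp add: \<nu>_def)
    have "((\<lambda>x. of_nat n + x) has_field_derivative 1) (at (of_real s :: complex))"
      by (auto intro!: derivative_eq_intros)
    from DERIV_cmult[OF DERIV_inverse_fun[OF this], of "t / (2 * of_nat a)"]
    have "((\<lambda>x. t / (2 * of_nat a) * inverse (of_nat n + x)) has_field_derivative - (\<tau> / \<nu>)) (at (of_real s))"
      using \<nu> by (simp add: eq \<tau>_def field_simps)
    from has_vector_derivative_real_field[OF this] show ?thesis by (simp add: field_simps)
  qed
  have "((\<lambda>\<tau>. poly (heat_evolution \<tau> f) z) has_field_derivative
     - poly (heat_evolution \<tau> (pderiv (pderiv f))) z) (at (t / (2 * of_nat a * of_real (real n + s))))"
    using has_field_derivative_heat_time[of f z \<tau>] by (simp add: \<tau>_def \<nu>_def)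
  from field_vector_diff_chain_at[OF d\<tau> this]
  have D: "((\<lambda>s. ev n s z g) has_vector_derivative \<tau> / \<nu> * poly (heat_evolution \<tau> (pderiv (pderiv f))) z) (at s)"
    by (simp add: o_def ev_def f_def)
  have "poly (heat_evolution \<tau> ([:-z, 1:] * ([:-z, 1:] * f))) z = - 2 * \<tau> * poly (heat_evolution \<tau> (pderiv ([:-z, 1:] * f))) z"
    by (rule poly_heat_shift_mult)
  also have "pderiv ([:-z, 1:] * f) = [:-z, 1:] * pderiv f + f" by (subst pderiv_mult) (simp add: pderiv_pCons)
  also have "poly (heat_evolution \<tau> ([:-z, 1:] * pderiv f + f)) z = - 2 * \<tau> * poly (heat_evolution \<tau> (pderiv (pderiv f))) z + poly (heat_evolution \<tau> f) z"
    unfolding heat_evolution_add poly_add poly_heat_shift_mult ..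
  finally have E: "ev n s z ([:-z, 1:] * ([:-z, 1:] * g)) = - 2 * \<tau> * (- 2 * \<tau> * poly (heat_evolution \<tau> (pderiv (pderiv f))) z + ev n s z g)"
    unfolding ev_def f_def \<nu>_def[symmetric] \<tau>_def[symmetric] by (simp only: mult.assoc)
  have "of_nat a / (2 * t) = 1 / (4 * \<tau> * \<nu>)" using t a \<nu> by (simp add: \<tau>_def)
  then have "of_nat a / (2 * t) * ev n s z ([:-z, 1:] * ([:-z, 1:] * g)) + ev n s z g / (2 * \<nu>) =
     \<tau> / \<nu> * poly (heat_evolution \<tau> (pderiv (pderiv f))) z"
    unfolding E \<open>of_nat a / (2 * t) = _\<close> using \<tau> \<nu> by (simp add: field_simps)
  then show ?thesis using D unfolding \<nu>_def[symmetric] by simp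
qed

text \<open>A common yardstick for all values at z. The saddle polynomial has degree d + 1, so to
  leading order only d + 1 directions remain, and \<open>ev_dominated\<close> bounds every
  \<open>ev n s z g\<close> by this norm.\<close>

definition V :: "nat \<Rightarrow> real \<Rightarrow> complex \<Rightarrow> real" where
  "V n s z = sqrt (\<Sum>k\<le>d. cmod (ev n s z (monom 1 k)) ^ 2)"

lemma V_nonneg: "V n s z \<ge> 0" by (simp add: V_def sum_nonneg)

lemma ev_monom_le_V: "k \<le> d \<Longrightarrow> cmod (ev n s z (monom 1 k)) \<le> V n s z"
  unfolding V_def by (intro real_le_rsqrt member_le_sum) auto

definition dominated :: "real \<Rightarrow> complex poly \<Rightarrow> bool" where
  "dominated \<rho> g \<longleftrightarrow> (\<exists>C\<ge>0. \<forall>n s z. n \<ge> 1 \<longrightarrow> 0 \<le> s \<longrightarrow> s \<le> 1 \<longrightarrow> cmod z \<le> \<rho> \<longrightarrow> cmod (ev n s z g) \<le> C * V n s z)"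

lemma dominatedE:
  assumes "dominated \<rho> g"
  obtains C where "C \<ge> 0" "\<And>n s z. n \<ge> 1 \<Longrightarrow> 0 \<le> s \<Longrightarrow> s \<le> 1 \<Longrightarrow> cmod z \<le> \<rho> \<Longrightarrow> cmod (ev n s z g) \<le> C * V n s z"
  using assms unfolding dominated_def by blast

text \<open>Induction on the degree. A polynomial of degree \<open>k > d\<close> is reduced by the
  monic \<open>w = x q u\<close> of the same degree. By \<open>ev_parts\<close> its value is a
  combination of the values of q u, (q u)' and r u, all of smaller degree, with coefficients bounded
  by |z|, |t| / (a \<nu>) and |t| n / (a \<nu>), where \<nu> = n + s >= n.\<close>

lemma ev_dominated: "dominated \<rho> g"
proof (cases "\<rho> \<ge> 0")
  case False
  have "\<not> cmod z \<le> \<rho>" for z using False norm_ge_zero[of z] by linarith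
  then show ?thesis unfolding dominated_def by (intro exI[of _ 0]) auto
next
  case \<rho>: True
  show ?thesis
  proof (induction "degree g" arbitrary: g rule: less_induct)
    case less
    show ?case
    proof (cases "degree g \<le> d")
      case True
      have g: "g = (\<Sum>k\<le>d. smult (coeff g k) (monom 1 k))"
        using poly_as_sum_of_monoms'[OF True] by (simp add: smult_monom)
      have "cmod (ev n s z g) \<le> (\<Sum>k\<le>d. cmod (coeff g k)) * V n s z" for n s z
      proof -
        have "cmod (ev n s z g) \<le> (\<Sum>k\<le>d. cmod (coeff g k * ev n s z (monom 1 k)))"
          by (subst g, subst ev_sum, subst ev_smult) (rule norm_sum)
        also have "\<dots> \<le> (\<Sum>k\<le>d. cmod (coeff g k) * V n s z)"
          by (intro sum_mono) (auto simp: norm_mult intro!: mult_left_mono ev_monom_le_V)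
        finally show ?thesis by (simp add: sum_distrib_right)
      qed
      then show ?thesis unfolding dominated_def by (intro exI[of _ "\<Sum>k\<le>d. cmod (coeff g k)"]) (auto simp: sum_nonneg)
    next
      case False
      define k where "k = degree g"
      define u where "u = (monom 1 (k - d - 1) :: complex poly)"
      define w where "w = [:0, 1:] * (q * u)"
      have d1: "d \<ge> 1" using deg_r by simp
      have u: "degree u = k - d - 1" "lead_coeff u = 1" "u \<noteq> 0" by (auto simp: u_def degree_monom_eq)
      have "lead_coeff (q * u) = 1" unfolding lead_coeff_mult using u lead_q by simp
      then have qu: "degree (q * u) = k - 1" "lead_coeff (q * u) = 1" "q * u \<noteq> 0"
        using u q_nz lead_q deg_q False by (auto simp: degree_mult_eq k_def)
      have "lead_coeff w = 1"
        by (simp only: w_def lead_coeff_mult[of "[:0, 1:]" "q * u"] qu(2)) simp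
      then have w: "degree w = k" "lead_coeff w = 1"
        using qu False unfolding w_def by (auto simp: degree_mult_eq k_def simp del: mult_pCons_left)
      have dr: "degree (r * u) < k"
        using degree_mult_le[of r u] u deg_r False by (simp add: k_def)
      have dp: "degree (pderiv (q * u)) < k" using qu False by (simp add: degree_pderiv k_def)
      define g' where "g' = g - smult (lead_coeff g) w"
      have "degree g' < k"
      proof -
        have "degree g' \<le> k" unfolding g'_def using w by (intro degree_diff_le) (auto simp: k_def)
        moreover have "coeff g' k = 0" using w by (simp add: g'_def k_def)
        moreover have "k > 0" using False by (simp add: k_def)
        ultimately show ?thesis by (metis coeff_eq_0 degree_0 leading_coeff_0_iff le_neq_implies_less)
      qed
      then have "dominated \<rho> g'" using less.hyps by (simp add: k_def)
      then obtain C1 where C1: "C1 \<ge> 0" "\<And>n s z. n \<ge> 1 \<Longrightarrow> 0 \<le> s \<Longrightarrow> s \<le> 1 \<Longrightarrow> cmod z \<le> \<rho> \<Longrightarrow> cmod (ev n s z g') \<le> C1 * V n s z"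
        unfolding dominated_def by blast
      have "dominated \<rho> (q * u)" using less.hyps qu False by (simp add: k_def)
      then obtain C2 where C2: "C2 \<ge> 0" "\<And>n s z. n \<ge> 1 \<Longrightarrow> 0 \<le> s \<Longrightarrow> s \<le> 1 \<Longrightarrow> cmod z \<le> \<rho> \<Longrightarrow> cmod (ev n s z (q * u)) \<le> C2 * V n s z"
        unfolding dominated_def by blast
      have "dominated \<rho> (pderiv (q * u))" using less.hyps dp by (simp add: k_def)
      then obtain C3 where C3: "C3 \<ge> 0" "\<And>n s z. n \<ge> 1 \<Longrightarrow> 0 \<le> s \<Longrightarrow> s \<le> 1 \<Longrightarrow> cmod z \<le> \<rho> \<Longrightarrow> cmod (ev n s z (pderiv (q * u))) \<le> C3 * V n s z"
        unfolding dominated_def by blast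
      have "dominated \<rho> (r * u)" using less.hyps dr by (simp add: k_def)
      then obtain C4 where C4: "C4 \<ge> 0" "\<And>n s z. n \<ge> 1 \<Longrightarrow> 0 \<le> s \<Longrightarrow> s \<le> 1 \<Longrightarrow> cmod z \<le> \<rho> \<Longrightarrow> cmod (ev n s z (r * u)) \<le> C4 * V n s z"
        unfolding dominated_def by blast
      define C where "C = cmod (lead_coeff g) * (\<rho> * C2 + cmod t * (C3 + C4)) + C1"
      have "cmod (ev n s z g) \<le> C * V n s z" if h: "n \<ge> 1" "0 \<le> s" "s \<le> 1" "cmod z \<le> \<rho>" for n s z
      proof -
        define \<nu> where "\<nu> = (of_real (real n + s) :: complex)"
        have \<nu>0: "real n + s \<ge> 1" using h by linarith
        then have \<nu>1: "cmod \<nu> = real n + s" unfolding \<nu>_def norm_of_real by linarith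
        have \<nu>: "\<nu> \<noteq> 0" using \<nu>1 \<nu>0 by auto
        have "of_nat a * \<nu> * (ev n s z w - z * ev n s z (q * u)) + t * ev n s z (pderiv (q * u)) + t * of_nat n * ev n s z (r * u) = 0"
          using ev_parts[OF h(1,2), of z u] unfolding ev_shift w_def \<nu>_def .
        then have "of_nat a * \<nu> * ev n s z w = of_nat a * \<nu> * (z * ev n s z (q * u)) - t * (ev n s z (pderiv (q * u)) + of_nat n * ev n s z (r * u))"
          by algebra
        then have w_eq: "ev n s z w = z * ev n s z (q * u) - t / (of_nat a * \<nu>) * (ev n s z (pderiv (q * u)) + of_nat n * ev n s z (r * u))"
          using \<nu> a by (simp add: field_simps)
        have "cmod (ev n s z w) \<le> cmod z * cmod (ev n s z (q * u)) + cmod t / (real a * cmod \<nu>) * (cmod (ev n s z (pderiv (q * u))) + real n * cmod (ev n s z (r * u)))"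
        proof -
          have "cmod (ev n s z (pderiv (q * u)) + of_nat n * ev n s z (r * u)) \<le> cmod (ev n s z (pderiv (q * u))) + real n * cmod (ev n s z (r * u))"
            by (metis norm_mult norm_of_nat norm_triangle_ineq)
          then have "cmod (t / (of_nat a * \<nu>)) * cmod (ev n s z (pderiv (q * u)) + of_nat n * ev n s z (r * u))
              \<le> cmod (t / (of_nat a * \<nu>)) * (cmod (ev n s z (pderiv (q * u))) + real n * cmod (ev n s z (r * u)))"
            by (intro mult_left_mono) auto
          moreover have "cmod (t / (of_nat a * \<nu>)) = cmod t / (real a * cmod \<nu>)" by (simp add: norm_divide norm_mult)
          ultimately show ?thesis unfolding w_eq
            using norm_triangle_ineq4[of "z * ev n s z (q * u)" "t / (of_nat a * \<nu>) * (ev n s z (pderiv (q * u)) + of_nat n * ev n s z (r * u))"]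
            by (simp only: norm_mult)
        qed
        also have "\<dots> \<le> \<rho> * (C2 * V n s z) + cmod t / (real a * cmod \<nu>) * (real n * (C3 * V n s z) + real n * (C4 * V n s z))"
        proof (intro add_mono mult_mono mult_left_mono)
          have "cmod (ev n s z (pderiv (q * u))) \<le> 1 * (C3 * V n s z)" using C3 h by auto
          also have "\<dots> \<le> real n * (C3 * V n s z)" using h C3(1) V_nonneg[of n s z] by (intro mult_right_mono) auto
          finally show "cmod (ev n s z (pderiv (q * u))) \<le> real n * (C3 * V n s z)" .
        qed (use h C2 C4 \<rho> in auto)
        also have "\<dots> = \<rho> * (C2 * V n s z) + (real n / (real a * cmod \<nu>)) * (cmod t * (C3 + C4) * V n s z)"
          by (simp add: field_simps)
        also have "\<dots> \<le> \<rho> * (C2 * V n s z) + 1 * (cmod t * (C3 + C4) * V n s z)"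
        proof (intro add_left_mono mult_right_mono)
          have "real n \<le> 1 * cmod \<nu>" using \<nu>1 h by simp
          also have "\<dots> \<le> real a * cmod \<nu>" using a by (intro mult_right_mono) auto
          finally show "real n / (real a * cmod \<nu>) \<le> 1" using a \<nu> by (simp add: divide_le_eq)
        qed (use C3 C4 V_nonneg[of n s z] in auto)
        finally have w_le: "cmod (ev n s z w) \<le> (\<rho> * C2 + cmod t * (C3 + C4)) * V n s z" by (simp add: algebra_simps)
        have "ev n s z g = lead_coeff g * ev n s z w + ev n s z g'" by (simp add: g'_def ev_diff ev_smult)
        then have "cmod (ev n s z g) \<le> cmod (lead_coeff g) * cmod (ev n s z w) + cmod (ev n s z g')"
          by (metis norm_mult norm_triangle_ineq)
        also have "\<dots> \<le> cmod (lead_coeff g) * ((\<rho> * C2 + cmod t * (C3 + C4)) * V n s z) + C1 * V n s z"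
          using w_le C1 h by (intro add_mono mult_left_mono) auto
        finally show ?thesis by (simp add: C_def algebra_simps)
      qed
      moreover have "C \<ge> 0" using C1 C2 C3 C4 \<rho> by (simp add: C_def)
      ultimately show ?thesis unfolding dominated_def by blast
    qed
  qed
qed

text \<open>If \<open>V\<close> vanished, so would every \<open>ev n s z g\<close>. The polynomials
  all of whose multiples have heat evolution 0 at z are closed under differentiation, by
  \<open>poly_heat_shift_mult\<close> and \<tau> \<noteq> 0. Differentiating \<open>P ^ n\<close>
  down to a nonzero constant would put 1 among them, but the heat evolution of 1 is 1.\<close>

lemma V_pos:
  assumes n: "n \<ge> 1" and s: "0 \<le> s" "s \<le> 1"
  shows "V n s z > 0"
proof (rule ccontr)
  assume "\<not> ?thesis"
  then have V0: "V n s z = 0" using V_nonneg[of n s z] by simp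
  have ev0: "ev n s z g = 0" for g
    using dominatedE[OF ev_dominated[of "cmod z" g]] n s V0 by (metis mult_zero_right norm_le_zero_iff order_refl)
  define \<tau> where "\<tau> = t / (2 * of_nat a * of_real (real n + s))"
  have \<tau>: "\<tau> \<noteq> 0"
  proof -
    have "(of_real (real n + s) :: complex) \<noteq> 0" using n s by (subst of_real_eq_0_iff) linarith
    then show ?thesis using t a by (simp add: \<tau>_def)
  qed
  have step: "\<forall>h. poly (heat_evolution \<tau> (h * pderiv f)) z = 0" if f: "\<forall>h. poly (heat_evolution \<tau> (h * f)) z = 0" for f
  proof
    fix h
    have "poly (heat_evolution \<tau> ([:-z, 1:] * (h * f))) z = 0" using f by (metis mult.assoc)
    then have "poly (heat_evolution \<tau> (pderiv (h * f))) z = 0" using \<tau> unfolding poly_heat_shift_mult by simp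
    moreover have "pderiv (h * f) = h * pderiv f + pderiv h * f" by (simp add: pderiv_mult mult.commute)
    ultimately show "poly (heat_evolution \<tau> (h * pderiv f)) z = 0" using f by (simp add: heat_evolution_add)
  qed
  have iter: "\<forall>h. poly (heat_evolution \<tau> (h * (pderiv ^^ k) (P ^ n))) z = 0" for k
  proof (induction k)
    case 0 then show ?case using ev0 by (simp add: ev_def \<tau>_def)
  next
    case (Suc k) then show ?case using step[OF Suc] by simp
  qed
  define c where "c = (pderiv ^^ degree (P ^ n)) (P ^ n)"
  have "degree c = 0" by (simp add: c_def degree_higher_pderiv)
  then obtain c0 where c0: "c = [:c0:]" by (metis degree_eq_zeroE)
  have "coeff c 0 \<noteq> 0" unfolding c_def coeff_higher_pderiv
    using P_nz by (simp add: pochhammer_fact[symmetric] del: degree_power_eq)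
  then have "c0 \<noteq> 0" by (simp add: c0)
  then have "[:1 / c0:] * c = 1" by (simp add: c0 one_pCons)
  then have "poly (heat_evolution \<tau> 1) z = 0" using iter[of "degree (P ^ n)"] c_def by metis
  then show False by simp
qed

text \<open>The function (1/n) ln V is Lipschitz in z with a constant independent of n, which later
  makes the exponential rate continuous. A z-derivative costs exactly one factor n, and Gronwall's
  inequality is applied along the segment from z to w.\<close>

lemma V_lipschitz:
  "\<exists>C\<ge>0. \<forall>n z w. n \<ge> 1 \<longrightarrow> cmod z \<le> \<rho> \<longrightarrow> cmod w \<le> \<rho> \<longrightarrow> V n 0 w \<le> exp (real n * C * cmod (w - z)) * V n 0 z"
proof -
  have "\<exists>C\<ge>0. \<forall>n s z. n \<ge> 1 \<longrightarrow> 0 \<le> s \<longrightarrow> s \<le> 1 \<longrightarrow> cmod z \<le> \<rho> \<longrightarrow>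
      cmod (ev n s z ([:0, 1:] * monom 1 k)) + \<rho> * cmod (ev n s z (monom 1 k)) \<le> C * V n s z" for k
  proof (cases "\<rho> \<ge> 0")
    case True
    obtain C1 where C1: "C1 \<ge> 0" "\<And>n s z. n \<ge> 1 \<Longrightarrow> 0 \<le> s \<Longrightarrow> s \<le> 1 \<Longrightarrow> cmod z \<le> \<rho> \<Longrightarrow> cmod (ev n s z ([:0, 1:] * monom 1 k)) \<le> C1 * V n s z"
      using dominatedE[OF ev_dominated[of \<rho> "[:0, 1:] * monom 1 k"]] by blast
    obtain C2 where C2: "C2 \<ge> 0" "\<And>n s z. n \<ge> 1 \<Longrightarrow> 0 \<le> s \<Longrightarrow> s \<le> 1 \<Longrightarrow> cmod z \<le> \<rho> \<Longrightarrow> cmod (ev n s z (monom 1 k)) \<le> C2 * V n s z"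
      using dominatedE[OF ev_dominated[of \<rho> "monom 1 k"]] by blast
    show ?thesis
    proof (intro exI[of _ "C1 + \<rho> * C2"] conjI allI impI)
      fix n s z assume h: "n \<ge> (1::nat)" "0 \<le> (s::real)" "s \<le> 1" "cmod z \<le> \<rho>"
      have "cmod (ev n s z ([:0, 1:] * monom 1 k)) + \<rho> * cmod (ev n s z (monom 1 k)) \<le> C1 * V n s z + \<rho> * (C2 * V n s z)"
        using C1 C2 h True by (intro add_mono mult_left_mono) auto
      then show "cmod (ev n s z ([:0, 1:] * monom 1 k)) + \<rho> * cmod (ev n s z (monom 1 k)) \<le> (C1 + \<rho> * C2) * V n s z"
        by (simp add: algebra_simps)
    qed (use C1 C2 True in auto)
  next
    case False
    have "\<not> cmod z \<le> \<rho>" for z using False norm_ge_zero[of z] by linarith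
    then show ?thesis by (intro exI[of _ 0]) auto
  qed
  then obtain C where C: "\<And>k. C k \<ge> 0" "\<And>k n s z. n \<ge> 1 \<Longrightarrow> 0 \<le> s \<Longrightarrow> s \<le> 1 \<Longrightarrow> cmod z \<le> \<rho> \<Longrightarrow>
      cmod (ev n s z ([:0, 1:] * monom 1 k)) + \<rho> * cmod (ev n s z (monom 1 k)) \<le> C k * V n s z" by metis
  define D where "D = real a / cmod t * (\<Sum>k\<le>d. C k)"
  have D: "D \<ge> 0" unfolding D_def using C(1) by (intro mult_nonneg_nonneg sum_nonneg divide_nonneg_nonneg) auto
  show ?thesis
  proof (intro exI[of _ "real (d + 1) * D"] conjI allI impI)
    fix n z w assume n: "n \<ge> (1::nat)" and z: "cmod z \<le> \<rho>" and w: "cmod w \<le> \<rho>"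
    define \<gamma> where "\<gamma> x = z + of_real x * (w - z)" for x :: real
    have \<gamma>: "cmod (\<gamma> x) \<le> \<rho>" if "0 \<le> x" "x \<le> 1" for x
    proof -
      have "\<gamma> x \<in> closed_segment z w" unfolding in_segment \<gamma>_def using that
        by (intro exI[of _ x]) (simp add: algebra_simps scaleR_conv_of_real)
      moreover have "closed_segment z w \<subseteq> cball 0 \<rho>" using z w by (intro closed_segment_subset) auto
      ultimately show ?thesis by auto
    qed
    define f where "f k x = ev n 0 (\<gamma> x) (monom 1 k)" for k x
    define f' where "f' k x = (w - z) * (- (of_nat a * of_nat n / t) * ev n 0 (\<gamma> x) ([:-\<gamma> x, 1:] * monom 1 k))" for k x
    have "sqrt (\<Sum>j\<le>d. cmod (f j 1) ^ 2) \<le> exp (real (d + 1) * (real n * D * cmod (w - z))) * sqrt (\<Sum>j\<le>d. cmod (f j 0) ^ 2)"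
    proof (rule gronwall_l2[where f' = f'])
      fix k x assume k: "k \<le> d" and x: "0 \<le> x" "x \<le> (1::real)"
      have "(\<gamma> has_vector_derivative (w - z)) (at x)"
        unfolding \<gamma>_def[abs_def] by (auto intro!: derivative_eq_intros simp: scaleR_conv_of_real)
      from field_vector_diff_chain_at[OF this ev_deriv_z[OF n, of 0 "monom 1 k" "\<gamma> x"]]
      show "(f k has_vector_derivative f' k x) (at x)" by (simp add: f_def[abs_def] f'_def o_def)
      have "cmod (ev n 0 (\<gamma> x) ([:-\<gamma> x, 1:] * monom 1 k)) \<le> cmod (ev n 0 (\<gamma> x) ([:0, 1:] * monom 1 k)) + \<rho> * cmod (ev n 0 (\<gamma> x) (monom 1 k))"
        unfolding ev_shift using \<gamma>[OF x]
        by (intro order.trans[OF norm_triangle_ineq4] add_left_mono) (simp add: norm_mult mult_right_mono)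
      also have "\<dots> \<le> C k * V n 0 (\<gamma> x)" using C n \<gamma>[OF x] by auto
      also have "\<dots> \<le> (\<Sum>k\<le>d. C k) * V n 0 (\<gamma> x)"
        using C k V_nonneg by (intro mult_right_mono member_le_sum) auto
      finally have "cmod (f' k x) \<le> cmod (w - z) * (real a * real n / cmod t * ((\<Sum>k\<le>d. C k) * V n 0 (\<gamma> x)))"
        unfolding f'_def norm_mult by (intro mult_mono mult_left_mono) (auto simp: norm_divide norm_mult)
      then show "cmod (f' k x) \<le> (real n * D * cmod (w - z)) * sqrt (\<Sum>j\<le>d. cmod (f j x) ^ 2)"
        by (simp add: D_def f_def V_def mult_ac)
    qed (use D in auto)
    then show "V n 0 w \<le> exp (real n * (real (d + 1) * D) * cmod (w - z)) * V n 0 z"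
      by (simp add: V_def f_def \<gamma>_def mult_ac)
  qed (use D in auto)
qed

end

lemma unit_interval_mvt_bound:
  fixes f :: "real \<Rightarrow> complex"
  assumes deriv: "\<And>s. 0 \<le> s \<Longrightarrow> s \<le> 1 \<Longrightarrow> (f has_vector_derivative f' s) (at s)"
    and bound: "\<And>s. 0 \<le> s \<Longrightarrow> s \<le> 1 \<Longrightarrow> cmod (f' s) \<le> B"
  shows "cmod (f 1 - f 0) \<le> B"
proof -
  have "norm (f 1 - f 0) \<le> B * norm (1 - 0 :: real)"
  proof (rule differentiable_bound[where S = "{0..1}" and f' = "\<lambda>s x. x *\<^sub>R f' s"])
    fix s :: real assume s: "s \<in> {0..1}"
    have "(f has_vector_derivative f' s) (at s within {0..1})"
      by (rule has_vector_derivative_at_within, rule deriv) (use s in auto)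
    then show "(f has_derivative (\<lambda>x. x *\<^sub>R f' s)) (at s within {0..1})"
      by (simp add: has_vector_derivative_def)
    show "onorm (\<lambda>x. x *\<^sub>R f' s) \<le> B"
    proof (rule onorm_le)
      fix x :: real
      have "norm (x *\<^sub>R f' s) = norm x * cmod (f' s)" by simp
      also have "\<dots> \<le> norm x * B" using bound s by (intro mult_left_mono) auto
      also have "\<dots> = B * norm x" by (rule mult.commute)
      finally show "norm (x *\<^sub>R f' s) \<le> B * norm x" .
    qed
  qed auto
  then show ?thesis by simp
qed

section \<open>Lagrange interpolation\<close>

definition lagrange_basis :: "nat \<Rightarrow> (nat \<Rightarrow> complex) \<Rightarrow> nat \<Rightarrow> complex poly" where
  "lagrange_basis d y j = (\<Prod>i\<in>{..d} - {j}. smult (1 / (y j - y i)) [:- y i, 1:])"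

lemma degree_lagrange_basis: "j \<le> d \<Longrightarrow> degree (lagrange_basis d y j) \<le> d"
proof -
  assume j: "j \<le> d"
  have "degree (lagrange_basis d y j) \<le> (\<Sum>i\<in>{..d} - {j}. 1)"
    unfolding lagrange_basis_def
    by (intro order.trans[OF degree_prod_sum_le] sum_mono order.trans[OF degree_smult_le]) auto
  then show ?thesis using j by simp
qed

lemma poly_lagrange_basis:
  assumes "inj_on y {..d}" "i \<le> d" "j \<le> d"
  shows "poly (lagrange_basis d y j) (y i) = (if i = j then 1 else 0)"
proof (cases "i = j")
  case True
  have "poly (smult (1 / (y j - y k)) [:- y k, 1:]) (y j) = 1" if "k \<in> {..d} - {j}" for k
  proof -
    have "y j - y k \<noteq> 0" using inj_onD[OF assms(1), of j k] that assms by auto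
    moreover have "poly (smult c [:- y k, 1:]) (y j) = c * (y j - y k)" for c by (simp add: algebra_simps)
    ultimately show ?thesis by (simp only:) simp
  qed
  then have "(\<Prod>k\<in>{..d} - {j}. poly (smult (1 / (y j - y k)) [:- y k, 1:]) (y j)) = 1"
    by (rule prod.neutral[rule_format])
  then show ?thesis using True by (simp only: lagrange_basis_def poly_prod) simp
next
  case False
  then show ?thesis using assms by (auto simp: lagrange_basis_def poly_prod)
qed

lemma poly_eq_0_of_roots:
  fixes h :: "complex poly"
  assumes "inj_on y {..d}" "\<And>i. i \<le> d \<Longrightarrow> poly h (y i) = 0" "degree h \<le> d"
  shows "h = 0"
proof (rule ccontr)
  assume h: "h \<noteq> 0"
  have "card (y ` {..d}) \<le> card {x. poly h x = 0}"
    using assms(2) poly_roots_finite[OF h] by (intro card_mono) auto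
  then show False using card_poly_roots_bound[OF h] assms card_image[OF assms(1)] by simp
qed

lemma lagrange_interpolation:
  assumes "inj_on y {..d}" "degree g \<le> d"
  shows "g = (\<Sum>j\<le>d. smult (poly g (y j)) (lagrange_basis d y j))"
proof -
  define h where "h = g - (\<Sum>j\<le>d. smult (poly g (y j)) (lagrange_basis d y j))"
  have "h = 0"
  proof (rule poly_eq_0_of_roots[OF assms(1)])
    show "poly h (y i) = 0" if "i \<le> d" for i
      using that by (simp add: h_def poly_sum poly_lagrange_basis[OF assms(1)] if_distrib sum.delta cong: if_cong)
    show "degree h \<le> d" unfolding h_def
      by (intro degree_diff_le assms degree_sum_le order.trans[OF degree_smult_le degree_lagrange_basis]) auto
  qed
  then show ?thesis by (simp add: h_def)
qed

section \<open>The recurrence at the saddle points\<close>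

context heat_power
begin

lemma ev_dominated_at:
  "\<exists>C. C \<ge> 0 \<and> (\<forall>n s. n \<ge> 1 \<longrightarrow> 0 \<le> s \<longrightarrow> s \<le> 1 \<longrightarrow> cmod (ev n s z g) \<le> C * V n s z)"
proof -
  from ev_dominated[of "cmod z" g] obtain C where C: "C \<ge> 0"
    "\<forall>n s z'. n \<ge> 1 \<longrightarrow> 0 \<le> s \<longrightarrow> s \<le> 1 \<longrightarrow> cmod z' \<le> cmod z \<longrightarrow> cmod (ev n s z' g) \<le> C * V n s z'"
    unfolding dominated_def by blast
  show ?thesis by (rule exI[of _ C]) (use C in auto)
qed

text \<open>This is \<open>t * q\<close> times the logarithmic derivative of \<open>F z\<close> in
  y. Zeros of \<open>q\<close> are not among its roots, since \<open>r\<close> does not vanish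
  there.\<close>

definition saddle :: "complex \<Rightarrow> complex poly" where
  "saddle z = smult t r + smult (of_nat a) ([:-z, 1:] * q)"

definition F :: "complex \<Rightarrow> complex \<Rightarrow> complex" where
  "F z y = poly P y * exp (of_nat a * (y - z) ^ 2 / (2 * t))"

lemma degree_saddle: "degree (saddle z) = Suc d"
proof -
  have "degree ([:-z, 1:] * q) = Suc d" using q_nz deg_q by (subst degree_mult_eq) auto
  then have "degree (smult (of_nat a) ([:-z, 1:] * q)) = Suc d" using a by simp
  moreover have "degree (smult t r) < Suc d" using deg_r t by simp
  ultimately show ?thesis unfolding saddle_def by (simp add: degree_add_eq_right)
qed

lemma poly_saddle: "poly (saddle z) y = t * poly r y + of_nat a * (y - z) * poly q y"
  unfolding saddle_def by (simp only: poly_add poly_smult poly_mult) (simp add: algebra_simps)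

definition nodes :: "complex \<Rightarrow> (nat \<Rightarrow> complex) \<Rightarrow> bool" where
  "nodes z y \<longleftrightarrow> inj_on y {..d} \<and> (\<forall>i\<le>d. poly (saddle z) (y i) = 0)"

lemma F_nonzero: "poly (saddle z) y = 0 \<Longrightarrow> F z y \<noteq> 0"
  using coprime[of y] zero_P[of y] t by (auto simp: F_def poly_saddle)

lemma interpolation_remainder:
  assumes "nodes z y"
  obtains u where "g = (\<Sum>j\<le>d. smult (poly g (y j)) (lagrange_basis d y j)) + saddle z * u"
proof -
  have inj: "inj_on y {..d}" and R: "\<And>i. i \<le> d \<Longrightarrow> poly (saddle z) (y i) = 0"
    using assms by (auto simp: nodes_def)
  have "degree (g mod saddle z) \<le> d"
  proof (cases "g mod saddle z = 0")
    case False
    then have "degree (g mod saddle z) < Suc d"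
      using degree_mod_less[of "saddle z" g] degree_saddle[of z] by (metis degree_0 nat.distinct(1))
    then show ?thesis by simp
  qed simp
  then have "g mod saddle z = (\<Sum>j\<le>d. smult (poly (g mod saddle z) (y j)) (lagrange_basis d y j))"
    by (rule lagrange_interpolation[OF inj])
  also have "\<dots> = (\<Sum>j\<le>d. smult (poly g (y j)) (lagrange_basis d y j))"
  proof (rule sum.cong[OF refl])
    fix j assume "j \<in> {..d}"
    have "poly g (y j) = poly (saddle z * (g div saddle z) + g mod saddle z) (y j)" by simp
    also have "\<dots> = poly (g mod saddle z) (y j)" using R \<open>j \<in> {..d}\<close> by (simp only: poly_add poly_mult) auto
    finally show "smult (poly (g mod saddle z) (y j)) (lagrange_basis d y j) = smult (poly g (y j)) (lagrange_basis d y j)" by simp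
  qed
  finally have "g = (\<Sum>j\<le>d. smult (poly g (y j)) (lagrange_basis d y j)) + saddle z * (g div saddle z)"
    by (metis mult_div_mod_eq add.commute)
  then show ?thesis by (rule that)
qed

text \<open>After division with remainder by \<open>saddle z\<close>, the remainder is its own
  Lagrange interpolant. For the multiple \<open>saddle z * u\<close>, \<open>ev_parts\<close>
  expresses n times its value through values without the factor n, which are bounded by
  \<open>V\<close>.\<close>

lemma ev_interpolation:
  assumes "nodes z y"
  shows "\<exists>C\<ge>0. \<forall>n s. n \<ge> 1 \<longrightarrow> 0 \<le> s \<longrightarrow> s \<le> 1 \<longrightarrow>
    cmod (ev n s z g - (\<Sum>j\<le>d. poly g (y j) * ev n s z (lagrange_basis d y j))) \<le> C / real n * V n s z"
proof -
  obtain u where u: "g = (\<Sum>j\<le>d. smult (poly g (y j)) (lagrange_basis d y j)) + saddle z * u"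
    using interpolation_remainder[OF assms, of g] by blast
  from ev_dominated_at[of z "pderiv (q * u)"] obtain C1 where C1': "C1 \<ge> 0"
     "\<forall>n s. n \<ge> 1 \<longrightarrow> 0 \<le> s \<longrightarrow> s \<le> 1 \<longrightarrow> cmod (ev n s z (pderiv (q * u))) \<le> C1 * V n s z"
    by (elim exE conjE)
  note C1 = C1'(1) C1'(2)[rule_format]
  from ev_dominated_at[of z "[:-z, 1:] * (q * u)"] obtain C2 where C2': "C2 \<ge> 0"
     "\<forall>n s. n \<ge> 1 \<longrightarrow> 0 \<le> s \<longrightarrow> s \<le> 1 \<longrightarrow> cmod (ev n s z ([:-z, 1:] * (q * u))) \<le> C2 * V n s z"
    by (elim exE conjE)
  note C2 = C2'(1) C2'(2)[rule_format]
  define C where "C = cmod t * C1 + real a * C2"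
  show ?thesis
  proof (intro exI[of _ C] conjI allI impI)
    show "C \<ge> 0" using C1 C2 by (simp add: C_def)
    fix n and s :: real assume h: "n \<ge> (1::nat)" "0 \<le> s" "s \<le> 1"
    have "saddle z * u = smult t (r * u) + smult (of_nat a) ([:-z, 1:] * (q * u))"
      unfolding saddle_def distrib_right by (simp only: mult_smult_left mult.assoc)
    then have S: "ev n s z (saddle z * u) = t * ev n s z (r * u) + of_nat a * ev n s z ([:-z, 1:] * (q * u))"
      by (simp only: ev_add ev_smult)
    have "of_real (real n + s) = (of_nat n + of_real s :: complex)" by simp
    then have "of_nat n * ev n s z (saddle z * u) = - t * ev n s z (pderiv (q * u)) - of_nat a * of_real s * ev n s z ([:-z, 1:] * (q * u))"
      using ev_parts[OF h(1,2), of z u] unfolding S by algebra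
    then have "real n * cmod (ev n s z (saddle z * u)) = cmod (- t * ev n s z (pderiv (q * u)) - of_nat a * of_real s * ev n s z ([:-z, 1:] * (q * u)))"
      by (metis norm_mult norm_of_nat)
    also have "\<dots> \<le> cmod t * cmod (ev n s z (pderiv (q * u))) + real a * s * cmod (ev n s z ([:-z, 1:] * (q * u)))"
      using h by (intro order.trans[OF norm_triangle_ineq4]) (simp add: norm_mult)
    also have "\<dots> \<le> cmod t * (C1 * V n s z) + real a * 1 * (C2 * V n s z)"
      using C1 C2 h by (intro add_mono mult_left_mono mult_mono) auto
    also have "\<dots> = C * V n s z" by (simp add: C_def algebra_simps)
    finally have *: "cmod (ev n s z (saddle z * u)) \<le> C / real n * V n s z"
      using h by (simp add: field_simps)
    have "ev n s z g = ev n s z ((\<Sum>j\<le>d. smult (poly g (y j)) (lagrange_basis d y j)) + saddle z * u)"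
      using u by (rule arg_cong)
    also have "\<dots> = (\<Sum>j\<le>d. poly g (y j) * ev n s z (lagrange_basis d y j)) + ev n s z (saddle z * u)"
      by (simp only: ev_add ev_sum ev_smult)
    finally show "cmod (ev n s z g - (\<Sum>j\<le>d. poly g (y j) * ev n s z (lagrange_basis d y j))) \<le> C / real n * V n s z"
      using * by simp
  qed
qed

text \<open>In contrast to the z-direction, the derivative in s is bounded by a multiple of
  \<open>V\<close> that does not grow with n, so Gronwall's inequality gives a bound uniform in
  n.\<close>

lemma V_growth_in_s:
  "\<exists>C\<ge>0. \<forall>n s. n \<ge> 1 \<longrightarrow> 0 \<le> s \<longrightarrow> s \<le> 1 \<longrightarrow> V n s z \<le> C * V n 0 z"
proof -
  have "\<exists>C\<ge>0. \<forall>n s. n \<ge> 1 \<longrightarrow> 0 \<le> s \<longrightarrow> s \<le> 1 \<longrightarrow>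
      cmod (ev n s z ([:-z, 1:] * ([:-z, 1:] * monom 1 k))) \<le> C * V n s z" for k
    by (rule ev_dominated_at)
  then obtain C where C: "\<And>k. C k \<ge> 0" "\<And>k n s. n \<ge> 1 \<Longrightarrow> 0 \<le> s \<Longrightarrow> s \<le> 1 \<Longrightarrow>
      cmod (ev n s z ([:-z, 1:] * ([:-z, 1:] * monom 1 k))) \<le> C k * V n s z" by metis
  define B where "B = real a / (2 * cmod t) * (\<Sum>k\<le>d. C k) + 1"
  have B: "B \<ge> 0" unfolding B_def using C(1) by (intro add_nonneg_nonneg mult_nonneg_nonneg sum_nonneg divide_nonneg_nonneg) auto
  show ?thesis
  proof (intro exI[of _ "exp (real (d + 1) * B)"] conjI allI impI)
    fix n and s :: real assume n: "n \<ge> (1::nat)" and s: "0 \<le> s" "s \<le> 1"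
    show "V n s z \<le> exp (real (d + 1) * B) * V n 0 z" unfolding V_def
    proof (rule gronwall_l2[where f = "\<lambda>k s. ev n s z (monom 1 k)", OF _ _ s B])
      fix k and x :: real assume k: "k \<le> d" and x: "0 \<le> x" "x \<le> 1"
      show "((\<lambda>s. ev n s z (monom 1 k)) has_vector_derivative
         of_nat a / (2 * t) * ev n x z ([:-z, 1:] * ([:-z, 1:] * monom 1 k)) + ev n x z (monom 1 k) / (2 * of_real (real n + x))) (at x)"
        using n x by (intro ev_deriv_s)
      have "cmod (2 * of_real (real n + x)) \<ge> 1" using n x unfolding norm_mult norm_of_real by simp
      then have "cmod (ev n x z (monom 1 k) / (2 * of_real (real n + x))) \<le> V n x z"
        using ev_monom_le_V[OF k, of n x z] V_nonneg[of n x z] unfolding norm_divide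
        by (intro order.trans[OF divide_right_mono[OF ev_monom_le_V[OF k]]]) (auto simp: divide_le_eq mult_le_cancel_left1 simp del: of_real_add)
      moreover have "cmod (of_nat a / (2 * t) * ev n x z ([:-z, 1:] * ([:-z, 1:] * monom 1 k))) \<le> real a / (2 * cmod t) * ((\<Sum>k\<le>d. C k) * V n x z)"
      proof -
        have "cmod (ev n x z ([:-z, 1:] * ([:-z, 1:] * monom 1 k))) \<le> C k * V n x z" using C n x by blast
        also have "\<dots> \<le> (\<Sum>k\<le>d. C k) * V n x z" using C(1) k V_nonneg by (intro mult_right_mono member_le_sum) auto
        finally show ?thesis unfolding norm_mult norm_divide by (intro mult_mono) auto
      qed
      ultimately have "cmod (of_nat a / (2 * t) * ev n x z ([:-z, 1:] * ([:-z, 1:] * monom 1 k)) + ev n x z (monom 1 k) / (2 * of_real (real n + x))) \<le> B * V n x z"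
        using norm_triangle_ineq[of "of_nat a / (2 * t) * ev n x z ([:-z, 1:] * ([:-z, 1:] * monom 1 k))" "ev n x z (monom 1 k) / (2 * of_real (real n + x))"]
        unfolding B_def distrib_right by (simp only: mult.assoc)
      then show "cmod (of_nat a / (2 * t) * ev n x z ([:-z, 1:] * ([:-z, 1:] * monom 1 k)) + ev n x z (monom 1 k) / (2 * of_real (real n + x))) \<le>
        B * sqrt (\<Sum>j\<le>d. (cmod (ev n x z (monom 1 j)))\<^sup>2)" by (simp only: V_def)
    qed
  qed simp
qed

text \<open>Passing from n to n + 1 multiplies by \<open>P\<close> and moves s from 0 to 1. On a
  Lagrange polynomial, multiplication by a polynomial acts as its value at \<open>y j\<close>, up to
  O(1/n). So the first operation contributes \<open>poly P (y j)\<close>, and the flow, driven by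
  the square of y - z, contributes \<open>exp \<kappa>\<close>; the product is
  \<open>F z (y j)\<close>.\<close>

lemma ev_step:
  assumes "nodes z y" and j: "j \<le> d"
  shows "\<exists>C\<ge>0. \<forall>n\<ge>1. cmod (ev (Suc n) 0 z (lagrange_basis d y j) - F z (y j) * ev n 0 z (lagrange_basis d y j))
      \<le> C / real n * V n 0 z"
proof -
  define l where "l = lagrange_basis d y j"
  have inj: "inj_on y {..d}" using assms by (simp add: nodes_def)
  have delta: "(\<Sum>i\<le>d. poly (g * l) (y i) * ev n s z (lagrange_basis d y i)) = poly g (y j) * ev n s z l" for g n s
  proof -
    have "(\<Sum>i\<le>d. poly (g * l) (y i) * ev n s z (lagrange_basis d y i)) = (\<Sum>i\<le>d. if i = j then poly g (y j) * ev n s z l else 0)"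
      using j by (intro sum.cong refl) (simp add: l_def poly_lagrange_basis[OF inj])
    then show ?thesis using j by simp
  qed
  have interp: "\<exists>C\<ge>0. \<forall>n s. n \<ge> 1 \<longrightarrow> 0 \<le> s \<longrightarrow> s \<le> 1 \<longrightarrow>
    cmod (ev n s z (g * l) - poly g (y j) * ev n s z l) \<le> C / real n * V n s z" for g
    using ev_interpolation[OF assms(1), of "g * l"] by (simp only: delta)
  define \<kappa> where "\<kappa> = of_nat a * (y j - z) ^ 2 / (2 * t)"
  obtain K where K: "K \<ge> 0" "\<And>n s. n \<ge> 1 \<Longrightarrow> 0 \<le> s \<Longrightarrow> s \<le> 1 \<Longrightarrow> V n s z \<le> K * V n 0 z"
    using V_growth_in_s by blast
  obtain C1 where C1: "C1 \<ge> 0" "\<And>n s. n \<ge> 1 \<Longrightarrow> 0 \<le> s \<Longrightarrow> s \<le> 1 \<Longrightarrow>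
     cmod (ev n s z (P * l) - poly P (y j) * ev n s z l) \<le> C1 / real n * V n s z"
    using interp[of P] by blast
  obtain C2 where C2: "C2 \<ge> 0" "\<And>n s. n \<ge> 1 \<Longrightarrow> 0 \<le> s \<Longrightarrow> s \<le> 1 \<Longrightarrow>
     cmod (ev n s z (([:-z, 1:] * [:-z, 1:]) * l) - poly ([:-z, 1:] * [:-z, 1:]) (y j) * ev n s z l) \<le> C2 / real n * V n s z"
    using interp[of "[:-z, 1:] * [:-z, 1:]"] by blast
  from ev_dominated_at[of z l] obtain C3 where C3': "C3 \<ge> 0"
     "\<forall>n s. n \<ge> 1 \<longrightarrow> 0 \<le> s \<longrightarrow> s \<le> 1 \<longrightarrow> cmod (ev n s z l) \<le> C3 * V n s z"
    by (elim exE conjE)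
  note C3 = C3'(1) C3'(2)[rule_format]
  define D where "D = exp (cmod \<kappa>) * ((real a / (2 * cmod t) * C2 + C3) * K)"
  have D: "D \<ge> 0" using C2 C3 K by (simp add: D_def)
  have flow: "cmod (ev n 1 z l - exp \<kappa> * ev n 0 z l) \<le> exp (cmod \<kappa>) * (D / real n * V n 0 z)" if n: "n \<ge> 1" for n
  proof -
    \<comment> \<open>The integrating factor removes the leading part of the flow; what remains of
      the derivative is O(1/n) relative to \<open>V\<close>.\<close>
    define E where "E s = exp (- (of_real s * \<kappa>)) * ev n s z l" for s :: real
    define E' where "E' s = exp (- (of_real s * \<kappa>)) * (of_nat a / (2 * t) * (ev n s z ([:-z, 1:] * ([:-z, 1:] * l)) - (y j - z) ^ 2 * ev n s z l)
        + ev n s z l / (2 * of_real (real n + s)))" for s :: real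
    have dE: "(E has_vector_derivative E' s) (at s)" if s: "0 \<le> s" "s \<le> 1" for s
    proof -
      have 1: "((\<lambda>s. exp (- (of_real s * \<kappa>))) has_vector_derivative exp (- (of_real s * \<kappa>)) * (- \<kappa>)) (at s)"
      proof -
        have "((\<lambda>s. exp (- (s * \<kappa>))) has_field_derivative exp (- (of_real s * \<kappa>)) * (- \<kappa>)) (at (of_real s))"
          by (auto intro!: derivative_eq_intros)
        from has_vector_derivative_real_field[OF this] show ?thesis by simp
      qed
      have "(E has_vector_derivative exp (- (of_real s * \<kappa>)) *
         (of_nat a / (2 * t) * ev n s z ([:-z, 1:] * ([:-z, 1:] * l)) + ev n s z l / (2 * of_real (real n + s)))
         + exp (- (of_real s * \<kappa>)) * (- \<kappa>) * ev n s z l) (at s)"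
        unfolding E_def[abs_def] using has_vector_derivative_mult[OF 1 ev_deriv_s[OF n s(1), of z l]] .
      also have "exp (- (of_real s * \<kappa>)) *
         (of_nat a / (2 * t) * ev n s z ([:-z, 1:] * ([:-z, 1:] * l)) + ev n s z l / (2 * of_real (real n + s)))
         + exp (- (of_real s * \<kappa>)) * (- \<kappa>) * ev n s z l = E' s"
      proof -
        have "e * (c * X + W) + e * (- \<kappa>) * Y = e * (c * (X - p * Y) + W)" if "\<kappa> = c * p" for e c X W p Y
          unfolding that by algebra
        from this[of "of_nat a / (2 * t)" "(y j - z) ^ 2"] show ?thesis unfolding E'_def by (simp add: \<kappa>_def)
      qed
      finally show ?thesis .
    qed
    have bE: "cmod (E' s) \<le> D / real n * V n 0 z" if s: "0 \<le> s" "s \<le> 1" for s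
    proof -
      have e: "cmod (exp (- (of_real s * \<kappa>))) \<le> exp (cmod \<kappa>)"
      proof -
        have "cmod (exp (- (of_real s * \<kappa>))) \<le> exp (cmod (- (of_real s * \<kappa>)))" by (rule norm_exp)
        also have "cmod (- (of_real s * \<kappa>)) \<le> cmod \<kappa>" using s by (simp add: norm_mult mult_left_le_one_le)
        finally show ?thesis by simp
      qed
      have p: "poly ([:-z, 1:] * [:-z, 1:]) (y j) = (y j - z) ^ 2" by (simp add: power2_eq_square algebra_simps)
      have a1: "cmod (ev n s z ([:-z, 1:] * ([:-z, 1:] * l)) - (y j - z) ^ 2 * ev n s z l) \<le> C2 / real n * V n s z"
        using C2(2)[OF n s] unfolding p mult.assoc .
      have a2: "cmod (ev n s z l / (2 * of_real (real n + s))) \<le> C3 / real n * V n s z"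
      proof -
        have "cmod (2 * of_real (real n + s)) \<ge> real n" using n s unfolding norm_mult norm_of_real by simp
        then have "cmod (ev n s z l) / cmod (2 * of_real (real n + s)) \<le> (C3 * V n s z) / real n"
          using C3 n s V_nonneg by (intro frac_le) auto
        then show ?thesis by (simp add: norm_divide)
      qed
      have "cmod (of_nat a / (2 * t) * (ev n s z ([:-z, 1:] * ([:-z, 1:] * l)) - (y j - z) ^ 2 * ev n s z l)
        + ev n s z l / (2 * of_real (real n + s))) \<le> real a / (2 * cmod t) * (C2 / real n * V n s z) + C3 / real n * V n s z"
        by (rule order.trans[OF norm_triangle_ineq], rule add_mono[OF _ a2])
          (use mult_left_mono[OF a1, of "real a / (2 * cmod t)"] in \<open>simp add: norm_mult norm_divide\<close>)
      also have "\<dots> = (real a / (2 * cmod t) * C2 + C3) / real n * V n s z" by (simp add: add_divide_distrib algebra_simps)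
      also have "\<dots> \<le> (real a / (2 * cmod t) * C2 + C3) / real n * (K * V n 0 z)"
        using K(2)[OF n s] C2 C3 by (intro mult_left_mono) auto
      finally have "cmod (E' s) \<le> exp (cmod \<kappa>) * ((real a / (2 * cmod t) * C2 + C3) / real n * (K * V n 0 z))"
        unfolding E'_def norm_mult[of "exp _"] using e by (intro mult_mono) auto
      then show ?thesis by (simp add: D_def mult_ac)
    qed
    have "cmod (E 1 - E 0) \<le> D / real n * V n 0 z"
      by (rule unit_interval_mvt_bound[OF dE bE])
    moreover have "exp \<kappa> * (E 1 - E 0) = ev n 1 z l - exp \<kappa> * ev n 0 z l"
    proof -
      have "exp \<kappa> * exp (- \<kappa>) = 1" by (simp add: exp_minus)
      then show ?thesis unfolding E_def of_real_1 of_real_0 by (simp add: right_diff_distrib flip: mult.assoc)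
    qed
    moreover have "cmod (exp \<kappa> * (E 1 - E 0)) \<le> exp (cmod \<kappa>) * (D / real n * V n 0 z)"
      unfolding norm_mult using \<open>cmod (E 1 - E 0) \<le> _\<close> by (intro mult_mono norm_exp) auto
    ultimately show ?thesis by (simp only:)
  qed
  define C where "C = C1 * K + cmod (poly P (y j)) * (exp (cmod \<kappa>) * D)"
  show ?thesis
  proof (intro exI[of _ C] conjI allI impI)
    show "C \<ge> 0" using C1 K D by (simp add: C_def)
    fix n assume n: "n \<ge> (1::nat)"
    \<comment> \<open>The time of n + 1 at s = 0 is the time of n at s = 1, and the additional
      factor \<open>P\<close> is moved into the polynomial in front of \<open>P ^ n\<close>.\<close>
    have nxt: "ev (Suc n) 0 z l = ev n 1 z (P * l)"
    proof -
      have "of_real (real (Suc n) + 0) = (of_real (real n + 1) :: complex)" by simp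
      moreover have "l * P ^ Suc n = P * l * P ^ n" by (simp add: mult_ac)
      ultimately show ?thesis unfolding ev_def by (simp only:)
    qed
    have "ev (Suc n) 0 z l - F z (y j) * ev n 0 z l =
       (ev n 1 z (P * l) - poly P (y j) * ev n 1 z l) + poly P (y j) * (ev n 1 z l - exp \<kappa> * ev n 0 z l)"
      unfolding nxt F_def \<kappa>_def[symmetric] by (simp add: algebra_simps)
    then have "cmod (ev (Suc n) 0 z l - F z (y j) * ev n 0 z l) \<le>
      cmod (ev n 1 z (P * l) - poly P (y j) * ev n 1 z l) + cmod (poly P (y j)) * cmod (ev n 1 z l - exp \<kappa> * ev n 0 z l)"
      by (metis norm_mult norm_triangle_ineq)
    also have "\<dots> \<le> C1 / real n * (K * V n 0 z) + cmod (poly P (y j)) * (exp (cmod \<kappa>) * (D / real n * V n 0 z))"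
    proof (intro add_mono mult_left_mono)
      have "cmod (ev n 1 z (P * l) - poly P (y j) * ev n 1 z l) \<le> C1 / real n * V n 1 z" using C1 n by simp
      also have "\<dots> \<le> C1 / real n * (K * V n 0 z)" using K(2)[OF n, of 1] C1 by (intro mult_left_mono) auto
      finally show "cmod (ev n 1 z (P * l) - poly P (y j) * ev n 1 z l) \<le> C1 / real n * (K * V n 0 z)" .
    qed (use flow[OF n] in auto)
    also have "\<dots> = C / real n * V n 0 z" by (simp add: C_def add_divide_distrib algebra_simps)
    finally show "cmod (ev (Suc n) 0 z (lagrange_basis d y j) - F z (y j) * ev n 0 z (lagrange_basis d y j)) \<le> C / real n * V n 0 z"
      by (simp only: l_def)
  qed
qed

text \<open>A change of basis: the monomials up to degree d are combinations of the Lagrange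
  polynomials with coefficients independent of n.\<close>

lemma V_le_lagrange_sum:
  assumes "nodes z y"
  shows "\<exists>C. C \<ge> 0 \<and> (\<forall>n. V n 0 z \<le> C * (\<Sum>j\<le>d. cmod (ev n 0 z (lagrange_basis d y j))))"
proof -
  have inj: "inj_on y {..d}" using assms by (simp add: nodes_def)
  define C where "C = (\<Sum>k\<le>d. \<Sum>j\<le>d. cmod (y j) ^ k)"
  have C0: "C \<ge> 0" by (simp add: C_def sum_nonneg)
  have "V n 0 z \<le> C * (\<Sum>j\<le>d. cmod (ev n 0 z (lagrange_basis d y j)))" for n
  proof -
    define X where "X = (\<Sum>j\<le>d. cmod (ev n 0 z (lagrange_basis d y j)))"
    have X: "X \<ge> 0" by (simp add: X_def sum_nonneg)
    have ev_le: "cmod (ev n 0 z (monom 1 k)) \<le> (\<Sum>j\<le>d. cmod (y j) ^ k) * X" if k: "k \<le> d" for k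
    proof -
      have "monom 1 k = (\<Sum>j\<le>d. smult (poly (monom 1 k) (y j)) (lagrange_basis d y j))"
        using k by (intro lagrange_interpolation[OF inj]) (simp add: degree_monom_eq)
      then have "ev n 0 z (monom 1 k) = ev n 0 z (\<Sum>j\<le>d. smult (poly (monom 1 k) (y j)) (lagrange_basis d y j))"
        by (rule arg_cong)
      also have "\<dots> = (\<Sum>j\<le>d. y j ^ k * ev n 0 z (lagrange_basis d y j))"
        by (simp only: ev_sum ev_smult) (simp add: poly_monom)
      also have "cmod \<dots> \<le> (\<Sum>j\<le>d. cmod (y j) ^ k * cmod (ev n 0 z (lagrange_basis d y j)))"
        by (rule order.trans[OF norm_sum]) (simp add: norm_mult norm_power)
      also have "\<dots> \<le> (\<Sum>j\<le>d. cmod (y j) ^ k * X)"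
        unfolding X_def by (intro sum_mono mult_left_mono member_le_sum) auto
      finally show ?thesis by (simp add: sum_distrib_right)
    qed
    have "V n 0 z \<le> (\<Sum>k\<le>d. \<bar>cmod (ev n 0 z (monom 1 k))\<bar>)"
      using L2_set_le_sum_abs[of "\<lambda>k. cmod (ev n 0 z (monom 1 k))" "{..d}"] by (simp add: V_def L2_set_def)
    also have "\<dots> \<le> (\<Sum>k\<le>d. (\<Sum>j\<le>d. cmod (y j) ^ k) * X)"
      using ev_le by (intro sum_mono) auto
    also have "\<dots> = C * X" unfolding C_def by (rule sum_distrib_right[symmetric])
    finally show ?thesis by (simp add: X_def)
  qed
  then show ?thesis using C0 by blast
qed

text \<open>One Lagrange component dominates, so by interpolation \<open>ev n 0 z g / x n i\<close>
  tends to \<open>poly g (y i)\<close> for every g; the choices 1 and \<open>[:-z, 1:]\<close> give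
  the quotient. The rate of \<open>V\<close> is recorded as well, because \<open>V\<close> does not
  depend on i and can be compared at different z.\<close>

theorem point_asymptotics:
  assumes y: "nodes z y"
    and dist: "\<And>i j. i \<le> d \<Longrightarrow> j \<le> d \<Longrightarrow> i \<noteq> j \<Longrightarrow> cmod (F z (y i)) \<noteq> cmod (F z (y j))"
  shows "\<exists>i\<le>d. (\<lambda>n. ln (V n 0 z) / real n) \<longlonglongrightarrow> ln (cmod (F z (y i))) \<and>
     (\<lambda>n. ev n 0 z [:-z, 1:] / ev n 0 z 1) \<longlonglongrightarrow> y i - z \<and> (\<forall>\<^sub>F n in sequentially. ev n 0 z 1 \<noteq> 0)"
proof -
  define x where "x n j = ev n 0 z (lagrange_basis d y j)" for n j
  define c where "c j = F z (y j)" for j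
  define X where "X n = (\<Sum>j\<le>d. cmod (x n j))" for n
  from V_le_lagrange_sum[OF y] obtain K where K: "K \<ge> 0" "\<forall>n. V n 0 z \<le> K * X n"
    unfolding X_def x_def by (elim exE conjE)
  have "\<exists>C. C \<ge> 0 \<and> (\<forall>n\<ge>1. cmod (x (Suc n) j - c j * x n j) \<le> C / real n * V n 0 z)" if "j \<le> d" for j
    using ev_step[OF y that] unfolding x_def c_def by (elim exE conjE) (intro exI conjI)
  then obtain C where C: "\<forall>j\<le>d. C j \<ge> 0 \<and> (\<forall>n\<ge>1. cmod (x (Suc n) j - c j * x n j) \<le> C j / real n * V n 0 z)"
    by metis
  define D where "D = (\<Sum>j\<le>d. C j) * K"
  have X0: "X n \<ge> 0" for n by (simp add: X_def sum_nonneg)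
  have step: "cmod (x (Suc n) j - c j * x n j) \<le> (D / real n) * (\<Sum>k\<le>d. cmod (x n k))" if n: "n \<ge> 1" and j: "j \<le> d" for n j
  proof -
    have "cmod (x (Suc n) j - c j * x n j) \<le> C j / real n * V n 0 z" using C n j by blast
    also have "\<dots> \<le> (\<Sum>j\<le>d. C j) / real n * V n 0 z"
      using C j V_nonneg by (intro mult_right_mono divide_right_mono member_le_sum) auto
    also have "\<dots> \<le> (\<Sum>j\<le>d. C j) / real n * (K * X n)"
      using K C by (intro mult_left_mono divide_nonneg_nonneg sum_nonneg) auto
    finally show ?thesis by (simp add: D_def X_def)
  qed
  have D0: "(\<lambda>n. D / real n) \<longlonglongrightarrow> 0" by (rule lim_const_over_n)
  have pos: "\<exists>j\<le>d. x n j \<noteq> 0" if n: "n \<ge> 1" for n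
  proof (rule ccontr)
    assume "\<not> ?thesis"
    then have "X n = 0" by (simp add: X_def)
    then show False using K V_pos[OF n, of 0 z] by (metis leD mult_zero_right order_refl zero_le_one)
  qed
  have nz: "c i \<noteq> 0" if "i \<le> d" for i
    using y that unfolding c_def nodes_def by (intro F_nonzero) auto
  have "\<exists>i\<le>d. (\<forall>j\<le>d. j \<noteq> i \<longrightarrow> (\<lambda>n. x n j / x n i) \<longlonglongrightarrow> 0) \<and>
    eventually (\<lambda>n. x n i \<noteq> 0) sequentially \<and>
    (\<lambda>n. ln (cmod (x n i)) / real n) \<longlonglongrightarrow> ln (cmod (c i))"
    by (rule poincare_diagonal[where x = x and c = c and d = d, OF dist[folded c_def] nz pos D0 step])
  then obtain i where i: "i \<le> d" "\<And>j. j \<le> d \<Longrightarrow> j \<noteq> i \<Longrightarrow> (\<lambda>n. x n j / x n i) \<longlonglongrightarrow> 0"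
    "eventually (\<lambda>n. x n i \<noteq> 0) sequentially"
    "(\<lambda>n. ln (cmod (x n i)) / real n) \<longlonglongrightarrow> ln (cmod (c i))" by blast
  have ratio: "(\<lambda>n. x n j / x n i) \<longlonglongrightarrow> (if j = i then 1 else 0)" if "j \<le> d" for j
  proof (cases "j = i")
    case True
    have "(\<lambda>n. x n j / x n i) \<longlonglongrightarrow> 1"
      by (rule Lim_transform_eventually[OF tendsto_const]) (use i(3) in eventually_elim, simp add: True)
    then show ?thesis using True by simp
  qed (use i(2) that in simp)
  have Xlim: "(\<lambda>n. X n / cmod (x n i)) \<longlonglongrightarrow> 1"
  proof -
    have "(\<lambda>n. \<Sum>j\<le>d. cmod (x n j / x n i)) \<longlonglongrightarrow> (\<Sum>j\<le>d. cmod (if j = i then 1 else 0))"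
      by (intro tendsto_sum tendsto_norm ratio) auto
    also have "(\<Sum>j\<le>d. cmod (if j = i then 1 else 0)) = 1"
      using i(1) by (simp add: if_distrib[of cmod] cong: if_cong)
    finally show ?thesis by (simp add: X_def norm_divide sum_divide_distrib)
  qed
  have evlim: "(\<lambda>n. ev n 0 z g / x n i) \<longlonglongrightarrow> poly g (y i)" for g
  proof -
    obtain B where B: "B \<ge> 0" "\<forall>n s. n \<ge> 1 \<longrightarrow> 0 \<le> s \<longrightarrow> s \<le> 1 \<longrightarrow>
      cmod (ev n s z g - (\<Sum>j\<le>d. poly g (y j) * ev n s z (lagrange_basis d y j))) \<le> B / real n * V n s z"
      using ev_interpolation[OF y, of g] by (elim exE conjE)
    have "(\<lambda>n. (ev n 0 z g - (\<Sum>j\<le>d. poly g (y j) * x n j)) / x n i) \<longlonglongrightarrow> 0"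
    proof (rule tendsto_0_le)
      show "(\<lambda>n. (B * K / real n) * (X n / cmod (x n i))) \<longlonglongrightarrow> 0"
        using tendsto_mult[OF lim_const_over_n[of "B * K"] Xlim] by simp
      show "\<forall>\<^sub>F n in sequentially. norm ((ev n 0 z g - (\<Sum>j\<le>d. poly g (y j) * x n j)) / x n i) \<le> norm ((B * K / real n) * (X n / cmod (x n i))) * 1"
        using eventually_ge_at_top[of 1]
      proof eventually_elim
        case (elim n)
        have "cmod (ev n 0 z g - (\<Sum>j\<le>d. poly g (y j) * x n j)) \<le> B / real n * V n 0 z"
          using B(2)[rule_format, of n 0] elim unfolding x_def by simp
        also have "\<dots> \<le> B / real n * (K * X n)" using K B(1) by (intro mult_left_mono) auto
        finally have "cmod (ev n 0 z g - (\<Sum>j\<le>d. poly g (y j) * x n j)) / cmod (x n i) \<le> (B / real n * (K * X n)) / cmod (x n i)"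
          by (intro divide_right_mono) auto
        then show ?case using B(1) K(1) X0[of n] by (simp add: norm_divide abs_mult)
      qed
    qed
    moreover have "(\<lambda>n. \<Sum>j\<le>d. poly g (y j) * (x n j / x n i)) \<longlonglongrightarrow> (\<Sum>j\<le>d. poly g (y j) * (if j = i then 1 else 0))"
      by (intro tendsto_sum tendsto_mult tendsto_const ratio) auto
    ultimately have "(\<lambda>n. (ev n 0 z g - (\<Sum>j\<le>d. poly g (y j) * x n j)) / x n i + (\<Sum>j\<le>d. poly g (y j) * (x n j / x n i)))
       \<longlonglongrightarrow> 0 + (\<Sum>j\<le>d. poly g (y j) * (if j = i then 1 else 0))" by (rule tendsto_add)
    moreover have "(\<Sum>j\<le>d. poly g (y j) * (if j = i then 1 else 0)) = poly g (y i)"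
      using i(1) by (simp add: if_distrib cong: if_cong)
    moreover have "(ev n 0 z g - (\<Sum>j\<le>d. poly g (y j) * x n j)) / x n i + (\<Sum>j\<le>d. poly g (y j) * (x n j / x n i)) = ev n 0 z g / x n i" for n
      by (simp add: diff_divide_distrib sum_divide_distrib)
    ultimately show ?thesis by simp
  qed
  have "(\<lambda>n. (ev n 0 z [:-z, 1:] / x n i) / (ev n 0 z 1 / x n i)) \<longlonglongrightarrow> poly [:-z, 1:] (y i) / poly 1 (y i)"
    by (intro tendsto_divide evlim) simp
  moreover have "\<forall>\<^sub>F n in sequentially. (ev n 0 z [:-z, 1:] / x n i) / (ev n 0 z 1 / x n i) = ev n 0 z [:-z, 1:] / ev n 0 z 1"
    using i(3) by eventually_elim simp
  ultimately have "(\<lambda>n. ev n 0 z [:-z, 1:] / ev n 0 z 1) \<longlonglongrightarrow> poly [:-z, 1:] (y i) / poly 1 (y i)"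
    by (rule Lim_transform_eventually)
  then have lim2: "(\<lambda>n. ev n 0 z [:-z, 1:] / ev n 0 z 1) \<longlonglongrightarrow> y i - z" by simp
  have lim1: "(\<lambda>n. ln (V n 0 z) / real n) \<longlonglongrightarrow> ln (cmod (c i))"
  proof -
    from ev_dominated_at[of z "lagrange_basis d y i"] obtain L where L: "L \<ge> 0"
      "\<forall>n s. n \<ge> 1 \<longrightarrow> 0 \<le> s \<longrightarrow> s \<le> 1 \<longrightarrow> cmod (ev n s z (lagrange_basis d y i)) \<le> L * V n s z"
      by (elim exE conjE)
    have lo: "(\<lambda>n. ln (cmod (x n i)) / real n - ln (L + 1) / real n) \<longlonglongrightarrow> ln (cmod (c i)) - 0"
      by (intro tendsto_diff i(4) lim_const_over_n)
    have hi: "(\<lambda>n. ln (cmod (x n i)) / real n + ln (2 * (K + 1)) / real n) \<longlonglongrightarrow> ln (cmod (c i)) + 0"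
      by (intro tendsto_add i(4) lim_const_over_n)
    have Xev: "\<forall>\<^sub>F n in sequentially. X n / cmod (x n i) < 2"
      using order_tendstoD(2)[OF Xlim, of 2] by simp
    show ?thesis
    proof (rule tendsto_sandwich)
      show "(\<lambda>n. ln (cmod (x n i)) / real n - ln (L + 1) / real n) \<longlonglongrightarrow> ln (cmod (c i))" using lo by simp
      show "(\<lambda>n. ln (cmod (x n i)) / real n + ln (2 * (K + 1)) / real n) \<longlonglongrightarrow> ln (cmod (c i))" using hi by simp
      show "\<forall>\<^sub>F n in sequentially. ln (cmod (x n i)) / real n - ln (L + 1) / real n \<le> ln (V n 0 z) / real n"
        using eventually_ge_at_top[of 1] i(3)
      proof eventually_elim
        case (elim n)
        have V: "V n 0 z > 0" using V_pos elim by simp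
        have "cmod (x n i) \<le> L * V n 0 z" using L(2)[rule_format, of n 0] elim by (simp add: x_def)
        also have "\<dots> \<le> (L + 1) * V n 0 z" using V by (intro mult_right_mono) auto
        finally have "ln (cmod (x n i)) \<le> ln ((L + 1) * V n 0 z)" using elim V L(1) by (subst ln_le_cancel_iff) auto
        also have "\<dots> = ln (L + 1) + ln (V n 0 z)" using V L(1) by (intro ln_mult_pos) auto
        finally have "(ln (cmod (x n i)) - ln (L + 1)) / real n \<le> ln (V n 0 z) / real n"
          by (intro divide_right_mono) auto
        then show ?case by (simp add: diff_divide_distrib)
      qed
      show "\<forall>\<^sub>F n in sequentially. ln (V n 0 z) / real n \<le> ln (cmod (x n i)) / real n + ln (2 * (K + 1)) / real n"
        using eventually_ge_at_top[of 1] i(3) Xev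
      proof eventually_elim
        case (elim n)
        have V: "V n 0 z > 0" using V_pos elim by simp
        have xp: "cmod (x n i) > 0" using elim by simp
        have "X n \<le> 2 * cmod (x n i)" using elim xp by (simp add: pos_divide_less_eq less_imp_le)
        have "V n 0 z \<le> K * X n" using K by blast
        also have "\<dots> \<le> (K + 1) * (2 * cmod (x n i))" using K(1) X0[of n] \<open>X n \<le> 2 * cmod (x n i)\<close> by (intro mult_mono) auto
        also have "\<dots> = cmod (x n i) * (2 * (K + 1))" by simp
        finally have "ln (V n 0 z) \<le> ln (cmod (x n i) * (2 * (K + 1)))" using V xp K(1) by (subst ln_le_cancel_iff) auto
        also have "\<dots> = ln (cmod (x n i)) + ln (2 * (K + 1))" using xp K(1) by (intro ln_mult_pos) auto
        finally have "ln (V n 0 z) / real n \<le> (ln (cmod (x n i)) + ln (2 * (K + 1))) / real n"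
          by (intro divide_right_mono) auto
        then show ?case by (simp add: add_divide_distrib)
      qed
    qed
  qed
  have "\<forall>\<^sub>F n in sequentially. ev n 0 z 1 / x n i \<noteq> 0"
    by (rule tendsto_imp_eventually_ne[OF evlim]) simp
  then have "\<forall>\<^sub>F n in sequentially. ev n 0 z 1 \<noteq> 0" by eventually_elim auto
  then show ?thesis using i(1) lim1 lim2 unfolding c_def by blast
qed

end

section \<open>Bounds for the zeros\<close>

text \<open>The core of Laguerre's theorem. For k in the disc, x \<mapsto> 1 / (k - x) sends points
  outside the disc to \<psi> > 0 and points of the disc to \<psi> <= 0. Since \<psi> is concave, a
  mean of N points of the first kind is not of the second kind. If \<open>card I < N\<close>, the
  missing points lie at infinity, with image 0, where \<psi> equals 1.\<close>

lemma grace_disc_aux: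
  fixes k u :: complex and r :: real
  assumes "cmod k \<le> r" and I: "finite I" and N: "card I \<le> N" "N > 0"
    and a: "\<And>i. i \<in> I \<Longrightarrow> cmod (a i) > r"
    and z: "cmod \<zeta> \<le> r" "\<zeta> \<noteq> k"
  shows "(\<Sum>i\<in>I. 1 / (k - a i)) \<noteq> of_nat N / (k - \<zeta>)"
proof
  assume eq: "(\<Sum>i\<in>I. 1 / (k - a i)) = of_nat N / (k - \<zeta>)"
  define \<psi> where "\<psi> u = (cmod k ^ 2 - r ^ 2) * cmod u ^ 2 - 2 * Re (k * u) + 1" for u
  have r0: "r \<ge> 0" using assms(1) norm_ge_zero order_trans by blast
  have kr: "cmod k ^ 2 - r ^ 2 \<le> 0" using assms(1) by (simp add: power_mono)
  have \<psi>_eq: "\<psi> (1 / (k - x)) = (cmod x ^ 2 - r ^ 2) * cmod (1 / (k - x)) ^ 2" if "x \<noteq> k" for x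
  proof -
    define u where "u = 1 / (k - x)"
    have "u \<noteq> 0" using that by (simp add: u_def)
    have "x * u = k * u - 1" using that by (simp add: u_def field_simps)
    then have "cmod x ^ 2 * cmod u ^ 2 = cmod (k * u - 1) ^ 2" by (metis norm_mult power_mult_distrib)
    also have "\<dots> = cmod k ^ 2 * cmod u ^ 2 - 2 * Re (k * u) + 1"
      unfolding cmod_power2 by (simp add: algebra_simps power2_eq_square)
    finally show ?thesis by (simp add: \<psi>_def u_def algebra_simps)
  qed
  define w where "w = 1 / (k - \<zeta>)"
  have w0: "\<psi> w \<le> 0"
  proof -
    have "cmod \<zeta> ^ 2 \<le> r ^ 2" using z by (simp add: power_mono)
    then show ?thesis using \<psi>_eq[OF z(2)] by (simp add: w_def mult_nonpos_nonneg)
  qed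
  have av: "(\<Sum>i\<in>I. 1 / (k - a i)) = of_nat N * w" using eq by (simp add: w_def)
  have \<psi>_pos: "\<psi> (1 / (k - a i)) > 0" if "i \<in> I" for i
  proof -
    have "a i \<noteq> k" using a[OF that] assms(1) by auto
    moreover have "r ^ 2 < cmod (a i) ^ 2" using a[OF that] r0 by (intro power_strict_mono) auto
    ultimately show ?thesis by (subst \<psi>_eq) auto
  qed
  \<comment> \<open>concavity of \<open>\<psi>\<close>: it lies below its tangent at \<open>w\<close>\<close>
  have tangent: "\<psi> u \<le> \<psi> w + (2 * (cmod k ^ 2 - r ^ 2) * Re (cnj w * (u - w)) - 2 * Re (k * (u - w)))" for u
  proof -
    have "cmod u ^ 2 = cmod w ^ 2 + 2 * Re (cnj w * (u - w)) + cmod (u - w) ^ 2"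
      unfolding cmod_power2 by (simp add: algebra_simps power2_eq_square)
    then have "\<psi> u = \<psi> w + (2 * (cmod k ^ 2 - r ^ 2) * Re (cnj w * (u - w)) - 2 * Re (k * (u - w)))
       + (cmod k ^ 2 - r ^ 2) * cmod (u - w) ^ 2"
    proof -
      have "Re (k * u) = Re (k * w) + Re (k * (u - w))" by (simp add: algebra_simps)
      then show ?thesis
        unfolding \<psi>_def \<open>cmod u ^ 2 = _\<close>
        by algebra
    qed
    moreover have "(cmod k ^ 2 - r ^ 2) * cmod (u - w) ^ 2 \<le> 0" using kr by (simp add: mult_nonpos_nonneg)
    ultimately show ?thesis by simp
  qed
  define L where "L u = 2 * (cmod k ^ 2 - r ^ 2) * Re (cnj w * (u - w)) - 2 * Re (k * (u - w))" for u
  have L_sum: "(\<Sum>i\<in>I. L (g i)) = 2 * (cmod k ^ 2 - r ^ 2) * Re (cnj w * ((\<Sum>i\<in>I. g i) - of_nat (card I) * w))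
     - 2 * Re (k * ((\<Sum>i\<in>I. g i) - of_nat (card I) * w))" for g :: "_ \<Rightarrow> complex"
  proof -
    have "(\<Sum>i\<in>I. g i) - of_nat (card I) * w = (\<Sum>i\<in>I. g i - w)" by (simp add: sum_subtractf)
    then show ?thesis unfolding L_def sum_subtractf[of "\<lambda>i. 2 * (cmod k ^ 2 - r ^ 2) * Re (cnj w * (g i - w))"]
      by (simp only: sum_distrib_left Re_sum)
  qed
  have L0: "L 0 \<ge> 1 - \<psi> w" using tangent[of 0] by (simp add: L_def \<psi>_def)
  have "(\<Sum>i\<in>I. L (1 / (k - a i))) = - (real N - real (card I)) * L 0"
    unfolding L_sum av by (simp add: L_def algebra_simps)
  also have "\<dots> \<le> 0" using N L0 w0 by (intro mult_nonpos_nonneg) auto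
  finally have "(\<Sum>i\<in>I. L (1 / (k - a i))) \<le> 0" .
  moreover have "L (1 / (k - a i)) > 0" if "i \<in> I" for i
    using tangent[of "1 / (k - a i)"] \<psi>_pos[OF that] w0 by (simp add: L_def)
  ultimately have "I = {}"
    using sum_pos[OF I, of "\<lambda>i. L (1 / (k - a i))"] by force
  then have "of_nat N * w = 0" using av by simp
  then show False using N z by (simp add: w_def)
qed

lemma poly_deriv_logarithmic:
  fixes p :: "complex poly"
  assumes "poly p z \<noteq> 0"
  shows "poly (pderiv p) z = poly p z * (\<Sum>x\<in>#proots p. 1 / (z - x))"
proof -
  have *: "poly (\<Prod>x\<in>#A. [:-x, 1:]) z \<noteq> 0 \<Longrightarrow>
     poly (pderiv (\<Prod>x\<in>#A. [:-x, 1:])) z = poly (\<Prod>x\<in>#A. [:-x, 1:]) z * (\<Sum>x\<in>#A. 1 / (z - x))" for A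
  proof (induction A)
    case (add x A)
    define Q where "Q = (\<Prod>x\<in>#A. [:-x, 1:])"
    have "z \<noteq> x" "poly Q z \<noteq> 0" using add.prems by (auto simp: Q_def)
    moreover have "poly (pderiv Q) z = poly Q z * (\<Sum>x\<in>#A. 1 / (z - x))"
      using add.IH \<open>poly Q z \<noteq> 0\<close> by (simp add: Q_def)
    moreover have "pderiv ([:-x, 1:] * Q) = [:-x, 1:] * pderiv Q + Q"
      by (subst pderiv_mult) (simp add: pderiv_pCons)
    moreover have "poly ([:-x, 1:] * pderiv Q + Q) z = (z - x) * poly (pderiv Q) z + poly Q z"
      "poly ([:-x, 1:] * Q) z = (z - x) * poly Q z"
      by (simp_all add: algebra_simps)
    ultimately have "poly (pderiv ([:-x, 1:] * Q)) z = poly ([:-x, 1:] * Q) z * (1 / (z - x) + (\<Sum>x\<in>#A. 1 / (z - x)))"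
      by (simp only:) (simp add: distrib_left)
    then show ?case by (simp add: Q_def)
  qed auto
  have p: "p = smult (lead_coeff p) (\<Prod>x\<in>#proots p. [:-x, 1:])"
    by (rule complex_poly_decompose_multiset[symmetric])
  have "poly (\<Prod>x\<in>#proots p. [:-x, 1:]) z \<noteq> 0"
    using assms by (subst (asm) p) auto
  from *[OF this] show ?thesis by (subst (1 2) p) (simp add: pderiv_smult)
qed

text \<open>Dividing the polar derivative by \<open>poly A k\<close> leaves N minus k - \<zeta>
  times the sum of the 1 / (k - x) over the roots x, to which \<open>grace_disc_aux\<close> applies.
  \<open>N\<close> is a nominal degree, roots at infinity being allowed.\<close>

lemma laguerre_polar_derivative:
  fixes A :: "complex poly"
  assumes A: "degree A \<le> N" "N > 0" "\<And>k. cmod k \<le> r \<Longrightarrow> poly A k \<noteq> 0"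
    and "cmod k \<le> r" "cmod \<zeta> \<le> r"
  shows "of_nat N * poly A k + (\<zeta> - k) * poly (pderiv A) k \<noteq> 0"
proof (cases "\<zeta> = k")
  case True then show ?thesis using A assms by auto
next
  case False
  have A0: "A \<noteq> 0" using A(3)[of k] assms(4) by auto
  obtain xs where xs: "mset xs = proots A" using ex_mset by blast
  have sumxs: "(\<Sum>x\<in>#proots A. 1 / (k - x)) = (\<Sum>i\<in>{..<length xs}. 1 / (k - xs ! i))"
  proof -
    have "(\<Sum>x\<in>#proots A. 1 / (k - x)) = sum_list (map (\<lambda>x. 1 / (k - x)) xs)"
      by (metis mset_map sum_mset_sum_list xs)
    then show ?thesis by (simp add: sum_list_sum_nth atLeast0LessThan)
  qed
  have len: "length xs = degree A"
    by (metis size_proots_complex size_mset xs)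
  have "cmod (xs ! i) > r" if "i < length xs" for i
  proof (rule ccontr)
    assume "\<not> ?thesis"
    moreover have "poly A (xs ! i) = 0"
      using that xs A0 by (metis nth_mem set_mset_mset set_count_proots mem_Collect_eq)
    ultimately show False using A(3)[of "xs ! i"] by auto
  qed
  then have "(\<Sum>i\<in>{..<length xs}. 1 / (k - xs ! i)) \<noteq> of_nat N / (k - \<zeta>)"
    using assms False len by (intro grace_disc_aux[where r = r]) auto
  moreover have "poly (pderiv A) k = poly A k * (\<Sum>i\<in>{..<length xs}. 1 / (k - xs ! i))"
    using poly_deriv_logarithmic[of A k] A(3)[of k] assms(4) sumxs by simp
  moreover define \<sigma> where "\<sigma> = (\<Sum>i\<in>{..<length xs}. 1 / (k - xs ! i))"
  ultimately have *: "\<sigma> * (k - \<zeta>) \<noteq> of_nat N" "poly (pderiv A) k = poly A k * \<sigma>"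
    using False by (auto simp: nonzero_eq_divide_eq)
  have "of_nat N * poly A k + (\<zeta> - k) * poly (pderiv A) k = poly A k * (of_nat N - \<sigma> * (k - \<zeta>))"
    unfolding *(2) by algebra
  then show ?thesis using *(1) A(3)[of k] assms(4) by simp
qed


section \<open>The coincidence theorem for linear functionals\<close>

locale linear_poly_functional =
  fixes \<Lambda> :: "complex poly \<Rightarrow> complex"
  assumes add: "\<Lambda> (p + q) = \<Lambda> p + \<Lambda> q" and smult: "\<Lambda> (smult c p) = c * \<Lambda> p"

lemma linear_functional_mult:
  "linear_poly_functional \<Lambda> \<Longrightarrow> linear_poly_functional (\<lambda>p. \<Lambda> (q * p))"
  by (simp add: linear_poly_functional_def distrib_left)

text \<open>Laguerre's theorem speaks about polynomials in k, so the value on the shifted power must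
  be exhibited as one, together with its derivative. The induction on N generalises the functional:
  splitting off one factor x - k leads to the functional p \<mapsto> \<Lambda>(x p).\<close>

lemma functional_of_shifted_power:
  assumes "linear_poly_functional \<Lambda>"
  shows "\<exists>A. degree A \<le> N \<and> (\<forall>k. poly A k = \<Lambda> ([:-k, 1:] ^ N)) \<and>
     (\<forall>k. poly (pderiv A) k = - of_nat N * \<Lambda> ([:-k, 1:] ^ (N - 1)))"
  using assms
proof (induction N arbitrary: \<Lambda>)
  case 0
  show ?case by (rule exI[of _ "[:\<Lambda> 1:]"]) (simp add: pderiv_pCons)
next
  case (Suc N)
  interpret linear_poly_functional \<Lambda> by fact
  have mult: "\<Lambda> ([:-k, 1:] * p) = \<Lambda> ([:0, 1:] * p) - k * \<Lambda> p" for k p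
  proof -
    have "[:-k, 1:] * p = [:0, 1:] * p + smult (-k) p" by simp
    then show ?thesis by (simp only: add smult) simp
  qed
  obtain A where A: "degree A \<le> N" "\<And>k. poly A k = \<Lambda> ([:-k, 1:] ^ N)"
     "\<And>k. poly (pderiv A) k = - of_nat N * \<Lambda> ([:-k, 1:] ^ (N - 1))"
    using Suc.IH[OF Suc.prems] by blast
  obtain B where B: "degree B \<le> N" "\<And>k. poly B k = \<Lambda> ([:0, 1:] * [:-k, 1:] ^ N)"
     "\<And>k. poly (pderiv B) k = - of_nat N * \<Lambda> ([:0, 1:] * [:-k, 1:] ^ (N - 1))"
    using Suc.IH[OF linear_functional_mult[OF Suc.prems, of "[:0,1:]"]] by blast
  define C where "C = B - [:0, 1:] * A"
  have "degree ([:0, 1:] * A) \<le> Suc N" using A(1) by (intro order.trans[OF degree_mult_le]) simp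
  then have "degree C \<le> Suc N" unfolding C_def using B(1) by (intro degree_diff_le) auto
  moreover have "poly C k = \<Lambda> ([:-k, 1:] ^ Suc N)" for k
    unfolding power_Suc mult C_def by (simp add: A(2) B(2))
  moreover have "poly (pderiv C) k = - of_nat (Suc N) * \<Lambda> ([:-k, 1:] ^ (Suc N - 1))" for k
  proof -
    have "pderiv C = pderiv B - ([:0, 1:] * pderiv A + A)"
      unfolding C_def pderiv_diff by (subst pderiv_mult) (simp add: pderiv_pCons)
    then have "poly (pderiv C) k = poly (pderiv B) k - (k * poly (pderiv A) k + poly A k)"
      by (simp only:) simp
    then have "poly (pderiv C) k = - of_nat N * (\<Lambda> ([:0, 1:] * [:-k, 1:] ^ (N - 1)) - k * \<Lambda> ([:-k, 1:] ^ (N - 1)))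
       - \<Lambda> ([:-k, 1:] ^ N)"
      unfolding A(2,3) B(3) by algebra
    moreover have "of_nat N * (\<Lambda> ([:0, 1:] * [:-k, 1:] ^ (N - 1)) - k * \<Lambda> ([:-k, 1:] ^ (N - 1)))
      = of_nat N * \<Lambda> ([:-k, 1:] ^ N)"
      by (cases N) (simp_all only: mult[symmetric] power_Suc diff_Suc_1 of_nat_0 mult_zero_left)
    ultimately show ?thesis unfolding of_nat_Suc diff_Suc_1 by algebra
  qed
  ultimately show ?case by blast
qed

text \<open>The roots are introduced one at a time. The polar derivative at \<zeta> of the
  polynomial k \<mapsto> \<Lambda>((x - k)^N) is N times \<Lambda>((x - \<zeta>) (x - k)^(N-1)), and
  by Laguerre it has no zero in the disc. So the functional p \<mapsto> \<Lambda>((x - \<zeta>) p)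
  satisfies the hypothesis for the remaining roots.\<close>

theorem grace_walsh_coincidence:
  assumes "linear_poly_functional \<Lambda>" and "\<And>x. x \<in> set xs \<Longrightarrow> cmod x \<le> r"
    and "\<And>k. cmod k \<le> r \<Longrightarrow> \<Lambda> ([:-k, 1:] ^ length xs) \<noteq> 0" and "0 \<le> r"
  shows "\<Lambda> (\<Prod>x\<leftarrow>xs. [:-x, 1:]) \<noteq> 0"
  using assms
proof (induction xs arbitrary: \<Lambda>)
  case Nil
  then show ?case using Nil(3)[of 0] by simp
next
  case (Cons \<zeta> xs)
  interpret linear_poly_functional \<Lambda> by fact
  obtain A where A: "degree A \<le> Suc (length xs)" "\<And>k. poly A k = \<Lambda> ([:-k, 1:] ^ Suc (length xs))"
     "\<And>k. poly (pderiv A) k = - of_nat (Suc (length xs)) * \<Lambda> ([:-k, 1:] ^ length xs)"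
    using functional_of_shifted_power[OF Cons.prems(1), of "Suc (length xs)"] by auto
  have nz: "\<Lambda> ([:-\<zeta>, 1:] * [:-k, 1:] ^ length xs) \<noteq> 0" if k: "cmod k \<le> r" for k
  proof -
    have "of_nat (Suc (length xs)) * poly A k + (\<zeta> - k) * poly (pderiv A) k \<noteq> 0"
      using k Cons.prems by (intro laguerre_polar_derivative[where r = r] A(1)) (auto simp: A(2))
    also have "of_nat (Suc (length xs)) * poly A k + (\<zeta> - k) * poly (pderiv A) k =
       of_nat (Suc (length xs)) * (poly A k + (k - \<zeta>) * \<Lambda> ([:-k, 1:] ^ length xs))"
      unfolding A(3) by algebra
    also have "poly A k + (k - \<zeta>) * \<Lambda> ([:-k, 1:] ^ length xs) = \<Lambda> ([:-\<zeta>, 1:] * [:-k, 1:] ^ length xs)"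
    proof -
      have "[:-\<zeta>, 1:] = [:-k, 1:] + [:k - \<zeta>:]" by simp
      then have "[:-\<zeta>, 1:] * [:-k, 1:] ^ length xs = [:-k, 1:] ^ Suc (length xs) + smult (k - \<zeta>) ([:-k, 1:] ^ length xs)"
        by (simp only: distrib_right) simp
      then show ?thesis unfolding A(2) by (simp only: add smult)
    qed
    finally show ?thesis by simp
  qed
  have "\<Lambda> ([:-\<zeta>, 1:] * (\<Prod>x\<leftarrow>xs. [:-x, 1:])) \<noteq> 0"
    using Cons.prems(2,4) nz by (intro Cons.IH[OF linear_functional_mult[OF Cons.prems(1)]]) auto
  then show ?case by simp
qed

text \<open>The values \<open>h j\<close> obey the three-term recurrence of Hermite polynomials. If
  h grew by at least the factor X/2 in the last step, the constant 8 makes the final term of the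
  recurrence at most half of the leading one, so the growth persists.\<close>

lemma heat_shifted_power_nonzero:
  assumes c: "0 < cmod (z - k)" and \<tau>: "8 * cmod \<tau> * real N \<le> cmod (z - k) ^ 2"
  shows "poly (heat_evolution \<tau> ([:-k, 1:] ^ N)) z \<noteq> 0"
proof -
  define h where "h j = poly (heat_evolution \<tau> ([:-k, 1:] ^ j)) z" for j
  have rec: "h (Suc (Suc j)) = (z - k) * h (Suc j) - 2 * \<tau> * of_nat (Suc j) * h j" for j
  proof -
    have "[:-k, 1:] ^ Suc (Suc j) = [:0,1:] * [:-k, 1:] ^ Suc j + smult (-k) ([:-k, 1:] ^ Suc j)"
      unfolding power_Suc[of _ "Suc j"] by simp
    moreover have "pderiv ([:-k, 1:] ^ Suc j) = smult (of_nat (Suc j)) ([:-k, 1:] ^ j)"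
      by (subst pderiv_power_Suc) (simp add: pderiv_pCons)
    ultimately show ?thesis unfolding h_def
      by (simp only: heat_evolution_add heat_evolution_smult heat_evolution_x_mult heat_evolution_pderiv[symmetric])
        (simp add: algebra_simps del: of_nat_Suc power_Suc)
  qed
  define X where "X = cmod (z - k)"
  have X: "X > 0" using c by (simp add: X_def)
  have h0: "h 0 = 1" and h1: "h 1 = z - k"
  proof -
    have "[:-k, 1:] = [:0,1:] * 1 + smult (-k) (1 :: complex poly)" by simp
    then have "heat_evolution \<tau> [:-k, 1:] = heat_evolution \<tau> ([:0,1:] * 1 + smult (-k) 1)" by (rule arg_cong)
    also have "\<dots> = [:0,1:] - [:k:]"
      by (simp only: heat_evolution_add heat_evolution_smult heat_evolution_x_mult heat_evolution_1) simp
    finally show "h 1 = z - k" by (simp add: h_def)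
  qed (simp add: h_def)
  have grow: "cmod (h (Suc j)) \<ge> X / 2 * cmod (h j) \<and> cmod (h j) > 0" if "j \<le> N" for j
    using that
  proof (induction j)
    case 0
    then show ?case using h0 h1 X by (simp add: X_def)
  next
    case (Suc j)
    then have IH: "cmod (h (Suc j)) \<ge> X / 2 * cmod (h j)" "cmod (h j) > 0" by auto
    have "cmod (h (Suc (Suc j))) \<ge> X * cmod (h (Suc j)) - 2 * cmod \<tau> * real (Suc j) * cmod (h j)"
      unfolding rec X_def using norm_triangle_ineq2[of "(z - k) * h (Suc j)" "2 * \<tau> * of_nat (Suc j) * h j"]
      by (simp add: norm_mult del: of_nat_Suc)
    moreover have "2 * cmod \<tau> * real (Suc j) * cmod (h j) \<le> X / 2 * cmod (h (Suc j))"
    proof -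
      have "8 * cmod \<tau> * real (Suc j) \<le> 8 * cmod \<tau> * real N" using Suc.prems by (intro mult_left_mono) auto
      also have "\<dots> \<le> X ^ 2" using \<tau> by (simp add: X_def)
      finally have "2 * cmod \<tau> * real (Suc j) * cmod (h j) \<le> (X ^ 2 / 4) * cmod (h j)"
        by (intro mult_right_mono) auto
      also have "\<dots> = X / 2 * (X / 2 * cmod (h j))" by (simp add: power2_eq_square)
      also have "\<dots> \<le> X / 2 * cmod (h (Suc j))" using IH(1) X by (intro mult_left_mono) auto
      finally show ?thesis .
    qed
    moreover have "cmod (h (Suc j)) > 0" using IH X by (smt (verit) divide_pos_pos mult_pos_pos)
    ultimately show ?case by (simp add: field_simps)
  qed
  show ?thesis using grow[of N] by (simp add: h_def)
qed

lemma linear_functional_heat: "linear_poly_functional (\<lambda>p. poly (heat_evolution \<tau> p) z)"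
  by (simp add: linear_poly_functional_def heat_evolution_add heat_evolution_smult)

text \<open>The coincidence theorem reduces the claim to one root k of full multiplicity in the disc
  of radius \<open>r\<close>; a point of modulus at least \<open>r + c\<close> has distance at least
  \<open>c\<close> from it.\<close>

lemma heat_evolution_zero_bound:
  fixes p :: "complex poly"
  assumes p: "p \<noteq> 0" "\<And>x. poly p x = 0 \<Longrightarrow> cmod x \<le> r" and r: "0 \<le> r" and c: "c > 0"
    and \<tau>: "8 * cmod \<tau> * real (degree p) \<le> c ^ 2" and z: "poly (heat_evolution \<tau> p) z = 0"
  shows "cmod z < r + c"
proof (rule ccontr)
  assume "\<not> ?thesis"
  then have zc: "cmod z \<ge> r + c" by simp
  obtain xs where xs: "mset xs = proots p" using ex_mset by blast
  have len: "length xs = degree p" by (metis size_proots_complex size_mset xs)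
  have set: "set xs = {x. poly p x = 0}" using p(1) by (metis set_count_proots set_mset_mset xs)
  have "p = smult (lead_coeff p) (\<Prod>x\<leftarrow>xs. [:-x, 1:])"
    by (metis complex_poly_decompose_multiset mset_map prod_mset_prod_list xs)
  moreover have "poly (heat_evolution \<tau> (\<Prod>x\<leftarrow>xs. [:-x, 1:])) z \<noteq> 0"
  proof (rule grace_walsh_coincidence[OF linear_functional_heat _ _ r])
    show "cmod x \<le> r" if "x \<in> set xs" for x using that set p(2) by auto
    fix k assume "cmod k \<le> r"
    then have k: "c \<le> cmod (z - k)" using zc norm_triangle_ineq2[of z k] by linarith
    then have "c ^ 2 \<le> cmod (z - k) ^ 2" using c by (intro power_mono) auto
    then have "8 * cmod \<tau> * real (length xs) \<le> cmod (z - k) ^ 2" using \<tau> len by simp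
    then show "poly (heat_evolution \<tau> ([:-k, 1:] ^ length xs)) z \<noteq> 0"
      using k c by (intro heat_shifted_power_nonzero) auto
  qed
  ultimately have "poly (heat_evolution \<tau> p) z \<noteq> 0"
    using p(1) by (metis heat_evolution_smult leading_coeff_0_iff mult_eq_0_iff poly_smult)
  then show False using z by simp
qed

section \<open>Weak limits from Cauchy transforms\<close>

text \<open>Vitali's convergence theorem on a set of finite measure, with uniform integrability
  expressed by the excess of the modulus over a level K. Truncation at K costs at most e/4 for each
  function, and truncated functions converge dominatedly.\<close>

lemma integral_tendsto_uniformly_integrable:
  fixes f :: "nat \<Rightarrow> 'a \<Rightarrow> complex"
  assumes A: "A \<in> sets M" "emeasure M A < \<infinity>"
    and meas [measurable]: "\<And>n. f n \<in> borel_measurable M" "f0 \<in> borel_measurable M"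
    and supp: "\<And>n x. x \<notin> A \<Longrightarrow> f n x = 0" "\<And>x. x \<notin> A \<Longrightarrow> f0 x = 0"
    and lim: "AE x in M. (\<lambda>n. f n x) \<longlonglongrightarrow> f0 x"
    and tail: "\<And>e. e > 0 \<Longrightarrow> \<exists>K\<ge>0. \<forall>n. (\<integral>\<^sup>+x. ennreal (max 0 (cmod (f n x) - K)) \<partial>M) \<le> ennreal e"
  shows "\<And>n. integrable M (f n)" "integrable M f0" "(\<lambda>n. \<integral>x. f n x \<partial>M) \<longlonglongrightarrow> (\<integral>x. f0 x \<partial>M)"
proof -
  \<comment> \<open>Fatou's lemma passes the tail bound on to the limit.\<close>
  have tail0: "(\<integral>\<^sup>+x. ennreal (max 0 (cmod (f0 x) - K)) \<partial>M) \<le> ennreal e"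
    if K: "\<forall>n. (\<integral>\<^sup>+x. ennreal (max 0 (cmod (f n x) - K)) \<partial>M) \<le> ennreal e" for K e
  proof -
    have "(\<integral>\<^sup>+x. ennreal (max 0 (cmod (f0 x) - K)) \<partial>M) = (\<integral>\<^sup>+x. liminf (\<lambda>n. ennreal (max 0 (cmod (f n x) - K))) \<partial>M)"
    proof (rule nn_integral_cong_AE)
      show "AE x in M. ennreal (max 0 (cmod (f0 x) - K)) = liminf (\<lambda>n. ennreal (max 0 (cmod (f n x) - K)))"
        using lim
      proof eventually_elim
        case (elim x)
        have "(\<lambda>n. ennreal (max 0 (cmod (f n x) - K))) \<longlonglongrightarrow> ennreal (max 0 (cmod (f0 x) - K))"
          by (intro tendsto_ennrealI tendsto_max tendsto_const tendsto_diff tendsto_norm elim)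
        then show ?case by (simp add: lim_imp_Liminf)
      qed
    qed
    also have "\<dots> \<le> liminf (\<lambda>n. \<integral>\<^sup>+x. ennreal (max 0 (cmod (f n x) - K)) \<partial>M)"
      by (rule nn_integral_liminf) measurable
    also have "\<dots> \<le> ennreal e" using K by (intro Liminf_le) auto
    finally show ?thesis .
  qed
  have int: "integrable M h" if [measurable]: "h \<in> borel_measurable M" and h: "\<And>x. x \<notin> A \<Longrightarrow> h x = 0"
    and K: "K \<ge> 0" "(\<integral>\<^sup>+x. ennreal (max 0 (cmod (h x) - K)) \<partial>M) \<le> ennreal e" for h :: "'a \<Rightarrow> complex" and K e
  proof (rule integrableI_bounded)
    have "(\<integral>\<^sup>+x. ennreal (cmod (h x)) \<partial>M) \<le> (\<integral>\<^sup>+x. ennreal K * indicator A x + ennreal (max 0 (cmod (h x) - K)) \<partial>M)"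
    proof (intro nn_integral_mono)
      fix x
      show "ennreal (cmod (h x)) \<le> ennreal K * indicator A x + ennreal (max 0 (cmod (h x) - K))"
      proof (cases "x \<in> A")
        case True
        have "ennreal (cmod (h x)) \<le> ennreal (K + max 0 (cmod (h x) - K))" by (intro ennreal_leI) auto
        then show ?thesis using True K(1) by (simp add: ennreal_plus)
      qed (use h in simp)
    qed
    also have "\<dots> = ennreal K * emeasure M A + (\<integral>\<^sup>+x. ennreal (max 0 (cmod (h x) - K)) \<partial>M)"
      using A by (subst nn_integral_add) (auto simp: nn_integral_cmult_indicator)
    also have "\<dots> < \<infinity>"
    proof -
      have "ennreal K * emeasure M A < \<infinity>" using A by (simp add: ennreal_mult_less_top)
      moreover have "(\<integral>\<^sup>+x. ennreal (max 0 (cmod (h x) - K)) \<partial>M) < \<infinity>"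
        using K(2) by (rule le_less_trans) simp
      ultimately show ?thesis by simp
    qed
    finally show "(\<integral>\<^sup>+x. ennreal (cmod (h x)) \<partial>M) < \<infinity>" .
  qed fact
  show f_int: "integrable M (f n)" for n
    using tail[of 1] int[OF meas(1) supp(1)] by (metis zero_less_one)
  show f0_int: "integrable M f0"
    using tail[of 1] int[OF meas(2) supp(2)] tail0 by (metis zero_less_one)
  show "(\<lambda>n. \<integral>x. f n x \<partial>M) \<longlonglongrightarrow> (\<integral>x. f0 x \<partial>M)"
  proof (rule LIMSEQ_I)
    fix e :: real assume e: "0 < e"
    obtain K where K: "K \<ge> 0" "\<And>n. (\<integral>\<^sup>+x. ennreal (max 0 (cmod (f n x) - K)) \<partial>M) \<le> ennreal (e / 4)"
      using tail[of "e/4"] e by auto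
    \<comment> \<open>The radial retraction onto the disc of radius K. Its continuity preserves
      pointwise convergence, and the distance it moves a point is exactly the excess over K.\<close>
    define T where "T x = (if cmod x \<le> K then 1 else K / cmod x) *\<^sub>R x" for x :: complex
    have T_eq: "T x = (K / max K (cmod x)) *\<^sub>R x" if "K > 0" for x using that by (auto simp: T_def max_def)
    have T_cont: "continuous_on UNIV T"
    proof (cases "K > 0")
      case True
      then show ?thesis unfolding T_eq[OF True, abs_def]
        by (intro continuous_intros) (auto simp: max_def)
    next
      case False
      then have "T = (\<lambda>x. 0)" using K by (auto simp: T_def fun_eq_iff)
      then show ?thesis by simp
    qed
    have T_meas [measurable]: "T \<in> borel_measurable borel" using T_cont by (rule borel_measurable_continuous_onI)
    have T_bd: "cmod (T x) \<le> K" for x using K by (auto simp: T_def)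
    have T_diff: "cmod (x - T x) = max 0 (cmod x - K)" for x
    proof (cases "cmod x \<le> K")
      case False
      then have "x - T x = (1 - K / cmod x) *\<^sub>R x" by (simp add: T_def scaleR_diff_left)
      then have "cmod (x - T x) = \<bar>1 - K / cmod x\<bar> * cmod x" by simp
      also have "\<dots> = cmod x - K" using False K by (auto simp: abs_if field_simps)
      finally show ?thesis using False by simp
    qed (simp add: T_def)
    have near: "cmod ((\<integral>x. h x \<partial>M) - (\<integral>x. T (h x) \<partial>M)) \<le> e / 4"
      if h: "integrable M h" "\<And>x. x \<notin> A \<Longrightarrow> h x = 0" "(\<integral>\<^sup>+x. ennreal (max 0 (cmod (h x) - K)) \<partial>M) \<le> ennreal (e / 4)" for h
    proof -
      have hm [measurable]: "h \<in> borel_measurable M" using h(1) by simp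
      have Tle: "cmod (T x) \<le> cmod x" for x using K by (auto simp: T_def)
      have Th: "integrable M (\<lambda>x. T (h x))"
        by (rule Bochner_Integration.integrable_bound[OF h(1)]) (auto simp: Tle)
      have "(\<integral>x. h x \<partial>M) - (\<integral>x. T (h x) \<partial>M) = (\<integral>x. h x - T (h x) \<partial>M)" using h Th by simp
      also have "cmod \<dots> \<le> (\<integral>x. cmod (h x - T (h x)) \<partial>M)" by (rule integral_norm_bound)
      also have "\<dots> = (\<integral>x. max 0 (cmod (h x) - K) \<partial>M)" by (simp add: T_diff)
      also have "\<dots> = enn2real (\<integral>\<^sup>+x. ennreal (max 0 (cmod (h x) - K)) \<partial>M)"
        by (rule integral_eq_nn_integral) auto
      also have "\<dots> \<le> e / 4" using h(3) e by (intro enn2real_leI) auto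
      finally show ?thesis .
    qed
    have "(\<lambda>n. \<integral>x. T (f n x) \<partial>M) \<longlonglongrightarrow> (\<integral>x. T (f0 x) \<partial>M)"
    proof (rule integral_dominated_convergence[where w = "\<lambda>x. K * indicator A x"])
      show "integrable M (\<lambda>x. K * indicator A x)" using A by (intro integrable_mult_right integrable_real_indicator) auto
      show "AE x in M. (\<lambda>n. T (f n x)) \<longlonglongrightarrow> T (f0 x)"
        using lim
      proof eventually_elim
        case (elim x)
        have "isCont T (f0 x)" using T_cont by (simp add: continuous_on_eq_continuous_at)
        then show ?case using elim by (rule isCont_tendsto_compose)
      qed
      show "AE x in M. norm (T (f n x)) \<le> K * indicator A x" for n
      proof (intro AE_I2)
        fix x
        show "norm (T (f n x)) \<le> K * indicator A x"
        proof (cases "x \<in> A")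
          case True then show ?thesis using T_bd by simp
        next
          case False then show ?thesis using supp(1)[OF False] by (simp add: T_def)
        qed
      qed
    qed auto
    then obtain n0 where n0: "\<And>n. n \<ge> n0 \<Longrightarrow> norm ((\<integral>x. T (f n x) \<partial>M) - (\<integral>x. T (f0 x) \<partial>M)) < e / 4"
      using e LIMSEQ_D[of _ _ "e/4"] by (metis divide_pos_pos zero_less_numeral)
    show "\<exists>no. \<forall>n\<ge>no. norm ((\<integral>x. f n x \<partial>M) - (\<integral>x. f0 x \<partial>M)) < e"
    proof (intro exI allI impI)
      fix n assume "n \<ge> n0"
      have 1: "cmod ((\<integral>x. f n x \<partial>M) - (\<integral>x. T (f n x) \<partial>M)) \<le> e / 4"
        using near[OF f_int supp(1) K(2)] .
      have 2: "cmod ((\<integral>x. f0 x \<partial>M) - (\<integral>x. T (f0 x) \<partial>M)) \<le> e / 4"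
        using near[OF f0_int supp(2) tail0] K(2) by blast
      have "cmod (p - p0) < e" if "cmod (p - q) \<le> e / 4" "cmod (p0 - q0) \<le> e / 4" "cmod (q - q0) < e / 4" for p q p0 q0
      proof -
        have "cmod (p - p0) \<le> cmod (p - q) + cmod (q - q0) + cmod (p0 - q0)"
          using norm_triangle_ineq4[of "(p - q) + (q - q0)" "p0 - q0"] norm_triangle_ineq[of "p - q" "q - q0"] by simp
        then show ?thesis using that e by linarith
      qed
      from this[OF 1 2 n0[OF \<open>n \<ge> n0\<close>]]
      show "norm ((\<integral>x. f n x \<partial>M) - (\<integral>x. f0 x \<partial>M)) < e" .
    qed
  qed
qed

text \<open>Where 2^(k+m) <= 1/|z| < 2^(k+m+1), the point lies in a disc of radius 2^-(k+m). Height
  times area is at most 2 pi 2^-(k+m), and summation over k gives 4 pi 2^-m.\<close>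

lemma inverse_norm_tail:
  "(\<integral>\<^sup>+z. ennreal (max 0 (1 / cmod z - 2 ^ m)) \<partial>lborel) \<le> ennreal (4 * pi * (1/2) ^ m)"
proof -
  define r :: "nat \<Rightarrow> real" where "r k = (1/2) ^ (k + m)" for k
  have "(\<integral>\<^sup>+z. ennreal (max 0 (1 / cmod z - 2 ^ m)) \<partial>lborel)
     \<le> (\<integral>\<^sup>+z. (\<Sum>k. ennreal (2 ^ (k + m + 1)) * indicator (cball 0 (r k)) (z::complex)) \<partial>lborel)"
  proof (intro nn_integral_mono)
    fix z :: complex
    show "ennreal (max 0 (1 / cmod z - 2 ^ m)) \<le> (\<Sum>k. ennreal (2 ^ (k + m + 1)) * indicator (cball 0 (r k)) z)"
    proof (cases "1 / cmod z > 2 ^ m")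
      case False then show ?thesis by simp
    next
      case True
      then have z: "cmod z > 0" by (cases "z = 0") (auto simp: not_less)
      obtain n0 :: nat where n0: "1 / cmod z < 2 ^ n0" using real_arch_pow[of 2 "1 / cmod z"] by auto
      define k where "k = (LEAST k. 1 / cmod z < 2 ^ (k + m + 1))"
      have ex: "1 / cmod z < 2 ^ (n0 + m + 1)"
        by (rule less_le_trans[OF n0]) (intro power_increasing, auto)
      have k: "1 / cmod z < 2 ^ (k + m + 1)" unfolding k_def by (rule LeastI[of _ n0]) (rule ex)
      have "2 ^ (k + m) \<le> 1 / cmod z"
      proof (cases k)
        case 0 then show ?thesis using True by simp
      next
        case (Suc l)
        have "\<not> 1 / cmod z < 2 ^ (l + m + 1)" using not_less_Least[of l] Suc unfolding k_def by (metis lessI)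
        then show ?thesis using Suc by simp
      qed
      then have "cmod z \<le> r k" using z by (simp add: r_def power_one_over field_simps)
      then have "ennreal (max 0 (1 / cmod z - 2 ^ m)) \<le> ennreal (2 ^ (k + m + 1)) * indicator (cball 0 (r k)) z"
      proof -
        have "max 0 (1 / cmod z - 2 ^ m) \<le> 2 ^ (k + m + 1)" using k by (intro max.boundedI) (auto intro: less_imp_le less_le_trans order_trans[of _ "1 / cmod z"])
        then show ?thesis using \<open>cmod z \<le> r k\<close> by (simp add: ennreal_leI del: max.bounded_iff)
      qed
      also have "\<dots> \<le> (\<Sum>k. ennreal (2 ^ (k + m + 1)) * indicator (cball 0 (r k)) z)"
      proof -
        define a where "a k = ennreal (2 ^ (k + m + 1)) * indicator (cball 0 (r k)) z" for k
        have "sum a {k} \<le> suminf a" by (intro sum_le_suminf) auto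
        then have "a k \<le> suminf a" by simp
        then show ?thesis unfolding a_def .
      qed
      finally show ?thesis .
    qed
  qed
  also have "\<dots> = (\<Sum>k. \<integral>\<^sup>+z. ennreal (2 ^ (k + m + 1)) * indicator (cball 0 (r k)) (z::complex) \<partial>lborel)"
    by (rule nn_integral_suminf) (simp add: borel_measurable_indicator borel_measurable_times_ennreal)
  also have "\<dots> = (\<Sum>k. ennreal (2 * pi * (1/2) ^ m * (1/2) ^ k))"
  proof (rule suminf_cong)
    fix k
    have "(\<integral>\<^sup>+z. ennreal (2 ^ (k + m + 1)) * indicator (cball 0 (r k)) (z::complex) \<partial>lborel) =
       ennreal (2 ^ (k + m + 1)) * ennreal (pi * r k ^ 2)"
      by (subst nn_integral_cmult_indicator) (auto simp: emeasure_cball r_def unit_ball_vol_2)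
    also have "\<dots> = ennreal (2 * pi * (1/2) ^ m * (1/2) ^ k)"
      by (subst ennreal_mult[symmetric]) (auto simp: r_def power2_eq_square power_add power_one_over field_simps)
    finally show "(\<integral>\<^sup>+z. ennreal (2 ^ (k + m + 1)) * indicator (cball 0 (r k)) (z::complex) \<partial>lborel) =
       ennreal (2 * pi * (1/2) ^ m * (1/2) ^ k)" .
  qed
  also have "\<dots> = ennreal (4 * pi * (1/2) ^ m)"
  proof (rule suminf_ennreal_eq)
    show "(\<lambda>k. 2 * pi * (1/2) ^ m * (1/2) ^ k) sums (4 * pi * (1/2) ^ m)"
      using sums_mult[OF geometric_sums[of "1/2::real"], of "2 * pi * (1/2) ^ m"] by (simp add: mult_ac)
  qed simp
  finally show ?thesis .
qed

lemma nn_integral_lborel_translate: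
  assumes [measurable]: "f \<in> borel_measurable borel"
  shows "(\<integral>\<^sup>+x. f (x + c) \<partial>lborel) = (\<integral>\<^sup>+x. f (x :: 'a :: euclidean_space) \<partial>lborel)"
proof -
  have "(\<integral>\<^sup>+x. f x \<partial>lborel) = (\<integral>\<^sup>+x. f x \<partial>(distr lborel borel ((+) c)))" by (simp add: lborel_distr_plus)
  also have "\<dots> = (\<integral>\<^sup>+x. f (c + x) \<partial>lborel)" by (rule nn_integral_distr) auto
  finally show ?thesis by (simp add: add.commute)
qed

text \<open>The excess over a level is a convex function of the value, so a convex combination of
  kernels has at most the combined excess. Translation invariance makes the bound independent of the
  points and of \<open>c\<close>.\<close>

lemma cauchy_transform_tail:
  fixes w :: "complex \<Rightarrow> real"
  assumes "finite Z" "\<And>x. x \<in> Z \<Longrightarrow> 0 \<le> w x" "(\<Sum>x\<in>Z. w x) = 1"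
  shows "(\<integral>\<^sup>+z. ennreal (max 0 (cmod (\<Sum>x\<in>Z. of_real (w x) / (z + c - x)) - 2 ^ m)) \<partial>lborel) \<le> ennreal (4 * pi * (1/2) ^ m)"
proof -
  have "(\<integral>\<^sup>+z. ennreal (max 0 (cmod (\<Sum>x\<in>Z. of_real (w x) / (z + c - x)) - 2 ^ m)) \<partial>lborel)
    \<le> (\<integral>\<^sup>+z. (\<Sum>x\<in>Z. ennreal (w x) * ennreal (max 0 (1 / cmod (z + (c - x)) - 2 ^ m))) \<partial>lborel)"
  proof (intro nn_integral_mono)
    fix z
    have "cmod (\<Sum>x\<in>Z. of_real (w x) / (z + c - x)) \<le> (\<Sum>x\<in>Z. cmod (of_real (w x) / (z + c - x)))" by (rule norm_sum)
    also have "\<dots> = (\<Sum>x\<in>Z. w x * (1 / cmod (z + (c - x))))"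
      using assms(2) by (intro sum.cong refl) (simp add: norm_divide add_diff_eq)
    finally have "cmod (\<Sum>x\<in>Z. of_real (w x) / (z + c - x)) - 2 ^ m \<le> (\<Sum>x\<in>Z. w x * (1 / cmod (z + (c - x)))) - (\<Sum>x\<in>Z. w x * 2 ^ m)"
      using assms(3) by (simp flip: sum_distrib_right)
    also have "\<dots> = (\<Sum>x\<in>Z. w x * (1 / cmod (z + (c - x)) - 2 ^ m))" by (simp add: right_diff_distrib sum_subtractf)
    also have "\<dots> \<le> (\<Sum>x\<in>Z. w x * max 0 (1 / cmod (z + (c - x)) - 2 ^ m))"
      using assms(2) by (intro sum_mono mult_left_mono) auto
    finally have "max 0 (cmod (\<Sum>x\<in>Z. of_real (w x) / (z + c - x)) - 2 ^ m) \<le> (\<Sum>x\<in>Z. w x * max 0 (1 / cmod (z + (c - x)) - 2 ^ m))"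
      using assms(2) by (intro max.boundedI sum_nonneg mult_nonneg_nonneg) auto
    then have "ennreal (max 0 (cmod (\<Sum>x\<in>Z. of_real (w x) / (z + c - x)) - 2 ^ m)) \<le> ennreal (\<Sum>x\<in>Z. w x * max 0 (1 / cmod (z + (c - x)) - 2 ^ m))"
      by (rule ennreal_leI)
    also have "\<dots> = (\<Sum>x\<in>Z. ennreal (w x) * ennreal (max 0 (1 / cmod (z + (c - x)) - 2 ^ m)))"
      using assms(2) by (subst sum_ennreal[symmetric]) (auto simp: ennreal_mult intro!: sum.cong)
    finally show "ennreal (max 0 (cmod (\<Sum>x\<in>Z. of_real (w x) / (z + c - x)) - 2 ^ m)) \<le> (\<Sum>x\<in>Z. ennreal (w x) * ennreal (max 0 (1 / cmod (z + (c - x)) - 2 ^ m)))" .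
  qed
  also have "\<dots> = (\<Sum>x\<in>Z. ennreal (w x) * (\<integral>\<^sup>+z. ennreal (max 0 (1 / cmod (z + (c - x)) - 2 ^ m)) \<partial>lborel))"
    by (subst nn_integral_sum) (auto simp: nn_integral_cmult)
  also have "\<dots> = (\<Sum>x\<in>Z. ennreal (w x) * (\<integral>\<^sup>+z. ennreal (max 0 (1 / cmod z - 2 ^ m)) \<partial>lborel))"
    by (intro sum.cong refl arg_cong2[where f = "(*)"] nn_integral_lborel_translate[where f = "\<lambda>z. ennreal (max 0 (1 / cmod z - 2 ^ m))"]) measurable
  also have "\<dots> = (\<Sum>x\<in>Z. ennreal (w x)) * (\<integral>\<^sup>+z. ennreal (max 0 (1 / cmod z - 2 ^ m)) \<partial>lborel)" by (simp add: sum_distrib_right)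
  also have "(\<Sum>x\<in>Z. ennreal (w x)) = 1" using assms by (subst sum_ennreal) auto
  finally show ?thesis using inverse_norm_tail[of m] by simp
qed

lemma AE_lborel_of_negligible:
  fixes S :: "complex set"
  assumes "negligible S"
  shows "AE x in lborel. x + c \<notin> S"
proof -
  have "negligible ((+) (-c) ` S)" using assms by (rule negligible_translation)
  then have "(+) (-c) ` S \<in> null_sets lebesgue" by (simp add: negligible_iff_null_sets)
  then have "AE x in lebesgue. x \<notin> (+) (-c) ` S" by (rule AE_not_in)
  then have "AE x in lborel. x \<notin> (+) (-c) ` S" by (simp add: AE_completion_iff)
  then show ?thesis
  proof eventually_elim
    case (elim x)
    show "x + c \<notin> S"
    proof
      assume "x + c \<in> S"
      then have "- c + (x + c) \<in> (+) (-c) ` S" by (rule imageI)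
      then show False using elim by simp
    qed
  qed
qed

section \<open>Contour integrals over small squares\<close>

definition corner :: "real \<Rightarrow> nat \<Rightarrow> complex" where
  "corner h k = of_real h * (- 1 - \<i>) * \<i> ^ k"

text \<open>The corners run counterclockwise from the lower left one of a square of side 2 h; corner
  4 equals corner 0 and closes the contour.\<close>

lemma corner_simps:
  "corner h 0 = Complex (- h) (- h)" "corner h (Suc 0) = Complex h (- h)" "corner h 2 = Complex h h"
  "corner h 3 = Complex (- h) h" "corner h 4 = Complex (- h) (- h)"
  by (simp_all add: corner_def complex_eq_iff power2_eq_square power3_eq_cube eval_nat_numeral)

definition edge :: "real \<Rightarrow> nat \<Rightarrow> real \<Rightarrow> complex" where
  "edge h k x = linepath (corner h k) (corner h (Suc k)) x"

lemma continuous_edge: "continuous_on S (edge h k)"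
  unfolding edge_def[abs_def] by (rule continuous_on_linepath)

lemma borel_measurable_edge [measurable]: "edge h k \<in> borel_measurable borel"
  by (rule borel_measurable_continuous_onI) (rule continuous_edge)

text \<open>The boundary integral is written with Lebesgue integrals over the edges because it is
  applied to limit functions known only to be measurable; Fubini and dominated convergence then
  apply directly.\<close>

definition square_integral :: "real \<Rightarrow> (complex \<Rightarrow> complex) \<Rightarrow> complex" where
  "square_integral h f = (\<Sum>k<4. (corner h (Suc k) - corner h k) * (\<integral>x. indicator {0..1} x *\<^sub>R f (edge h k x) \<partial>lborel))"

lemma linepath_integral:
  assumes "continuous_on (closed_segment p q) f"
  shows "contour_integral (linepath p q) f = (q - p) * (\<integral>x. indicator {0..1} x *\<^sub>R f (linepath p q x) \<partial>lborel)"
proof -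
  have c: "continuous_on {0..1} (\<lambda>x. f (linepath p q x))"
    by (rule continuous_on_compose2[OF assms continuous_on_linepath]) (auto simp: linepath_image_01[symmetric])
  have i: "set_integrable lborel {0..1} (\<lambda>x. f (linepath p q x))"
    unfolding set_integrable_def by (rule borel_integrable_compact[OF compact_Icc c])
  have "contour_integral (linepath p q) f = integral {0..1} (\<lambda>x. f (linepath p q x) * (q - p))"
    by (simp add: contour_integral_integral)
  also have "\<dots> = integral {0..1} (\<lambda>x. f (linepath p q x)) * (q - p)" by (rule integral_mult_left)
  also have "integral {0..1} (\<lambda>x. f (linepath p q x)) = (\<integral>x. indicator {0..1} x *\<^sub>R f (linepath p q x) \<partial>lborel)"
    using set_borel_integral_eq_integral(2)[OF i] by (simp add: set_lebesgue_integral_def)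
  finally show ?thesis by (simp add: mult.commute)
qed

lemma square_integral_eq_contour:
  assumes h: "h > 0" and f: "continuous_on (path_image (rectpath (w + corner h 0) (w + corner h 2))) f"
  shows "square_integral h (\<lambda>z. f (w + z)) = contour_integral (rectpath (w + corner h 0) (w + corner h 2)) f"
proof -
  define c where "c k = w + corner h k" for k
  have rp: "rectpath (w + corner h 0) (w + corner h 2) = linepath (c 0) (c 1) +++ linepath (c 1) (c 2) +++ linepath (c 2) (c 3) +++ linepath (c 3) (c 4)"
    unfolding rectpath_def Let_def c_def
    by (intro arg_cong2[where f = "(+++)"] arg_cong2[where f = linepath]) (simp_all add: corner_simps complex_eq_iff)
  have img: "path_image (rectpath (w + corner h 0) (w + corner h 2)) =
     closed_segment (c 0) (c 1) \<union> (closed_segment (c 1) (c 2) \<union> (closed_segment (c 2) (c 3) \<union> closed_segment (c 3) (c 4)))"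
    unfolding rp by (simp add: path_image_join)
  have cont: "continuous_on (closed_segment (c k) (c (Suc k))) f" if "k < 4" for k
  proof -
    have "k = 0 \<or> k = 1 \<or> k = 2 \<or> k = 3" using that by auto
    then show ?thesis by (elim disjE) (auto intro!: continuous_on_subset[OF f[unfolded img]] simp: eval_nat_numeral)
  qed
  have each: "contour_integral (linepath (c k) (c (Suc k))) f = (corner h (Suc k) - corner h k) * (\<integral>x. indicator {0..1} x *\<^sub>R f (w + edge h k x) \<partial>lborel)"
    if "k < 4" for k
  proof -
    have "linepath (c k) (c (Suc k)) x = w + edge h k x" for x
      by (simp add: c_def edge_def linepath_def algebra_simps)
    then show ?thesis using linepath_integral[OF cont[OF that]] by (simp add: c_def)
  qed
  have int: "f contour_integrable_on linepath (c k) (c (Suc k))" if "k < 4" for k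
    by (rule contour_integrable_continuous_linepath[OF cont[OF that]])
  have "contour_integral (rectpath (w + corner h 0) (w + corner h 2)) f =
    contour_integral (linepath (c 0) (c 1)) f + (contour_integral (linepath (c 1) (c 2)) f +
     (contour_integral (linepath (c 2) (c 3)) f + contour_integral (linepath (c 3) (c 4)) f))"
    unfolding rp using int[of 0] int[of 1] int[of 2] int[of 3]
    by (simp add: contour_integral_join contour_integrable_join eval_nat_numeral)
  also have "\<dots> = (\<Sum>k<4. contour_integral (linepath (c k) (c (Suc k))) f)"
    by (simp add: eval_nat_numeral)
  also have "\<dots> = square_integral h (\<lambda>z. f (w + z))"
    unfolding square_integral_def by (intro sum.cong refl each) auto
  finally show ?thesis ..
qed

lemma path_image_square:
  assumes h: "h > 0"
  shows "path_image (rectpath (w + corner h 0) (w + corner h 2)) = cbox (w + corner h 0) (w + corner h 2) - box (w + corner h 0) (w + corner h 2)"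
  using h by (intro path_image_rectpath_cbox_minus_box) (auto simp: corner_simps)

lemma square_integral_cauchy_kernels:
  assumes h: "h > 0" and Z: "finite Z" "\<And>x. x \<in> Z \<Longrightarrow> x \<notin> path_image (rectpath (w + corner h 0) (w + corner h 2))"
  shows "square_integral h (\<lambda>z. \<Sum>x\<in>Z. c x / (w + z - x)) =
    (\<Sum>x\<in>Z. c x * (2 * pi * \<i> * indicator (box (w + corner h 0) (w + corner h 2)) x))"
proof -
  let ?g = "rectpath (w + corner h 0) (w + corner h 2)"
  have "square_integral h (\<lambda>z. \<Sum>x\<in>Z. c x / (w + z - x)) = contour_integral ?g (\<lambda>z. \<Sum>x\<in>Z. c x / (z - x))"
    using Z(2) by (intro square_integral_eq_contour[OF h, of w "\<lambda>z. \<Sum>x\<in>Z. c x / (z - x)"] continuous_intros) auto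
  also have "((\<lambda>z. \<Sum>x\<in>Z. c x * (1 / (z - x))) has_contour_integral (\<Sum>x\<in>Z. c x * (2 * pi * \<i> * winding_number ?g x))) ?g"
    using Z by (intro has_contour_integral_sum has_contour_integral_lmul has_contour_integral_winding_number) auto
  then have "contour_integral ?g (\<lambda>z. \<Sum>x\<in>Z. c x / (z - x)) = (\<Sum>x\<in>Z. c x * (2 * pi * \<i> * winding_number ?g x))"
    by (simp add: contour_integral_unique)
  also have "\<dots> = (\<Sum>x\<in>Z. c x * (2 * pi * \<i> * indicator (box (w + corner h 0) (w + corner h 2)) x))"
  proof (rule sum.cong[OF refl])
    fix \<zeta> assume "\<zeta> \<in> Z"
    have "winding_number ?g \<zeta> = indicator (box (w + corner h 0) (w + corner h 2)) \<zeta>"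
    proof (cases "\<zeta> \<in> box (w + corner h 0) (w + corner h 2)")
      case True then show ?thesis by (simp add: winding_number_rectpath)
    next
      case False
      then have "\<zeta> \<notin> cbox (w + corner h 0) (w + corner h 2)" using Z(2)[OF \<open>\<zeta> \<in> Z\<close>] unfolding path_image_square[OF h] by blast
      then show ?thesis using h False by (subst winding_number_rectpath_outside) (auto simp: corner_simps)
    qed
    then show "c \<zeta> * (2 * pi * \<i> * winding_number ?g \<zeta>) = c \<zeta> * (2 * pi * \<i> * indicator (box (w + corner h 0) (w + corner h 2)) \<zeta>)"
      by simp
  qed
  finally show ?thesis .
qed

lemma square_integral_holomorphic:
  assumes h: "h > 0" and f: "f holomorphic_on S" and S: "convex S" "cbox (w + corner h 0) (w + corner h 2) \<subseteq> S"
  shows "square_integral h (\<lambda>z. f (w + z)) = 0"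
proof -
  let ?g = "rectpath (w + corner h 0) (w + corner h 2)"
  have im: "path_image ?g \<subseteq> S" using S(2) unfolding path_image_square[OF h] by blast
  have "(f has_contour_integral 0) ?g"
    by (rule Cauchy_theorem_convex_simple[OF f S(1) valid_path_rectpath im]) simp
  moreover have "square_integral h (\<lambda>z. f (w + z)) = contour_integral ?g f"
    using im by (intro square_integral_eq_contour[OF h] continuous_on_subset[OF holomorphic_on_imp_continuous_on[OF f]])
  ultimately show ?thesis by (simp add: contour_integral_unique)
qed

lemma edge_norm: "0 \<le> x \<Longrightarrow> x \<le> 1 \<Longrightarrow> 0 \<le> h \<Longrightarrow> cmod (edge h k x) \<le> 2 * h"
proof -
  assume x: "0 \<le> x" "x \<le> 1" and h: "0 \<le> h"
  have c: "cmod (corner h j) \<le> 2 * h" for j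
    using h mult_left_mono[OF norm_triangle_ineq4[of "-1" \<i>] h] by (simp add: corner_def norm_mult norm_power mult.commute)
  have "edge h k x = (1 - x) *\<^sub>R corner h k + x *\<^sub>R corner h (Suc k)" by (simp add: edge_def linepath_def)
  then have "cmod (edge h k x) \<le> (1 - x) * cmod (corner h k) + x * cmod (corner h (Suc k))"
    using norm_triangle_ineq[of "(1 - x) *\<^sub>R corner h k" "x *\<^sub>R corner h (Suc k)"] x by simp
  also have "\<dots> \<le> (1 - x) * (2 * h) + x * (2 * h)" using c x by (intro add_mono mult_left_mono) auto
  finally show ?thesis by (simp add: algebra_simps)
qed

text \<open>The bound is uniform in the translation, so the integrand is absolutely integrable over
  the product of each edge with the plane.\<close>

lemma square_integral_fubini:
  fixes g S :: "complex \<Rightarrow> complex"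
  assumes [measurable]: "g \<in> borel_measurable borel" "S \<in> borel_measurable borel"
    and bound: "\<And>c. (\<integral>\<^sup>+w. ennreal (cmod (g w * S (w + c))) \<partial>lborel) \<le> ennreal C"
  shows "square_integral h (\<lambda>c. \<integral>w. g w * S (w + c) \<partial>lborel) = (\<integral>w. g w * square_integral h (\<lambda>c. S (w + c)) \<partial>lborel)"
proof -
  define f where "f k x w = indicator {0..1} x *\<^sub>R (g w * S (w + edge h k x))" for k :: nat and x :: real and w :: complex
  have meas [measurable]: "case_prod (f k) \<in> borel_measurable (lborel \<Otimes>\<^sub>M lborel)" for k
    unfolding f_def by measurable
  have int: "integrable (lborel \<Otimes>\<^sub>M lborel) (case_prod (f k))" for k
  proof (rule integrableI_bounded)
    have "(\<integral>\<^sup>+p. ennreal (norm (case p of (x, w) \<Rightarrow> f k x w)) \<partial>(lborel \<Otimes>\<^sub>M lborel)) =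
       (\<integral>\<^sup>+x. \<integral>\<^sup>+w. ennreal (norm (f k x w)) \<partial>lborel \<partial>lborel)"
      by (subst lborel.nn_integral_fst[symmetric]) auto
    also have "\<dots> \<le> (\<integral>\<^sup>+x. ennreal C * indicator {0..1} (x::real) \<partial>lborel)"
    proof (intro nn_integral_mono)
      fix x :: real
      show "(\<integral>\<^sup>+w. ennreal (norm (f k x w)) \<partial>lborel) \<le> ennreal C * indicator {0..1} x"
        using bound[of "edge h k x"] by (cases "x \<in> {0..1}") (auto simp: f_def)
    qed
    also have "\<dots> = ennreal C * emeasure lborel {0..1::real}" by (rule nn_integral_cmult_indicator) simp
    also have "\<dots> < \<infinity>" by simp
    finally show "(\<integral>\<^sup>+p. ennreal (norm (case p of (x, w) \<Rightarrow> f k x w)) \<partial>(lborel \<Otimes>\<^sub>M lborel)) < \<infinity>" .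
  qed measurable
  have swap: "(\<integral>x. indicator {0..1} x *\<^sub>R (\<integral>w. g w * S (w + edge h k x) \<partial>lborel) \<partial>lborel) =
     (\<integral>w. g w * (\<integral>x. indicator {0..1} x *\<^sub>R S (w + edge h k x) \<partial>lborel) \<partial>lborel)" for k
  proof -
    have "(\<integral>x. indicator {0..1} x *\<^sub>R (\<integral>w. g w * S (w + edge h k x) \<partial>lborel) \<partial>lborel) = (\<integral>x. \<integral>w. f k x w \<partial>lborel \<partial>lborel)"
      unfolding f_def by simp
    also have "\<dots> = (\<integral>w. \<integral>x. f k x w \<partial>lborel \<partial>lborel)"
      by (rule lborel_pair.Fubini_integral[OF int[of k], symmetric])
    also have "\<dots> = (\<integral>w. g w * (\<integral>x. indicator {0..1} x *\<^sub>R S (w + edge h k x) \<partial>lborel) \<partial>lborel)"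
    proof (rule Bochner_Integration.integral_cong[OF refl])
      fix w
      have "f k x w = g w * (indicator {0..1} x *\<^sub>R S (w + edge h k x))" for x by (simp add: f_def)
      then show "(\<integral>x. f k x w \<partial>lborel) = g w * (\<integral>x. indicator {0..1} x *\<^sub>R S (w + edge h k x) \<partial>lborel)"
        by (simp only: integral_mult_right_zero)
    qed
    finally show ?thesis .
  qed
  have int2: "integrable lborel (\<lambda>w. g w * (\<integral>x. indicator {0..1} x *\<^sub>R S (w + edge h k x) \<partial>lborel))" for k
  proof -
    have "integrable lborel (\<lambda>w. \<integral>x. f k x w \<partial>lborel)" by (rule lborel_pair.integrable_snd[OF int[of k]])
    moreover have "(\<integral>x. f k x w \<partial>lborel) = g w * (\<integral>x. indicator {0..1} x *\<^sub>R S (w + edge h k x) \<partial>lborel)" for w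
    proof -
      have "f k x w = g w * (indicator {0..1} x *\<^sub>R S (w + edge h k x))" for x by (simp add: f_def)
      then show ?thesis by (simp only: integral_mult_right_zero)
    qed
    ultimately show ?thesis by simp
  qed
  have "square_integral h (\<lambda>c. \<integral>w. g w * S (w + c) \<partial>lborel) =
     (\<Sum>k<4. (corner h (Suc k) - corner h k) * (\<integral>w. g w * (\<integral>x. indicator {0..1} x *\<^sub>R S (w + edge h k x) \<partial>lborel) \<partial>lborel))"
    unfolding square_integral_def swap ..
  also have "\<dots> = (\<integral>w. (\<Sum>k<4. (corner h (Suc k) - corner h k) * (g w * (\<integral>x. indicator {0..1} x *\<^sub>R S (w + edge h k x) \<partial>lborel))) \<partial>lborel)"
    using int2 by (subst Bochner_Integration.integral_sum) auto
  also have "\<dots> = (\<integral>w. g w * square_integral h (\<lambda>c. S (w + c)) \<partial>lborel)"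
    unfolding square_integral_def by (simp add: sum_distrib_left mult_ac)
  finally show ?thesis .
qed

lemma square_integral_measurable:
  assumes [measurable]: "f \<in> borel_measurable borel"
  shows "(\<lambda>z. square_integral h (\<lambda>c. f (z + c))) \<in> borel_measurable borel"
  unfolding square_integral_def
proof (intro borel_measurable_sum borel_measurable_times borel_measurable_const)
  fix k
  show "(\<lambda>z. \<integral>x. indicator {0..1} x *\<^sub>R f (z + edge h k x) \<partial>lborel) \<in> borel_measurable borel"
    by (rule lborel.borel_measurable_lebesgue_integral) measurable
qed

lemma square_measure:
  assumes "h > 0"
  shows "emeasure lborel {w. \<zeta> \<in> box (w + corner h 0) (w + corner h 2)} = ennreal (4 * h\<^sup>2)"
    "{w. \<zeta> \<in> box (w + corner h 0) (w + corner h 2)} = box (\<zeta> + corner h 0) (\<zeta> + corner h 2)"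
proof -
  show eq: "{w. \<zeta> \<in> box (w + corner h 0) (w + corner h 2)} = box (\<zeta> + corner h 0) (\<zeta> + corner h 2)"
    by (auto simp: in_box_complex_iff corner_simps)
  have "emeasure lborel (box (\<zeta> + corner h 0) (\<zeta> + corner h 2)) = ennreal (\<Prod>b\<in>Basis. ((\<zeta> + corner h 2) - (\<zeta> + corner h 0)) \<bullet> b)"
    using assms by (intro emeasure_lborel_box) (auto simp: Basis_complex_def corner_simps)
  also have "(\<Prod>b\<in>Basis. ((\<zeta> + corner h 2) - (\<zeta> + corner h 0)) \<bullet> b) = 4 * h\<^sup>2"
    by (simp add: Basis_complex_def corner_simps power2_eq_square)
  finally show "emeasure lborel {w. \<zeta> \<in> box (w + corner h 0) (w + corner h 2)} = ennreal (4 * h\<^sup>2)"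
    unfolding eq .
qed

text \<open>The square centred at w contains \<zeta> exactly when the square centred at \<zeta>
  contains w. So the integral runs over the latter square, of area 4 h^2, where g deviates from its
  value at \<zeta> by at most e.\<close>

lemma square_average:
  fixes g :: "complex \<Rightarrow> complex"
  assumes h: "h > 0" and [measurable]: "g \<in> borel_measurable borel"
    and g: "\<And>w. w \<in> box (\<zeta> + corner h 0) (\<zeta> + corner h 2) \<Longrightarrow> cmod (g w - g \<zeta>) \<le> e"
  shows "cmod ((\<integral>w. g w * indicator (box (w + corner h 0) (w + corner h 2)) \<zeta> \<partial>lborel) - of_real (4 * h\<^sup>2) * g \<zeta>) \<le> 4 * h\<^sup>2 * e"
proof -
  define B where "B = box (\<zeta> + corner h 0) (\<zeta> + corner h 2)"
  have B [measurable]: "B \<in> sets lborel" by (simp add: B_def)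
  have ind: "indicator (box (w + corner h 0) (w + corner h 2)) \<zeta> = (indicator B w :: complex)" for w
    using square_measure(2)[OF h, of \<zeta>] by (auto simp: B_def indicator_def)
  have em: "emeasure lborel B = ennreal (4 * h\<^sup>2)" using square_measure[OF h, of \<zeta>] by (simp add: B_def)
  then have m: "measure lborel B = 4 * h\<^sup>2" by (simp add: measure_def)
  have ic: "integrable lborel (\<lambda>w. indicator B w *\<^sub>R c)" for c :: complex
    using em B by (intro integrable_scaleR_left) (auto simp: integrable_indicator_iff)
  have id: "integrable lborel (\<lambda>w. indicator B w *\<^sub>R (g w - g \<zeta>))"
  proof (rule Bochner_Integration.integrable_bound)
    show "integrable lborel (\<lambda>w. indicator B w * e)" using em B by (auto simp: integrable_indicator_iff)
    show "AE w in lborel. norm (indicator B w *\<^sub>R (g w - g \<zeta>)) \<le> norm (indicator B w * e)"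
      using g by (intro AE_I2) (auto simp: indicator_def B_def intro: order_trans[OF _ abs_ge_self])
  qed measurable
  have "(\<integral>w. g w * indicator (box (w + corner h 0) (w + corner h 2)) \<zeta> \<partial>lborel) = (\<integral>w. indicator B w *\<^sub>R (g w - g \<zeta>) + indicator B w *\<^sub>R g \<zeta> \<partial>lborel)"
    unfolding ind by (intro Bochner_Integration.integral_cong refl) (auto simp: indicator_def)
  also have "\<dots> = (\<integral>w. indicator B w *\<^sub>R (g w - g \<zeta>) \<partial>lborel) + (\<integral>w. indicator B w *\<^sub>R g \<zeta> \<partial>lborel)"
    by (rule Bochner_Integration.integral_add[OF id ic])
  also have "(\<integral>w. indicator B w *\<^sub>R g \<zeta> \<partial>lborel) = of_real (4 * h\<^sup>2) * g \<zeta>"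
    using em by (simp add: m scaleR_conv_of_real)
  finally have "cmod ((\<integral>w. g w * indicator (box (w + corner h 0) (w + corner h 2)) \<zeta> \<partial>lborel) - of_real (4 * h\<^sup>2) * g \<zeta>) = cmod (\<integral>w. indicator B w *\<^sub>R (g w - g \<zeta>) \<partial>lborel)"
    by simp
  also have "\<dots> \<le> (\<integral>w. cmod (indicator B w *\<^sub>R (g w - g \<zeta>)) \<partial>lborel)" by (rule integral_norm_bound)
  also have "\<dots> \<le> (\<integral>w. indicator B w * e \<partial>lborel)"
  proof (rule integral_mono)
    show "integrable lborel (\<lambda>w. cmod (indicator B w *\<^sub>R (g w - g \<zeta>)))" by (rule integrable_norm[OF id])
    show "integrable lborel (\<lambda>w. indicator B w * e)" using em B by (auto simp: integrable_indicator_iff)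
    show "cmod (indicator B w *\<^sub>R (g w - g \<zeta>)) \<le> indicator B w * e" for w using g by (auto simp: indicator_def B_def)
  qed
  also have "\<dots> = 4 * h\<^sup>2 * e" using em by (simp add: m)
  finally show ?thesis .
qed

lemma square_indicator:
  "h > 0 \<Longrightarrow> indicator (box (z + corner h 0) (z + corner h 2)) x = (indicator (box (x + corner h 0) (x + corner h 2)) z :: complex)"
  using square_measure(2)[of h x] by (auto simp: indicator_def)

lemma square_boundary:
  "h > 0 \<Longrightarrow> x \<in> path_image (rectpath (z + corner h 0) (z + corner h 2)) \<longleftrightarrow>
    z \<in> cbox (x + corner h 0) (x + corner h 2) - box (x + corner h 0) (x + corner h 2)"
  by (simp add: path_image_square) (auto simp: in_box_complex_iff in_cbox_complex_iff corner_simps)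

section \<open>Almost everywhere limits of Cauchy transforms\<close>

locale cauchy_transforms =
  fixes Z :: "nat \<Rightarrow> complex set" and w :: "nat \<Rightarrow> complex \<Rightarrow> real" and R :: real
    and G :: "complex set"
  assumes finite_Z: "finite (Z n)" and w_nonneg: "x \<in> Z n \<Longrightarrow> 0 \<le> w n x" and w_sum: "(\<Sum>x\<in>Z n. w n x) = 1"
    and Z_bounded: "x \<in> Z n \<Longrightarrow> cmod x \<le> R"
    and negl: "negligible (- G)"
    and local_limit: "z0 \<in> G \<Longrightarrow> \<exists>\<epsilon>>0. \<exists>M. M holomorphic_on ball z0 \<epsilon> \<and> (\<forall>z\<in>ball z0 \<epsilon>. (\<lambda>n. \<Sum>x\<in>Z n. of_real (w n x) / (z - x)) \<longlonglongrightarrow> M z)"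
begin

definition S :: "nat \<Rightarrow> complex \<Rightarrow> complex" where
  "S n z = (\<Sum>x\<in>Z n. of_real (w n x) / (z - x))"

text \<open>Where the sequence diverges, which can happen only off \<open>G\<close>, this is
  whatever value \<open>lim\<close> returns; the function is Borel measurable all the same.\<close>

definition m :: "complex \<Rightarrow> complex" where
  "m z = lim (\<lambda>n. S n z)"

lemma S_measurable [measurable]: "S n \<in> borel_measurable borel"
  unfolding S_def[abs_def] by measurable

lemma m_measurable [measurable]: "m \<in> borel_measurable borel"
  unfolding m_def[abs_def] by (rule borel_measurable_lim_metric) measurable

lemma S_tendsto: "z \<in> G \<Longrightarrow> (\<lambda>n. S n z) \<longlonglongrightarrow> m z"
proof -
  assume "z \<in> G"
  then obtain \<epsilon> M where e: "\<epsilon> > 0" "\<forall>z'\<in>ball z \<epsilon>. (\<lambda>n. \<Sum>x\<in>Z n. of_real (w n x) / (z' - x)) \<longlonglongrightarrow> M z'"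
    using local_limit by blast
  then have "(\<lambda>n. \<Sum>x\<in>Z n. of_real (w n x) / (z - x)) \<longlonglongrightarrow> M z" by simp
  then have "(\<lambda>n. S n z) \<longlonglongrightarrow> M z" by (simp add: S_def)
  then show ?thesis unfolding m_def by (metis limI)
qed

lemma tail_exists:
  assumes "e > 0"
  shows "\<exists>K\<ge>0. \<forall>n c. (\<integral>\<^sup>+z. ennreal (max 0 (cmod (S n (z + c)) - K)) \<partial>lborel) \<le> ennreal e"
proof -
  have "(\<lambda>k. 4 * pi * (1/2) ^ k :: real) \<longlonglongrightarrow> 0"
    by (intro tendsto_mult_right_zero LIMSEQ_power_zero) auto
  then have "\<forall>\<^sub>F k in sequentially. 4 * pi * (1/2) ^ k < e" using assms by (rule order_tendstoD(2))
  then obtain k where k: "4 * pi * (1/2) ^ k < e" by (auto simp: eventually_sequentially)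
  show ?thesis
  proof (intro exI[of _ "2 ^ k"] conjI allI)
    fix n c
    show "(\<integral>\<^sup>+z. ennreal (max 0 (cmod (S n (z + c)) - 2 ^ k)) \<partial>lborel) \<le> ennreal e"
    proof -
      have "(\<integral>\<^sup>+z. ennreal (max 0 (cmod (S n (z + c)) - 2 ^ k)) \<partial>lborel) \<le> ennreal (4 * pi * (1/2) ^ k)"
        unfolding S_def by (rule cauchy_transform_tail) (use finite_Z w_nonneg w_sum in auto)
      also have "\<dots> \<le> ennreal e" using k by (intro ennreal_leI) simp
      finally show ?thesis .
    qed
  qed simp
qed

context
  fixes g :: "complex \<Rightarrow> complex" and B :: real
  assumes g_meas [measurable]: "g \<in> borel_measurable borel" and g_le: "\<And>x. cmod (g x) \<le> 1"
    and g_supp: "\<And>x. cmod x > B \<Longrightarrow> g x = 0"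
begin

text \<open>The normalisation of g by modulus 1 lets the tail bounds of \<open>S\<close> pass to the
  product unchanged.\<close>

lemma gS_tail:
  assumes K: "K \<ge> 0" "(\<integral>\<^sup>+z. ennreal (max 0 (cmod (S n (z + c)) - K)) \<partial>lborel) \<le> ennreal e"
  shows "(\<integral>\<^sup>+z. ennreal (max 0 (cmod (g z * S n (z + c)) - K)) \<partial>lborel) \<le> ennreal e"
proof -
  have "(\<integral>\<^sup>+z. ennreal (max 0 (cmod (g z * S n (z + c)) - K)) \<partial>lborel) \<le> (\<integral>\<^sup>+z. ennreal (max 0 (cmod (S n (z + c)) - K)) \<partial>lborel)"
  proof (intro nn_integral_mono ennreal_leI)
    fix z
    have "cmod (g z * S n (z + c)) \<le> 1 * cmod (S n (z + c))" unfolding norm_mult using g_le by (intro mult_right_mono) auto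
    then show "max 0 (cmod (g z * S n (z + c)) - K) \<le> max 0 (cmod (S n (z + c)) - K)" by auto
  qed
  then show ?thesis using K by simp
qed

text \<open>The transforms converge only almost everywhere; their uniform tails take the place of an
  integrable majorant.\<close>

lemma gS_limit:
  "integrable lborel (\<lambda>z. g z * m (z + c))"
  "(\<lambda>n. \<integral>z. g z * S n (z + c) \<partial>lborel) \<longlonglongrightarrow> (\<integral>z. g z * m (z + c) \<partial>lborel)"
proof -
  have lim: "AE z in lborel. (\<lambda>n. g z * S n (z + c)) \<longlonglongrightarrow> g z * m (z + c)"
    using AE_lborel_of_negligible[OF negl, of c]
    by eventually_elim (auto intro!: tendsto_mult S_tendsto)
  have tail: "\<exists>K\<ge>0. \<forall>n. (\<integral>\<^sup>+z. ennreal (max 0 (cmod (g z * S n (z + c)) - K)) \<partial>lborel) \<le> ennreal e" if "e > 0" for e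
    using tail_exists[OF that] gS_tail by blast
  have supp: "g x * f x = 0" if "x \<notin> cball 0 B" for x and f :: "complex \<Rightarrow> complex"
    using g_supp[of x] that by simp
  have fin: "emeasure lborel (cball (0::complex) B) < \<infinity>" by (intro emeasure_bounded_finite) simp
  note ui = integral_tendsto_uniformly_integrable[where A = "cball 0 B" and M = lborel and f = "\<lambda>n z. g z * S n (z + c)"
      and ?f0.0 = "\<lambda>z. g z * m (z + c)"]
  show "integrable lborel (\<lambda>z. g z * m (z + c))"
    by (rule ui(2)) (use lim tail supp fin in \<open>simp_all\<close>)
  show "(\<lambda>n. \<integral>z. g z * S n (z + c) \<partial>lborel) \<longlonglongrightarrow> (\<integral>z. g z * m (z + c) \<partial>lborel)"
    by (rule ui(3)) (use lim tail supp fin in \<open>simp_all\<close>)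
qed

lemma gS_bounded: "\<exists>C\<ge>0. \<forall>n c. (\<integral>\<^sup>+z. ennreal (cmod (g z * S n (z + c))) \<partial>lborel) \<le> ennreal C"
proof -
  obtain K where K: "K \<ge> 0" "\<forall>n c. (\<integral>\<^sup>+z. ennreal (max 0 (cmod (S n (z + c)) - K)) \<partial>lborel) \<le> ennreal 1"
    using tail_exists[of 1] by auto
  define v where "v = measure lborel (cball (0::complex) B)"
  have v: "emeasure lborel (cball (0::complex) B) = ennreal v"
    unfolding v_def by (intro emeasure_eq_ennreal_measure) (use emeasure_bounded_finite[of "cball (0::complex) B"] in auto)
  have "(\<integral>\<^sup>+z. ennreal (cmod (g z * S n (z + c))) \<partial>lborel) \<le> ennreal (K * v + 1)" for n c
  proof -
    have "(\<integral>\<^sup>+z. ennreal (cmod (g z * S n (z + c))) \<partial>lborel) \<le> (\<integral>\<^sup>+z. ennreal K * indicator (cball 0 B) z + ennreal (max 0 (cmod (g z * S n (z + c)) - K)) \<partial>lborel)"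
    proof (intro nn_integral_mono)
      fix z
      show "ennreal (cmod (g z * S n (z + c))) \<le> ennreal K * indicator (cball 0 B) z + ennreal (max 0 (cmod (g z * S n (z + c)) - K))"
      proof (cases "z \<in> cball 0 B")
        case True
        have "ennreal (cmod (g z * S n (z + c))) \<le> ennreal (K + max 0 (cmod (g z * S n (z + c)) - K))" by (intro ennreal_leI) auto
        then show ?thesis using True K(1) by (simp add: ennreal_plus)
      qed (use g_supp in simp)
    qed
    also have "\<dots> = ennreal K * ennreal v + (\<integral>\<^sup>+z. ennreal (max 0 (cmod (g z * S n (z + c)) - K)) \<partial>lborel)"
      by (subst nn_integral_add) (auto simp: nn_integral_cmult_indicator v borel_measurable_indicator borel_measurable_times_ennreal)
    also have "\<dots> \<le> ennreal K * ennreal v + ennreal 1"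
      using gS_tail[OF K(1)] K(2) by (intro add_left_mono) blast
    also have "\<dots> = ennreal (K * v + 1)"
      using K(1) by (simp add: ennreal_mult ennreal_plus v_def)
    finally show ?thesis .
  qed
  moreover have "K * v + 1 \<ge> 0" using K(1) by (simp add: v_def)
  ultimately show ?thesis by blast
qed

text \<open>Averaging over the centres z of the squares, with weight g, makes the contour integrals
  insensitive to null sets. For fixed n, Fubini and the residue theorem evaluate the average. As n
  grows, \<open>gS_limit\<close> is integrated over the edges, with the uniform constant of
  \<open>gS_bounded\<close> as majorant.\<close>

lemma square_integral_limit:
  assumes h: "h > 0"
  shows "(\<lambda>n. \<Sum>x\<in>Z n. of_real (w n x) * (2 * pi * \<i> * (\<integral>z. g z * indicator (box (z + corner h 0) (z + corner h 2)) x \<partial>lborel)))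
     \<longlonglongrightarrow> square_integral h (\<lambda>c. \<integral>z. g z * m (z + c) \<partial>lborel)"
proof -
  obtain C where C: "C \<ge> 0" "\<forall>n c. (\<integral>\<^sup>+z. ennreal (cmod (g z * S n (z + c))) \<partial>lborel) \<le> ennreal C"
    using gS_bounded by blast
  have T_bd: "cmod (\<integral>z. g z * S n (z + c) \<partial>lborel) \<le> C" for n c
  proof -
    have "ennreal (cmod (\<integral>z. g z * S n (z + c) \<partial>lborel)) \<le> (\<integral>\<^sup>+z. ennreal (cmod (g z * S n (z + c))) \<partial>lborel)"
      by (rule integral_norm_bound_ennreal) (rule integrableI_bounded, measurable, use C in \<open>metis ennreal_less_top le_less_trans infinity_ennreal_def\<close>)
    also have "\<dots> \<le> ennreal C" using C by blast
    finally show ?thesis using C(1) by simp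
  qed
  have meas: "(\<lambda>x. \<integral>z. g z * f (z + edge h k x) \<partial>lborel) \<in> borel_measurable lborel" if [measurable]: "f \<in> borel_measurable borel" for f :: "complex \<Rightarrow> complex" and k
    by measurable
  have "(\<lambda>n. square_integral h (\<lambda>c. \<integral>z. g z * S n (z + c) \<partial>lborel)) \<longlonglongrightarrow> square_integral h (\<lambda>c. \<integral>z. g z * m (z + c) \<partial>lborel)"
    unfolding square_integral_def
  proof (intro tendsto_sum tendsto_mult tendsto_const)
    fix k
    show "(\<lambda>n. \<integral>x. indicator {0..1} x *\<^sub>R (\<integral>z. g z * S n (z + edge h k x) \<partial>lborel) \<partial>lborel)
       \<longlonglongrightarrow> (\<integral>x. indicator {0..1} x *\<^sub>R (\<integral>z. g z * m (z + edge h k x) \<partial>lborel) \<partial>lborel)"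
    proof (rule integral_dominated_convergence[where w = "\<lambda>x. indicator {0..1} x * C"])
      show "(\<lambda>x. indicator {0..1} x *\<^sub>R (\<integral>z. g z * m (z + edge h k x) \<partial>lborel)) \<in> borel_measurable lborel"
        by (intro borel_measurable_scaleR meas) auto
      show "(\<lambda>x. indicator {0..1} x *\<^sub>R (\<integral>z. g z * S n (z + edge h k x) \<partial>lborel)) \<in> borel_measurable lborel" for n
        by (intro borel_measurable_scaleR meas) auto
      show "AE x in lborel. (\<lambda>n. indicator {0..1} x *\<^sub>R (\<integral>z. g z * S n (z + edge h k x) \<partial>lborel)) \<longlonglongrightarrow> indicator {0..1} x *\<^sub>R (\<integral>z. g z * m (z + edge h k x) \<partial>lborel)"
        by (intro AE_I2 tendsto_scaleR tendsto_const gS_limit)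
      show "AE x in lborel. norm (indicator {0..1} x *\<^sub>R (\<integral>z. g z * S n (z + edge h k x) \<partial>lborel)) \<le> indicator {0..1} x * C" for n
        using T_bd by (intro AE_I2) (auto simp: indicator_def)
    qed auto
  qed
  moreover have "square_integral h (\<lambda>c. \<integral>z. g z * S n (z + c) \<partial>lborel) =
     (\<Sum>x\<in>Z n. of_real (w n x) * (2 * pi * \<i> * (\<integral>z. g z * indicator (box (z + corner h 0) (z + corner h 2)) x \<partial>lborel)))" for n
  proof -
    have "square_integral h (\<lambda>c. \<integral>z. g z * S n (z + c) \<partial>lborel) = (\<integral>z. g z * square_integral h (\<lambda>c. S n (z + c)) \<partial>lborel)"
      using C by (intro square_integral_fubini[where C = C]) auto
    also have "\<dots> = (\<integral>z. (\<Sum>x\<in>Z n. of_real (w n x) * (2 * pi * \<i> * (g z * indicator (box (x + corner h 0) (x + corner h 2)) z))) \<partial>lborel)"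
    proof (rule integral_cong_AE)
      show "(\<lambda>z. g z * square_integral h (\<lambda>c. S n (z + c))) \<in> borel_measurable lborel"
        by (simp add: borel_measurable_times square_integral_measurable)
      \<comment> \<open>These are the centres whose square has a point of \<open>Z n\<close> on its
        boundary, where residues cannot be counted.\<close>
      have "negligible (\<Union>x\<in>Z n. cbox (x + corner h 0) (x + corner h 2) - box (x + corner h 0) (x + corner h 2))"
        using finite_Z by (intro negligible_Union) (auto intro: negligible_frontier_interval)
      from AE_lborel_of_negligible[OF this, of 0]
      show "AE z in lborel. g z * square_integral h (\<lambda>c. S n (z + c)) = (\<Sum>x\<in>Z n. of_real (w n x) * (2 * pi * \<i> * (g z * indicator (box (x + corner h 0) (x + corner h 2)) z)))"
      proof eventually_elim
        case (elim z)
        then have "square_integral h (\<lambda>c. S n (z + c)) = (\<Sum>x\<in>Z n. of_real (w n x) * (2 * pi * \<i> * indicator (box (z + corner h 0) (z + corner h 2)) x))"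
          unfolding S_def by (intro square_integral_cauchy_kernels h finite_Z) (simp add: square_boundary[OF h])
        then have "g z * square_integral h (\<lambda>c. S n (z + c)) = (\<Sum>x\<in>Z n. g z * (of_real (w n x) * (2 * pi * \<i> * indicator (box (z + corner h 0) (z + corner h 2)) x)))"
          by (simp only: sum_distrib_left)
        also have "\<dots> = (\<Sum>x\<in>Z n. of_real (w n x) * (2 * pi * \<i> * (g z * indicator (box (x + corner h 0) (x + corner h 2)) z)))"
          by (intro sum.cong refl, subst square_indicator[OF h]) (simp only: mult_ac)
        finally show ?case .
      qed
    qed (simp add: borel_measurable_sum borel_measurable_times borel_measurable_indicator)
    also have "\<dots> = (\<Sum>x\<in>Z n. of_real (w n x) * (2 * pi * \<i> * (\<integral>z. g z * indicator (box (x + corner h 0) (x + corner h 2)) z \<partial>lborel)))"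
    proof -
      have "integrable lborel (\<lambda>z. g z * indicator (box (x + corner h 0) (x + corner h 2)) z)" for x
      proof (rule Bochner_Integration.integrable_bound)
        show "integrable lborel (indicator (box (x + corner h 0) (x + corner h 2)) :: complex \<Rightarrow> real)"
          using square_measure[OF h, of x] by (auto simp: integrable_indicator_iff)
        show "AE z in lborel. norm (g z * indicator (box (x + corner h 0) (x + corner h 2)) z) \<le> norm (indicator (box (x + corner h 0) (x + corner h 2)) z :: real)"
          using g_le by (intro AE_I2) (auto simp: indicator_def)
      qed measurable
      then show ?thesis by (subst Bochner_Integration.integral_sum) auto
    qed
    also have "\<dots> = (\<Sum>x\<in>Z n. of_real (w n x) * (2 * pi * \<i> * (\<integral>z. g z * indicator (box (z + corner h 0) (z + corner h 2)) x \<partial>lborel)))"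
    proof (rule sum.cong[OF refl])
      fix x
      have "(\<lambda>z. g z * indicator (box (z + corner h 0) (z + corner h 2)) x) = (\<lambda>z. g z * indicator (box (x + corner h 0) (x + corner h 2)) z)"
        by (rule ext, subst square_indicator[OF h]) (rule refl)
      then show "of_real (w n x) * (2 * pi * \<i> * (\<integral>z. g z * indicator (box (x + corner h 0) (x + corner h 2)) z \<partial>lborel)) =
          of_real (w n x) * (2 * pi * \<i> * (\<integral>z. g z * indicator (box (z + corner h 0) (z + corner h 2)) x \<partial>lborel))"
        by (simp only:)
    qed
    finally show ?thesis .
  qed
  ultimately show ?thesis by (simp only:)
qed

text \<open>Divided by 2 pi i times the area 4 h^2, the averaged contour integral replaces g by its
  mean over a small square, which differs from g by at most its oscillation there.\<close>

lemma integral_approx: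
  assumes h: "h > 0"
    and osc: "\<And>x z. cmod x \<le> R \<Longrightarrow> z \<in> box (x + corner h 0) (x + corner h 2) \<Longrightarrow> cmod (g z - g x) \<le> e"
  shows "cmod ((\<Sum>x\<in>Z n. of_real (w n x) * g x) - (\<Sum>x\<in>Z n. of_real (w n x) * (2 * pi * \<i> * (\<integral>z. g z * indicator (box (z + corner h 0) (z + corner h 2)) x \<partial>lborel)))
      / (2 * pi * \<i> * of_real (4 * h\<^sup>2))) \<le> e"
proof -
  define A where "A x = (\<integral>z. g z * indicator (box (z + corner h 0) (z + corner h 2)) x \<partial>lborel)" for x
  have A: "cmod (g x - A x / of_real (4 * h\<^sup>2)) \<le> e" if "x \<in> Z n" for x
  proof -
    have "cmod (A x - of_real (4 * h\<^sup>2) * g x) \<le> 4 * h\<^sup>2 * e"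
      unfolding A_def by (rule square_average[OF h g_meas osc[OF Z_bounded[OF that]]])
    moreover have "g x - A x / of_real (4 * h\<^sup>2) = - (A x - of_real (4 * h\<^sup>2) * g x) / of_real (4 * h\<^sup>2)"
      using h by (simp add: field_simps)
    then have "cmod (g x - A x / of_real (4 * h\<^sup>2)) = cmod (A x - of_real (4 * h\<^sup>2) * g x) / (4 * h\<^sup>2)"
      using h by (simp add: norm_divide norm_mult norm_power norm_minus_commute)
    ultimately show ?thesis using h by (simp add: pos_divide_le_eq mult.commute)
  qed
  have "(\<Sum>x\<in>Z n. of_real (w n x) * (2 * pi * \<i> * A x)) / (2 * pi * \<i> * of_real (4 * h\<^sup>2)) = (\<Sum>x\<in>Z n. of_real (w n x) * (A x / of_real (4 * h\<^sup>2)))"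
    using h by (simp add: sum_divide_distrib mult_ac)
  then have "(\<Sum>x\<in>Z n. of_real (w n x) * g x) - (\<Sum>x\<in>Z n. of_real (w n x) * (2 * pi * \<i> * A x)) / (2 * pi * \<i> * of_real (4 * h\<^sup>2))
     = (\<Sum>x\<in>Z n. of_real (w n x) * (g x - A x / of_real (4 * h\<^sup>2)))"
    by (simp add: right_diff_distrib sum_subtractf)
  also have "cmod \<dots> \<le> (\<Sum>x\<in>Z n. w n x * e)"
    using A w_nonneg by (intro order.trans[OF norm_sum] sum_mono) (auto simp: norm_mult intro!: mult_left_mono)
  also have "\<dots> = e" using w_sum[of n] by (simp flip: sum_distrib_right)
  finally show ?thesis by (simp add: A_def)
qed

text \<open>The support of g keeps a margin \<epsilon>/2 inside the ball where the limit is
  holomorphic. Squares of half-side below \<epsilon>/8 centred in the support remain in the ball,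
  and Cauchy's theorem makes each contour integral vanish.\<close>

lemma square_integral_limit_zero:
  assumes M: "M holomorphic_on ball z0 \<epsilon>" "\<And>z. z \<in> ball z0 \<epsilon> \<Longrightarrow> m z = M z"
    and supp: "\<And>z. z \<notin> ball z0 (\<epsilon> / 2) \<Longrightarrow> g z = 0" and h: "h > 0" "8 * h < \<epsilon>"
  shows "square_integral h (\<lambda>c. \<integral>z. g z * m (z + c) \<partial>lborel) = 0"
proof -
  have cong: "square_integral h f = square_integral h f'" if "\<And>c. cmod c \<le> 2 * h \<Longrightarrow> f c = f' c" for f f'
    unfolding square_integral_def
  proof (intro sum.cong refl arg_cong2[where f = "(*)"] Bochner_Integration.integral_cong)
    fix k x show "indicator {0..1} x *\<^sub>R f (edge h k x) = indicator {0..1} x *\<^sub>R f' (edge h k x)"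
      using that[of "edge h k x"] edge_norm[of x h k] h by (cases "x \<in> {0..1}") auto
  qed
  \<comment> \<open>Fubini requires a measurable function with an integrability bound on the whole
    plane, so \<open>M\<close> is cut off at radius 3 \<epsilon> / 4. This disc contains every z + c
    with z in the support of g and |c| <= 2 h < \<epsilon>/4.\<close>
  define M1 where "M1 z = indicator (cball z0 (3 * \<epsilon> / 4)) z *\<^sub>R M z" for z
  have sub: "cball z0 (3 * \<epsilon> / 4) \<subseteq> ball z0 \<epsilon>" using h by (auto simp: subset_eq)
  have cont: "continuous_on (cball z0 (3 * \<epsilon> / 4)) M"
    using holomorphic_on_imp_continuous_on[OF M(1)] sub by (rule continuous_on_subset)
  have M1_meas [measurable]: "M1 \<in> borel_measurable borel"
    unfolding M1_def[abs_def] using cont by (intro borel_measurable_continuous_on_indicator) auto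
  have "compact (M ` cball z0 (3 * \<epsilon> / 4))" by (intro compact_continuous_image cont) simp
  then obtain K where K: "\<And>z. z \<in> cball z0 (3 * \<epsilon> / 4) \<Longrightarrow> cmod (M z) \<le> K" "K > 0"
    using compact_imp_bounded bounded_pos by (metis imageI)
  have M1_le: "cmod (M1 z) \<le> K" for z using K by (cases "z \<in> cball z0 (3 * \<epsilon> / 4)") (auto simp: M1_def)
  have near: "z + c \<in> cball z0 (3 * \<epsilon> / 4)" if "z \<in> ball z0 (\<epsilon> / 2)" "cmod c \<le> 2 * h" for z c
  proof -
    have "dist z0 (z + c) \<le> dist z0 z + dist z (z + c)" by (rule dist_triangle)
    also have "dist z (z + c) = cmod c" by (simp add: dist_norm)
    finally show ?thesis using that h by simp
  qed
  have "square_integral h (\<lambda>c. \<integral>z. g z * m (z + c) \<partial>lborel) = square_integral h (\<lambda>c. \<integral>z. g z * M1 (z + c) \<partial>lborel)"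
  proof (intro cong Bochner_Integration.integral_cong refl)
    fix c z assume c: "cmod c \<le> 2 * h"
    show "g z * m (z + c) = g z * M1 (z + c)"
    proof (cases "z \<in> ball z0 (\<epsilon> / 2)")
      case True
      then show ?thesis using near[OF True c] sub M(2)[of "z + c"] by (auto simp: M1_def)
    qed (use supp in simp)
  qed
  also have "\<dots> = (\<integral>z. g z * square_integral h (\<lambda>c. M1 (z + c)) \<partial>lborel)"
  proof (rule square_integral_fubini)
    define v where "v = measure lborel (cball (0::complex) B)"
    have v: "emeasure lborel (cball (0::complex) B) = ennreal v"
      unfolding v_def by (intro emeasure_eq_ennreal_measure) (use emeasure_bounded_finite[of "cball (0::complex) B"] in auto)
    fix c
    have "(\<integral>\<^sup>+z. ennreal (cmod (g z * M1 (z + c))) \<partial>lborel) \<le> (\<integral>\<^sup>+z. ennreal K * indicator (cball 0 B) (z::complex) \<partial>lborel)"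
    proof (intro nn_integral_mono)
      fix z
      show "ennreal (cmod (g z * M1 (z + c))) \<le> ennreal K * indicator (cball 0 B) z"
      proof (cases "z \<in> cball 0 B")
        case True
        have "cmod (g z * M1 (z + c)) \<le> 1 * K" unfolding norm_mult using g_le M1_le by (intro mult_mono) auto
        then show ?thesis using True by (simp add: ennreal_leI)
      qed (use g_supp in simp)
    qed
    also have "\<dots> = ennreal K * ennreal v" using v by (subst nn_integral_cmult_indicator) auto
    also have "\<dots> = ennreal (K * v)" using K(2) by (simp add: ennreal_mult v_def)
    finally show "(\<integral>\<^sup>+z. ennreal (cmod (g z * M1 (z + c))) \<partial>lborel) \<le> ennreal (K * v)" .
  qed auto
  also have "\<dots> = (\<integral>z. 0 \<partial>(lborel :: complex measure))"
  proof (intro Bochner_Integration.integral_cong refl)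
    fix z
    show "g z * square_integral h (\<lambda>c. M1 (z + c)) = 0"
    proof (cases "z \<in> ball z0 (\<epsilon> / 2)")
      case True
      have "square_integral h (\<lambda>c. M1 (z + c)) = square_integral h (\<lambda>c. M (z + c))"
        using near[OF True] by (intro cong) (simp add: M1_def)
      also have "\<dots> = 0"
      proof (rule square_integral_holomorphic[OF h(1) M(1)])
        show "cbox (z + corner h 0) (z + corner h 2) \<subseteq> ball z0 \<epsilon>"
        proof
          fix u assume u: "u \<in> cbox (z + corner h 0) (z + corner h 2)"
          have "cmod (u - z) \<le> \<bar>Re (u - z)\<bar> + \<bar>Im (u - z)\<bar>" by (rule cmod_le)
          also have "\<dots> \<le> h + h" using u by (intro add_mono) (auto simp: in_cbox_complex_iff corner_simps abs_le_iff)
          finally have "z + (u - z) \<in> cball z0 (3 * \<epsilon> / 4)" using near[OF True, of "u - z"] by simp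
          then show "u \<in> ball z0 \<epsilon>" using sub by auto
        qed
      qed simp
      finally show ?thesis by simp
    qed (use supp in simp)
  qed
  finally show ?thesis by simp
qed

end

lemma convergent_of_approx:
  fixes a :: "nat \<Rightarrow> complex"
  assumes "\<And>e. e > 0 \<Longrightarrow> \<exists>L. \<forall>\<^sub>F n in sequentially. cmod (a n - L) \<le> e"
  shows "convergent a"
proof (rule Cauchy_convergent, rule metric_CauchyI)
  fix e :: real assume e: "e > 0"
  obtain L where "\<forall>\<^sub>F n in sequentially. cmod (a n - L) \<le> e / 3" using assms[of "e/3"] e by auto
  then obtain N where N: "\<And>n. n \<ge> N \<Longrightarrow> cmod (a n - L) \<le> e / 3" by (auto simp: eventually_sequentially)
  show "\<exists>N. \<forall>m\<ge>N. \<forall>n\<ge>N. dist (a m) (a n) < e"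
  proof (intro exI allI impI)
    fix m n assume "m \<ge> N" "n \<ge> N"
    then have "cmod (a m - L) \<le> e / 3" "cmod (a n - L) \<le> e / 3" using N by auto
    then show "dist (a m) (a n) < e" using e norm_triangle_ineq4[of "a m - L" "a n - L"] by (simp add: dist_norm)
  qed
qed

text \<open>The jump at radius \<open>R + 2\<close> does no harm: squares of half-side below 1
  around points of modulus at most \<open>R\<close> do not reach it.\<close>

definition cutoff :: "(complex \<Rightarrow> real) \<Rightarrow> complex \<Rightarrow> complex" where
  "cutoff f z = indicator (cball 0 (R + 2)) z *\<^sub>R complex_of_real (f z)"

lemma cutoff_props:
  assumes f: "continuous_on UNIV f"
  shows "\<exists>K>0. (\<lambda>z. cutoff f z / of_real K) \<in> borel_measurable borel \<and> (\<forall>z. cmod (cutoff f z / of_real K) \<le> 1) \<and>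
     (\<forall>z. cmod z > R + 2 \<longrightarrow> cutoff f z / of_real K = 0) \<and>
     (\<forall>e>0. \<exists>\<delta>>0. \<forall>h. 0 < h \<longrightarrow> h < \<delta> \<longrightarrow> (\<forall>x z. cmod x \<le> R \<longrightarrow> z \<in> box (x + corner h 0) (x + corner h 2) \<longrightarrow>
        cmod (cutoff f z / of_real K - cutoff f x / of_real K) \<le> e))"
proof -
  let ?D = "cball (0::complex) (R + 2)"
  have c: "continuous_on ?D f" using f by (rule continuous_on_subset) simp
  have "compact (f ` ?D)" by (intro compact_continuous_image c) simp
  then obtain K where K: "K > 0" "\<And>z. z \<in> ?D \<Longrightarrow> \<bar>f z\<bar> \<le> K"
    using compact_imp_bounded bounded_pos by (metis imageI real_norm_def)
  have meas: "(\<lambda>z. cutoff f z / of_real K) \<in> borel_measurable borel"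
  proof -
    have "cutoff f \<in> borel_measurable borel" unfolding cutoff_def[abs_def]
      using c by (intro borel_measurable_continuous_on_indicator continuous_on_of_real) auto
    then show ?thesis by measurable
  qed
  moreover have "cmod (cutoff f z / of_real K) \<le> 1" for z
    using K by (cases "z \<in> ?D") (auto simp: cutoff_def norm_divide)
  moreover have "cutoff f z / of_real K = 0" if "cmod z > R + 2" for z using that by (simp add: cutoff_def)
  moreover have "\<exists>\<delta>>0. \<forall>h. 0 < h \<longrightarrow> h < \<delta> \<longrightarrow> (\<forall>x z. cmod x \<le> R \<longrightarrow> z \<in> box (x + corner h 0) (x + corner h 2) \<longrightarrow>
        cmod (cutoff f z / of_real K - cutoff f x / of_real K) \<le> e)" if e: "e > 0" for e
  proof -
    have "uniformly_continuous_on ?D f" by (intro compact_uniformly_continuous c) simp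
    then obtain \<delta> where \<delta>: "\<delta> > 0" "\<And>x z. x \<in> ?D \<Longrightarrow> z \<in> ?D \<Longrightarrow> dist z x < \<delta> \<Longrightarrow> dist (f z) (f x) < e * K"
      using e K(1) unfolding uniformly_continuous_on_def by (metis mult_pos_pos)
    show ?thesis
    proof (intro exI[of _ "min 1 (\<delta> / 2)"] conjI allI impI)
      fix h x z assume h: "0 < h" "h < min 1 (\<delta> / 2)" and x: "cmod x \<le> R" and z: "z \<in> box (x + corner h 0) (x + corner h 2)"
      have "cmod (z - x) \<le> \<bar>Re (z - x)\<bar> + \<bar>Im (z - x)\<bar>" by (rule cmod_le)
      also have "\<dots> \<le> h + h" using z by (intro add_mono) (auto simp: in_box_complex_iff corner_simps abs_le_iff)
      finally have zx: "cmod (z - x) \<le> 2 * h" by simp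
      have "cmod z \<le> R + 2" using zx x h norm_triangle_ineq2[of z x] by simp
      then have D: "x \<in> ?D" "z \<in> ?D" using x by auto
      have "\<bar>f z - f x\<bar> \<le> e * K" using \<delta>(2)[OF D] zx h by (simp add: dist_norm dist_real_def less_imp_le)
      moreover have "cutoff f z / of_real K - cutoff f x / of_real K = of_real ((f z - f x) / K)"
        using D by (simp add: cutoff_def diff_divide_distrib)
      ultimately show "cmod (cutoff f z / of_real K - cutoff f x / of_real K) \<le> e"
        using K(1) by (simp only: norm_of_real) (simp add: pos_divide_le_eq)
    qed (use \<delta> in simp)
  qed
  ultimately show ?thesis using K(1) by blast
qed

lemma sum_cutoff: "(\<Sum>x\<in>Z n. of_real (w n x) * (cutoff f x / of_real K)) = of_real ((\<Sum>x\<in>Z n. w n x * f x) / K)"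
proof -
  have "cutoff f x = of_real (f x)" if "x \<in> Z n" for x
    using Z_bounded[OF that] by (simp add: cutoff_def)
  then have "(\<Sum>x\<in>Z n. of_real (w n x) * (cutoff f x / of_real K)) = (\<Sum>x\<in>Z n. of_real (w n x * f x / K))"
    by (intro sum.cong refl) simp
  then show ?thesis by (simp add: sum_divide_distrib)
qed

text \<open>For a given accuracy the half-side h is fixed by uniform continuity; the averaged sums
  converge and stay within e/2 of the given ones. Their limit depends on h, so the conclusion is
  drawn by the Cauchy criterion.\<close>

theorem weighted_sums_convergent:
  assumes f: "continuous_on UNIV f"
  shows "convergent (\<lambda>n. \<Sum>x\<in>Z n. w n x * f x)"
proof -
  obtain K where K: "K > 0" "(\<lambda>z. cutoff f z / of_real K) \<in> borel_measurable borel" "\<And>z. cmod (cutoff f z / of_real K) \<le> 1"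
     "\<And>z. cmod z > R + 2 \<Longrightarrow> cutoff f z / of_real K = 0"
     and osc: "\<And>e. e > 0 \<Longrightarrow> \<exists>\<delta>>0. \<forall>h. 0 < h \<longrightarrow> h < \<delta> \<longrightarrow> (\<forall>x z. cmod x \<le> R \<longrightarrow> z \<in> box (x + corner h 0) (x + corner h 2) \<longrightarrow>
        cmod (cutoff f z / of_real K - cutoff f x / of_real K) \<le> e)"
    using cutoff_props[OF f] by blast
  have "convergent (\<lambda>n. \<Sum>x\<in>Z n. of_real (w n x) * (cutoff f x / of_real K))"
  proof (rule convergent_of_approx)
    fix e :: real assume e: "e > 0"
    obtain \<delta> where \<delta>: "\<delta> > 0" "\<forall>h. 0 < h \<longrightarrow> h < \<delta> \<longrightarrow> (\<forall>x z. cmod x \<le> R \<longrightarrow> z \<in> box (x + corner h 0) (x + corner h 2) \<longrightarrow>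
        cmod (cutoff f z / of_real K - cutoff f x / of_real K) \<le> e / 2)"
      using osc[of "e/2"] e by auto
    define h where "h = \<delta> / 2"
    have h: "h > 0" "h < \<delta>" using \<delta> by (auto simp: h_def)
    define L where "L = square_integral h (\<lambda>c. \<integral>z. cutoff f z / of_real K * m (z + c) \<partial>lborel) / (2 * pi * \<i> * of_real (4 * h\<^sup>2))"
    define J where "J n = (\<Sum>x\<in>Z n. of_real (w n x) * (2 * pi * \<i> * (\<integral>z. cutoff f z / of_real K * indicator (box (z + corner h 0) (z + corner h 2)) x \<partial>lborel))) / (2 * pi * \<i> * of_real (4 * h\<^sup>2))" for n
    have "J \<longlonglongrightarrow> L" unfolding J_def L_def
      using h by (intro tendsto_divide tendsto_const square_integral_limit[OF K(2-4)]) auto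
    then have "\<forall>\<^sub>F n in sequentially. dist (J n) L < e / 2" using e by (intro tendstoD) auto
    moreover have "cmod ((\<Sum>x\<in>Z n. of_real (w n x) * (cutoff f x / of_real K)) - J n) \<le> e / 2" for n
      unfolding J_def by (rule integral_approx[OF K(2-4) h(1)]) (use \<delta>(2) h in auto)
    ultimately have "\<forall>\<^sub>F n in sequentially. cmod ((\<Sum>x\<in>Z n. of_real (w n x) * (cutoff f x / of_real K)) - L) \<le> e"
    proof (elim eventually_mono)
      fix n assume 1: "\<And>n. cmod ((\<Sum>x\<in>Z n. of_real (w n x) * (cutoff f x / of_real K)) - J n) \<le> e / 2" and 2: "dist (J n) L < e / 2"
      show "cmod ((\<Sum>x\<in>Z n. of_real (w n x) * (cutoff f x / of_real K)) - L) \<le> e"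
        using norm_triangle_ineq[of "(\<Sum>x\<in>Z n. of_real (w n x) * (cutoff f x / of_real K)) - J n" "J n - L"] 1[of n] 2
        by (simp add: dist_norm)
    qed
    then show "\<exists>L. \<forall>\<^sub>F n in sequentially. cmod ((\<Sum>x\<in>Z n. of_real (w n x) * (cutoff f x / of_real K)) - L) \<le> e" by blast
  qed
  then obtain l where "(\<lambda>n. complex_of_real ((\<Sum>x\<in>Z n. w n x * f x) / K)) \<longlonglongrightarrow> l"
    unfolding sum_cutoff convergent_def by blast
  then have "(\<lambda>n. Re (complex_of_real ((\<Sum>x\<in>Z n. w n x * f x) / K)) * K) \<longlonglongrightarrow> Re l * K"
    by (intro tendsto_intros)
  then have "(\<lambda>n. \<Sum>x\<in>Z n. w n x * f x) \<longlonglongrightarrow> Re l * K" using K(1) by simp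
  then show ?thesis by (rule convergentI)
qed

theorem weighted_sums_vanish:
  assumes z0: "z0 \<in> G"
  shows "\<exists>\<rho>>0. \<forall>f. continuous_on UNIV f \<longrightarrow> (\<forall>z. z \<notin> ball z0 \<rho> \<longrightarrow> f z = 0) \<longrightarrow> (\<lambda>n. \<Sum>x\<in>Z n. w n x * f x) \<longlonglongrightarrow> 0"
proof -
  obtain \<epsilon> M where \<epsilon>: "\<epsilon> > 0" and M: "M holomorphic_on ball z0 \<epsilon>"
     and lim: "\<forall>z\<in>ball z0 \<epsilon>. (\<lambda>n. \<Sum>x\<in>Z n. of_real (w n x) / (z - x)) \<longlonglongrightarrow> M z"
    using local_limit[OF z0] by blast
  have mM: "m z = M z" if "z \<in> ball z0 \<epsilon>" for z
  proof -
    have "(\<lambda>n. S n z) \<longlonglongrightarrow> M z" using lim that by (simp add: S_def)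
    then show ?thesis unfolding m_def by (rule limI)
  qed
  show ?thesis
  proof (intro exI[of _ "\<epsilon> / 2"] conjI allI impI)
    fix f :: "complex \<Rightarrow> real" assume f: "continuous_on UNIV f" and supp: "\<forall>z. z \<notin> ball z0 (\<epsilon> / 2) \<longrightarrow> f z = 0"
    obtain K where K: "K > 0" "(\<lambda>z. cutoff f z / of_real K) \<in> borel_measurable borel" "\<And>z. cmod (cutoff f z / of_real K) \<le> 1"
       "\<And>z. cmod z > R + 2 \<Longrightarrow> cutoff f z / of_real K = 0"
       and osc: "\<And>e. e > 0 \<Longrightarrow> \<exists>\<delta>>0. \<forall>h. 0 < h \<longrightarrow> h < \<delta> \<longrightarrow> (\<forall>x z. cmod x \<le> R \<longrightarrow> z \<in> box (x + corner h 0) (x + corner h 2) \<longrightarrow>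
          cmod (cutoff f z / of_real K - cutoff f x / of_real K) \<le> e)"
      using cutoff_props[OF f] by blast
    have supp': "cutoff f z / of_real K = 0" if "z \<notin> ball z0 (\<epsilon> / 2)" for z using supp that by (simp add: cutoff_def)
    have "(\<lambda>n. \<Sum>x\<in>Z n. of_real (w n x) * (cutoff f x / of_real K)) \<longlonglongrightarrow> 0"
    proof (rule LIMSEQ_I)
      fix e :: real assume e: "e > 0"
      obtain \<delta> where \<delta>: "\<delta> > 0" "\<forall>h. 0 < h \<longrightarrow> h < \<delta> \<longrightarrow> (\<forall>x z. cmod x \<le> R \<longrightarrow> z \<in> box (x + corner h 0) (x + corner h 2) \<longrightarrow>
          cmod (cutoff f z / of_real K - cutoff f x / of_real K) \<le> e / 2)"
        using osc[of "e/2"] e by auto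
      \<comment> \<open>The first bound serves the oscillation estimate, the second the margin
        demanded by \<open>square_integral_limit_zero\<close>.\<close>
      define h where "h = min (\<delta> / 2) (\<epsilon> / 16)"
      have h: "h > 0" "h < \<delta>" "8 * h < \<epsilon>" using \<delta> \<epsilon> by (auto simp: h_def min_def)
      define J where "J n = (\<Sum>x\<in>Z n. of_real (w n x) * (2 * pi * \<i> * (\<integral>z. cutoff f z / of_real K * indicator (box (z + corner h 0) (z + corner h 2)) x \<partial>lborel))) / (2 * pi * \<i> * of_real (4 * h\<^sup>2))" for n
      have "J \<longlonglongrightarrow> 0 / (2 * pi * \<i> * of_real (4 * h\<^sup>2))" unfolding J_def
        using h square_integral_limit[OF K(2-4) h(1)] square_integral_limit_zero[OF K(2-4) M mM supp' h(1,3)]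
        by (intro tendsto_divide tendsto_const) auto
      then have "\<forall>\<^sub>F n in sequentially. dist (J n) 0 < e / 2" using e by (intro tendstoD) auto
      then obtain N where N: "\<And>n. n \<ge> N \<Longrightarrow> cmod (J n) < e / 2" by (auto simp: eventually_sequentially)
      have "cmod ((\<Sum>x\<in>Z n. of_real (w n x) * (cutoff f x / of_real K)) - J n) \<le> e / 2" for n
        unfolding J_def by (rule integral_approx[OF K(2-4) h(1)]) (use \<delta>(2) h in auto)
      note close = this
      have "norm ((\<Sum>x\<in>Z n. of_real (w n x) * (cutoff f x / of_real K)) - 0) < e" if "n \<ge> N" for n
      proof -
        have "cmod ((\<Sum>x\<in>Z n. of_real (w n x) * (cutoff f x / of_real K)) - J n + J n) < e / 2 + e / 2"
          by (rule le_less_trans[OF norm_triangle_ineq add_le_less_mono[OF close N[OF that]]])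
        then show ?thesis by simp
      qed
      then show "\<exists>no. \<forall>n\<ge>no. norm ((\<Sum>x\<in>Z n. of_real (w n x) * (cutoff f x / of_real K)) - 0) < e" by blast
    qed
    then have "(\<lambda>n. Re (complex_of_real ((\<Sum>x\<in>Z n. w n x * f x) / K)) * K) \<longlonglongrightarrow> Re 0 * K"
      unfolding sum_cutoff by (intro tendsto_intros)
    then show "(\<lambda>n. \<Sum>x\<in>Z n. w n x * f x) \<longlonglongrightarrow> 0" using K(1) by simp
  qed (use \<epsilon> in simp)
qed

end

section \<open>A space-filling curve and compactness of measures\<close>

text \<open>The building block of Schoenberg's curve: even, of period 2, equal to 0 on [0, 1/3] and
  to 1 on [2/3, 1], linear in between. Subtracting a nearest even integer performs the reduction to
  [-1, 1].\<close>

definition schoenberg_wave :: "real \<Rightarrow> real" where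
  "schoenberg_wave x = min 1 (max 0 (3 * \<bar>x - 2 * of_int (round (x / 2))\<bar> - 1))"

lemma schoenberg_wave_bounds: "0 \<le> schoenberg_wave x" "schoenberg_wave x \<le> 1"
  by (auto simp: schoenberg_wave_def)

text \<open>At odd integers the nearest even integer is not unique, but either choice leaves
  distance 1.\<close>

lemma schoenberg_wave_eq:
  assumes "\<bar>x - 2 * of_int m\<bar> \<le> 1"
  shows "schoenberg_wave x = min 1 (max 0 (3 * \<bar>x - 2 * of_int m\<bar> - 1))"
proof -
  have "\<bar>x - 2 * of_int (round (x / 2))\<bar> = \<bar>x - 2 * of_int m\<bar>"
  proof -
    have 1: "\<bar>of_int (round (x / 2)) - x / 2\<bar> \<le> 1 / 2" by (rule of_int_round_abs_le)
    define k where "k = round (x / 2)"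
    define K M :: real where "K = of_int k" and "M = of_int m"
    have K: "\<bar>K - x / 2\<bar> \<le> 1 / 2" and M: "\<bar>x - 2 * M\<bar> \<le> 1" using 1 assms by (simp_all add: K_def M_def k_def)
    have "\<bar>K - M\<bar> \<le> 1" using K M by linarith
    then have "\<bar>k - m\<bar> \<le> 1" by (simp add: K_def M_def flip: of_int_diff of_int_abs)
    then consider "k = m" | "k = m + 1" | "k = m - 1" by linarith
    then have "K = M \<or> K = M + 1 \<or> K = M - 1" by cases (simp_all add: K_def M_def)
    then have "\<bar>x - 2 * K\<bar> = \<bar>x - 2 * M\<bar>" using K M by (elim disjE) linarith+
    then show ?thesis by (simp add: K_def M_def k_def)
  qed
  then show ?thesis by (simp add: schoenberg_wave_def)
qed

lemma schoenberg_wave_0: "\<bar>x - 2 * of_int m\<bar> \<le> 1/3 \<Longrightarrow> schoenberg_wave x = 0"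
  by (subst schoenberg_wave_eq[of x m]) auto

lemma schoenberg_wave_1: "2/3 \<le> x - 2 * of_int m \<Longrightarrow> x - 2 * of_int m \<le> 1 \<Longrightarrow> schoenberg_wave x = 1"
  by (subst schoenberg_wave_eq[of x m]) auto

lemma schoenberg_wave_lipschitz: "\<bar>schoenberg_wave x - schoenberg_wave y\<bar> \<le> 3 * \<bar>x - y\<bar>"
proof -
  define u v :: real where "u = of_int (round (x / 2))" and "v = of_int (round (y / 2))"
  define p q where "p = \<bar>x - 2 * u\<bar>" and "q = \<bar>y - 2 * v\<bar>"
  have "\<bar>x / 2 - u\<bar> \<le> \<bar>x / 2 - v\<bar>" "\<bar>y / 2 - v\<bar> \<le> \<bar>y / 2 - u\<bar>"
    unfolding u_def v_def by (rule round_diff_minimal)+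
  then have le: "\<bar>p - q\<bar> \<le> \<bar>x - y\<bar>" unfolding p_def q_def by linarith
  have "\<bar>min 1 (max 0 (3 * p - 1)) - min 1 (max 0 (3 * q - 1))\<bar> \<le> 3 * \<bar>p - q\<bar>" for p q :: real
    by (auto simp: min_def max_def abs_if)
  from this[of p q] have "\<bar>schoenberg_wave x - schoenberg_wave y\<bar> \<le> 3 * \<bar>p - q\<bar>"
    by (simp add: schoenberg_wave_def p_def q_def u_def v_def)
  also have "\<dots> \<le> 3 * \<bar>x - y\<bar>" using le by simp
  finally show ?thesis .
qed

lemma continuous_schoenberg_wave: "continuous_on UNIV schoenberg_wave"
proof -
  have "3-lipschitz_on UNIV schoenberg_wave"
    using schoenberg_wave_lipschitz by (intro lipschitz_onI) (auto simp: dist_real_def)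
  then show ?thesis by (rule lipschitz_on_continuous_on)
qed

text \<open>For x with ternary digits 0 and 2 only, this reads every second digit, from position
  \<open>i\<close> on, as the binary digits of one coordinate.\<close>

definition schoenberg_sum :: "nat \<Rightarrow> real \<Rightarrow> real" where
  "schoenberg_sum i x = (\<Sum>k. (1/2) ^ Suc k * schoenberg_wave (3 ^ (2 * k + i) * x))"

lemma continuous_schoenberg_sum: "continuous_on UNIV (schoenberg_sum i)"
  unfolding schoenberg_sum_def[abs_def]
proof (rule uniform_limit_theorem)
  show "uniform_limit UNIV (\<lambda>n x. \<Sum>k<n. (1/2) ^ Suc k * schoenberg_wave (3 ^ (2 * k + i) * x))
      (\<lambda>x. \<Sum>k. (1/2) ^ Suc k * schoenberg_wave (3 ^ (2 * k + i) * x)) sequentially"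
  proof (rule Weierstrass_m_test)
    show "summable (\<lambda>k. (1/2::real) ^ Suc k)" using power_half_series by (rule sums_summable)
    show "norm ((1/2) ^ Suc n * schoenberg_wave (3 ^ (2 * n + i) * x)) \<le> (1/2) ^ Suc n" for n x
      using schoenberg_wave_bounds[of "3 ^ (2 * n + i) * x"] by (simp add: abs_mult mult_left_le)
  qed
  show "\<forall>\<^sub>F n in sequentially. continuous_on UNIV (\<lambda>x. \<Sum>k<n. (1/2) ^ Suc k * schoenberg_wave (3 ^ (2 * k + i) * x))"
    by (intro always_eventually allI continuous_intros continuous_on_compose2[OF continuous_schoenberg_wave]) auto
qed simp

lemma binary_expansion:
  fixes y :: real
  assumes "0 \<le> y" "y \<le> 1"
  shows "\<exists>b :: nat \<Rightarrow> bool. (\<lambda>k. (1/2) ^ Suc k * of_bool (b k)) sums y"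
proof -
  \<comment> \<open>The remainder after k digits, rescaled to [0, 1]. Digit 1 is chosen only above
    1/2, and y = 1 gets the expansion with all digits 1.\<close>
  define r where "r = rec_nat y (\<lambda>_ s. if s > 1/2 then 2 * s - 1 else 2 * s)"
  define b where "b k \<longleftrightarrow> r k > 1/2" for k
  have r: "r 0 = y" "r (Suc k) = 2 * r k - of_bool (b k)" for k by (auto simp: r_def b_def)
  have bd: "0 \<le> r k \<and> r k \<le> 1" for k
    by (induction k) (use assms r in \<open>auto simp: b_def\<close>)
  have part: "(\<Sum>k<n. (1/2) ^ Suc k * of_bool (b k)) = y - (1/2) ^ n * r n" for n
  proof (induction n)
    case (Suc n)
    then show ?case by (simp add: r field_simps)
  qed (simp add: r)
  have "(\<lambda>n. (1/2) ^ n * r n) \<longlonglongrightarrow> 0"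
  proof (rule tendsto_0_le)
    show "(\<lambda>n. (1/2::real) ^ n) \<longlonglongrightarrow> 0" by (rule LIMSEQ_power_zero) auto
    show "\<forall>\<^sub>F n in sequentially. norm ((1/2) ^ n * r n) \<le> norm ((1/2::real) ^ n) * 1"
      using bd by (intro always_eventually allI) (simp add: abs_mult mult_left_le)
  qed
  then have "(\<lambda>n. y - (1/2) ^ n * r n) \<longlonglongrightarrow> y - 0" by (intro tendsto_diff tendsto_const)
  then have "(\<lambda>k. (1/2) ^ Suc k * of_bool (b k)) sums y" unfolding sums_def part by simp
  then show ?thesis by (rule exI[of _ b])
qed

text \<open>All ternary digits are 0 or 2, so \<open>3 ^ n * x\<close> is an even integer plus the
  tail that starts with digit n. The tail lies in [0, 1/3] or in [2/3, 1] according to that digit,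
  which is where the wave is constant.\<close>

lemma schoenberg_wave_digit:
  fixes c :: "nat \<Rightarrow> bool"
  defines "x \<equiv> (\<Sum>k. 2 * of_bool (c k) * (1/3) ^ Suc k)"
  shows "schoenberg_wave (3 ^ n * x) = of_bool (c n)"
proof -
  have geo: "(\<lambda>k. (1/3::real) ^ Suc k) sums (1/2)"
    using sums_mult[OF geometric_sums[of "1/3::real"], of "1/3"] by simp
  define T where "T c = (\<Sum>k. 2 * of_bool (c k) * (1/3) ^ Suc k :: real)" for c :: "nat \<Rightarrow> bool"
  have summ: "summable (\<lambda>k. 2 * of_bool (c k) * (1/3) ^ Suc k :: real)" for c :: "nat \<Rightarrow> bool"
    by (rule summable_comparison_test'[of "\<lambda>k. 2 * (1/3::real) ^ Suc k"])
       (use sums_summable[OF sums_mult[OF geo, of 2]] in auto)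
  have T_bd: "0 \<le> T c" "T c \<le> 1" for c
  proof -
    show "0 \<le> T c" unfolding T_def by (intro suminf_nonneg summ) auto
    have "T c \<le> (\<Sum>k. 2 * (1/3::real) ^ Suc k)" unfolding T_def
      by (intro suminf_le summ sums_summable[OF sums_mult[OF geo]]) auto
    also have "\<dots> = 1" using sums_unique[OF sums_mult[OF geo, of 2]] by simp
    finally show "T c \<le> 1" .
  qed
  have T_step: "3 * T c = 2 * of_bool (c 0) + T (\<lambda>k. c (Suc k))" for c
  proof -
    have "T c = 2 * of_bool (c 0) * (1/3) + (\<Sum>k. 2 * of_bool (c (Suc k)) * (1/3) ^ Suc (Suc k))"
      unfolding T_def using suminf_split_head[OF summ[of c]] by simp
    also have "(\<Sum>k. 2 * of_bool (c (Suc k)) * (1/3::real) ^ Suc (Suc k)) =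
       (\<Sum>k. (1/3) * (2 * of_bool (c (Suc k)) * (1/3::real) ^ Suc k))" by (simp add: mult_ac)
    also have "\<dots> = (1/3) * T (\<lambda>k. c (Suc k))" unfolding T_def by (intro suminf_mult summ)
    finally show ?thesis by simp
  qed
  have shift: "\<exists>m::int. 3 ^ n * T c = 2 * of_int m + T (\<lambda>k. c (n + k))"
  proof (induction n)
    case (Suc n)
    then obtain m :: int where m: "3 ^ n * T c = 2 * of_int m + T (\<lambda>k. c (n + k))" by blast
    have "3 ^ Suc n * T c = 3 * (2 * of_int m + T (\<lambda>k. c (n + k)))" by (simp flip: m)
    also have "\<dots> = 2 * of_int (3 * m + of_bool (c n)) + T (\<lambda>k. c (Suc n + k))"
      using T_step[of "\<lambda>k. c (n + k)"] by simp
    finally show ?case by blast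
  qed (auto intro: exI[of _ 0])
  then obtain m :: int where m: "3 ^ n * T c = 2 * of_int m + T (\<lambda>k. c (n + k))" by blast
  have xT: "x = T c" by (simp add: x_def T_def)
  show ?thesis
  proof (cases "c n")
    case True
    then have "2/3 \<le> T (\<lambda>k. c (n + k))" "T (\<lambda>k. c (n + k)) \<le> 1"
      using T_step[of "\<lambda>k. c (n + k)"] T_bd[of "\<lambda>k. c (n + k)"] T_bd[of "\<lambda>k. c (n + Suc k)"] by auto
    then show ?thesis using True m by (simp add: xT schoenberg_wave_1[of _ m])
  next
    case False
    then have "0 \<le> T (\<lambda>k. c (n + k))" "T (\<lambda>k. c (n + k)) \<le> 1/3"
      using T_step[of "\<lambda>k. c (n + k)"] T_bd[of "\<lambda>k. c (n + k)"] T_bd[of "\<lambda>k. c (n + Suc k)"] by auto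
    then show ?thesis using False m by (simp add: xT schoenberg_wave_0[of _ m])
  qed
qed

lemma square_filling_curve:
  obtains g :: "real \<Rightarrow> complex" where "continuous_on UNIV g"
    "\<And>z. Re z \<in> {0..1} \<Longrightarrow> Im z \<in> {0..1} \<Longrightarrow> \<exists>x\<in>{0..1}. g x = z"
proof -
  define g where "g x = Complex (schoenberg_sum 0 x) (schoenberg_sum 1 x)" for x
  have "continuous_on UNIV g" unfolding g_def[abs_def] by (intro continuous_intros continuous_schoenberg_sum)
  moreover have "\<exists>x\<in>{0..1}. g x = z" if "Re z \<in> {0..1}" "Im z \<in> {0..1}" for z
  proof -
    have "\<exists>b :: nat \<Rightarrow> bool. (\<lambda>k. (1/2) ^ Suc k * of_bool (b k)) sums Re z"
      by (rule binary_expansion) (use that in auto)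
    then obtain b0 :: "nat \<Rightarrow> bool" where b0: "(\<lambda>k. (1/2) ^ Suc k * of_bool (b0 k)) sums Re z" by (elim exE)
    have "\<exists>b :: nat \<Rightarrow> bool. (\<lambda>k. (1/2) ^ Suc k * of_bool (b k)) sums Im z"
      by (rule binary_expansion) (use that in auto)
    then obtain b1 :: "nat \<Rightarrow> bool" where b1: "(\<lambda>k. (1/2) ^ Suc k * of_bool (b1 k)) sums Im z" by (elim exE)
    \<comment> \<open>The binary digits of both coordinates are interleaved into one point of the
      Cantor set.\<close>
    define c where "c k = (if even k then b0 (k div 2) else b1 (k div 2))" for k
    define x where "x = (\<Sum>k. 2 * of_bool (c k) * (1/3::real) ^ Suc k)"
    have geo: "(\<lambda>k. 2 * (1/3::real) ^ Suc k) sums 1"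
      using sums_mult[OF geometric_sums[of "1/3::real"], of "2/3"] by simp
    have summ: "summable (\<lambda>k. 2 * of_bool (c k) * (1/3) ^ Suc k :: real)"
      by (rule summable_comparison_test'[of "\<lambda>k. 2 * (1/3::real) ^ Suc k"]) (use sums_summable[OF geo] in auto)
    have "0 \<le> x" unfolding x_def by (intro suminf_nonneg summ) auto
    moreover have "x \<le> (\<Sum>k. 2 * (1/3::real) ^ Suc k)" unfolding x_def
      by (intro suminf_le summ sums_summable[OF geo]) auto
    then have "x \<le> 1" using sums_unique[OF geo] by simp
    moreover have "schoenberg_wave (3 ^ (2 * k + 0) * x) = of_bool (b0 k)" for k
      using schoenberg_wave_digit[of "2 * k + 0" c, folded x_def] by (simp add: c_def)
    then have "schoenberg_sum 0 x = Re z" unfolding schoenberg_sum_def using sums_unique[OF b0] by simp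
    moreover have "schoenberg_wave (3 ^ (2 * k + 1) * x) = of_bool (b1 k)" for k
      using schoenberg_wave_digit[of "2 * k + 1" c, folded x_def] by (simp add: c_def)
    then have "schoenberg_sum 1 x = Im z" unfolding schoenberg_sum_def using sums_unique[OF b1] by simp
    ultimately show ?thesis by (intro bexI[of _ x]) (auto simp: g_def complex_eq_iff)
  qed
  ultimately show ?thesis by (rule that)
qed

section \<open>Weak limits: uniqueness and existence\<close>

lemma borel_prob_eqI:
  fixes L L' :: "complex measure"
  assumes L: "borel_prob L" "borel_prob L'"
    and eq: "\<And>f :: complex \<Rightarrow> real. continuous_on UNIV f \<Longrightarrow> bounded (range f) \<Longrightarrow> (\<integral>x. f x \<partial>L) = (\<integral>x. f x \<partial>L')"
  shows "L = L'"
proof (rule measure_eqI_generator_eq[where E = "{U. open U}" and \<Omega> = UNIV and A = "\<lambda>_. UNIV"])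
  show "Int_stable {U :: complex set. open U}" by (auto simp: Int_stable_def)
  show "sets L = sigma_sets UNIV {U. open U}" "sets L' = sigma_sets UNIV {U. open U}"
    using L by (auto simp: borel_prob_def borel_def)
  interpret L: prob_space L using L by (simp add: borel_prob_def)
  interpret L': prob_space L' using L by (simp add: borel_prob_def)
  have sL: "sets L = sets borel" "sets L' = sets borel" using L by (auto simp: borel_prob_def)
  show "emeasure L UNIV \<noteq> \<infinity>" using L.emeasure_finite by simp
  fix U :: "complex set" assume "U \<in> {U. open U}"
  then have U: "open U" by simp
  show "emeasure L U = emeasure L' U"
  \<comment> \<open>The whole space is treated apart: \<open>infdist\<close> to the empty set is 0,
    so the functions \<open>f k\<close> below would vanish identically.\<close>
  proof (cases "U = UNIV")
    case True
    then show ?thesis using L.emeasure_space_1 L'.emeasure_space_1 sL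
      by (metis sets_eq_imp_space_eq space_borel)
  next
    case False
    define f where "f k x = min 1 (real k * infdist x (- U))" for k x
    have f_cont: "continuous_on UNIV (f k)" for k unfolding f_def by (intro continuous_intros)
    have f_bd: "0 \<le> f k x" "f k x \<le> 1" for k x by (auto simp: f_def infdist_nonneg)
    have f_meas: "f k \<in> borel_measurable borel" for k by (rule borel_measurable_continuous_onI[OF f_cont])
    have f_lim: "(\<lambda>k. f k x) \<longlonglongrightarrow> indicator U x" for x
    proof (cases "x \<in> U")
      case False
      then show ?thesis by (simp add: f_def infdist_zero)
    next
      case True
      have "infdist x (- U) \<noteq> 0" using in_closed_iff_infdist_zero[of "- U" x] U True \<open>U \<noteq> UNIV\<close> by (auto simp: closed_Compl)
      then have p: "infdist x (- U) > 0" using infdist_nonneg[of x "- U"] by linarith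
      obtain k0 :: nat where k0: "1 < real k0 * infdist x (- U)" using reals_Archimedean3[OF p] by blast
      have "\<forall>\<^sub>F k in sequentially. f k x = indicator U x"
        using eventually_ge_at_top[of k0]
      proof eventually_elim
        case (elim k)
        have "real k0 * infdist x (- U) \<le> real k * infdist x (- U)" using elim p by (intro mult_right_mono) auto
        then show ?case using k0 True by (simp add: f_def)
      qed
      then show ?thesis by (rule tendsto_eventually)
    qed
    have lim: "(\<lambda>k. \<integral>x. f k x \<partial>M) \<longlonglongrightarrow> measure M U" if M: "prob_space M" "sets M = sets borel" for M :: "complex measure"
    proof -
      interpret M: prob_space M by fact
      have [measurable]: "U \<in> sets M" using U M by simp
      have "(\<lambda>k. \<integral>x. f k x \<partial>M) \<longlonglongrightarrow> (\<integral>x. indicator U x \<partial>M)"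
      proof (rule integral_dominated_convergence[where w = "\<lambda>_. 1"])
        show "f k \<in> borel_measurable M" for k using f_meas measurable_cong_sets[OF M(2) refl] by blast
        show "AE x in M. norm (f k x) \<le> 1" for k using f_bd by (intro AE_I2) auto
        show "AE x in M. (\<lambda>k. f k x) \<longlonglongrightarrow> indicator U x" using f_lim by (intro AE_I2)
      qed auto
      then show ?thesis by simp
    qed
    have "(\<integral>x. f k x \<partial>L) = (\<integral>x. f k x \<partial>L')" for k
      using f_bd by (intro eq f_cont boundedI[where B = 1]) (auto simp: abs_le_iff intro: order_trans[of _ 0])
    then have "measure L U = measure L' U"
      using lim[of L] lim[of L'] sL L.prob_space_axioms L'.prob_space_axioms by (simp add: LIMSEQ_unique)
    then show ?thesis by (simp add: L.emeasure_eq_measure L'.emeasure_eq_measure)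
  qed
qed auto

lemma weakly_converges_unique:
  fixes M :: "nat \<Rightarrow> complex measure"
  assumes "weakly_converges M L" "weakly_converges M L'"
  shows "L = L'"
  using assms unfolding weakly_converges_def by (intro borel_prob_eqI) (auto intro: LIMSEQ_unique)

lemma integral_distr_point_measure:
  fixes f :: "'b :: topological_space \<Rightarrow> real"
  assumes "finite Z" "\<And>x. x \<in> Z \<Longrightarrow> 0 \<le> w x" "f \<in> borel_measurable borel"
  shows "(\<integral>y. f y \<partial>(distr (point_measure Z (\<lambda>x. ennreal (w x))) borel s)) = (\<Sum>x\<in>Z. w x * f (s x))"
proof -
  have "s \<in> measurable (point_measure Z (\<lambda>x. ennreal (w x))) borel" by (simp add: point_measure_def)
  then have "(\<integral>y. f y \<partial>(distr (point_measure Z (\<lambda>x. ennreal (w x))) borel s)) = (\<integral>x. f (s x) \<partial>(point_measure Z (\<lambda>x. ennreal (w x))))"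
    using assms(3) by (rule integral_distr)
  also have "\<dots> = (\<Sum>x\<in>Z. w x *\<^sub>R f (s x))" using assms(1,2) by (rule lebesgue_integral_point_measure_finite)
  finally show ?thesis by simp
qed

lemma borel_prob_distr_point_measure:
  assumes "finite Z" "\<And>x. x \<in> Z \<Longrightarrow> 0 \<le> w x" "(\<Sum>x\<in>Z. w x) = 1"
  shows "prob_space (distr (point_measure Z (\<lambda>x. ennreal (w x))) borel s)"
proof (rule prob_space.prob_space_distr)
  have "emeasure (point_measure Z (\<lambda>x. ennreal (w x))) Z = (\<Sum>x\<in>Z. ennreal (w x))"
    using assms(1) by (rule emeasure_point_measure_finite) simp
  also have "\<dots> = 1" using assms by (subst sum_ennreal) auto
  finally show "prob_space (point_measure Z (\<lambda>x. ennreal (w x)))"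
    by (intro prob_spaceI) (simp add: space_point_measure)
qed (simp add: point_measure_def)

text \<open>Compactness is transported from the line along a space-filling curve: lift the weights to the
  parameter interval, apply Helly's selection theorem there and push the limit back.\<close>

lemma limit_measure_exists:
  fixes Z :: "nat \<Rightarrow> complex set" and w :: "nat \<Rightarrow> complex \<Rightarrow> real"
  assumes Z: "\<And>n. finite (Z n)" "\<And>n x. x \<in> Z n \<Longrightarrow> 0 \<le> w n x" "\<And>n. (\<Sum>x\<in>Z n. w n x) = 1"
    and R: "\<And>n x. x \<in> Z n \<Longrightarrow> cmod x \<le> R"
    and conv: "\<And>f. continuous_on UNIV f \<Longrightarrow> convergent (\<lambda>n. \<Sum>x\<in>Z n. w n x * f x)"
  shows "\<exists>L. borel_prob L \<and> (\<forall>f. continuous_on UNIV f \<longrightarrow> bounded (range f) \<longrightarrow>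
     (\<lambda>n. \<Sum>x\<in>Z n. w n x * f x) \<longlonglongrightarrow> (\<integral>x. f x \<partial>L))"
proof -
  obtain g :: "real \<Rightarrow> complex" where g: "continuous_on UNIV g" "\<forall>z. Re z \<in> {0..1} \<longrightarrow> Im z \<in> {0..1} \<longrightarrow> (\<exists>x\<in>{0..1}. g x = z)"
    using square_filling_curve by blast
  define R' where "R' = \<bar>R\<bar> + 1"
  have R': "R' > 0" "R \<le> R'" by (auto simp: R'_def)
  define \<gamma> where "\<gamma> x = of_real (2 * R') * g x - Complex R' R'" for x
  have \<gamma>_cont: "continuous_on UNIV \<gamma>" unfolding \<gamma>_def[abs_def] using g(1) by (intro continuous_intros)
  have \<gamma>_meas [measurable]: "\<gamma> \<in> borel_measurable borel" using \<gamma>_cont by (rule borel_measurable_continuous_onI)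
  have "\<exists>x\<in>{0..1}. \<gamma> x = z" if "cmod z \<le> R" for z
  proof -
    define z' where "z' = (z + Complex R' R') / of_real (2 * R')"
    have "\<bar>Re z\<bar> \<le> R'" "\<bar>Im z\<bar> \<le> R'" using that R' abs_Re_le_cmod[of z] abs_Im_le_cmod[of z] by linarith+
    then have "Re z' \<in> {0..1}" "Im z' \<in> {0..1}" using R'(1)
      by (simp_all add: z'_def Re_divide_of_real Im_divide_of_real abs_le_iff)
    then obtain x where "x \<in> {0..1}" "g x = z'" using g(2) by blast
    then show ?thesis using R'(1) by (intro bexI[of _ x]) (simp_all add: \<gamma>_def z'_def)
  qed
  \<comment> \<open>The preimages are chosen arbitrarily; on a \<open>point_measure\<close> every
    function is measurable.\<close>
  then obtain s where s: "\<And>z. cmod z \<le> R \<Longrightarrow> s z \<in> {0..1}" "\<And>z. cmod z \<le> R \<Longrightarrow> \<gamma> (s z) = z" by metis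
  define \<nu> where "\<nu> n = distr (point_measure (Z n) (\<lambda>x. ennreal (w n x))) borel s" for n
  have \<nu>_prob: "prob_space (\<nu> n)" for n unfolding \<nu>_def using Z by (intro borel_prob_distr_point_measure) auto
  have \<nu>_int: "(\<integral>y. f y \<partial>\<nu> n) = (\<Sum>x\<in>Z n. w n x * f (s x))" if "f \<in> borel_measurable borel" for f :: "real \<Rightarrow> real" and n
    unfolding \<nu>_def using Z that by (intro integral_distr_point_measure) auto
  have \<nu>_rd: "real_distribution (\<nu> n)" for n
    using \<nu>_prob[of n] by (simp add: real_distribution_def real_distribution_axioms_def \<nu>_def)
  have mass: "measure (\<nu> n) {-1<..1} = 1" for n
  proof -
    interpret prob_space "\<nu> n" by (rule \<nu>_prob)
    have "measure (\<nu> n) {-1<..1} = (\<integral>y. indicator {-1<..1} y \<partial>\<nu> n)" by (simp add: \<nu>_def)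
    also have "\<dots> = (\<Sum>x\<in>Z n. w n x * indicator {-1<..1} (s x))" by (rule \<nu>_int) simp
    also have "\<dots> = (\<Sum>x\<in>Z n. w n x)"
    proof (rule sum.cong[OF refl])
      fix x assume "x \<in> Z n"
      then have "s x \<in> {0..1}" using s(1) R by blast
      then show "w n x * indicator {-1<..1} (s x) = w n x" by (simp add: indicator_def)
    qed
    finally show ?thesis using Z(3) by simp
  qed
  have tight: "tight \<nu>"
    unfolding tight_def
  proof (intro conjI allI impI)
    fix \<epsilon> :: real assume "\<epsilon> > 0"
    then show "\<exists>a b. a < b \<and> (\<forall>n. measure (\<nu> n) {a<..b} > 1 - \<epsilon>)"
      using mass by (intro exI[of _ "-1"] exI[of _ 1]) simp
  qed (rule \<nu>_rd)
  obtain \<kappa> M where \<kappa>: "strict_mono (\<kappa> :: nat \<Rightarrow> nat)" "real_distribution M" "weak_conv_m (\<nu> \<circ> id \<circ> \<kappa>) M"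
    using tight_imp_convergent_subsubsequence[OF tight strict_mono_id] by blast
  interpret M: real_distribution M by (rule \<kappa>(2))
  define L where "L = distr M borel \<gamma>"
  have "prob_space L" unfolding L_def by (rule M.prob_space_distr) simp
  then have L: "borel_prob L" by (simp add: borel_prob_def L_def)
  have "(\<lambda>n. \<Sum>x\<in>Z n. w n x * f x) \<longlonglongrightarrow> (\<integral>x. f x \<partial>L)" if f: "continuous_on UNIV f" "bounded (range f)" for f :: "complex \<Rightarrow> real"
  proof -
    have fm [measurable]: "f \<in> borel_measurable borel" using f(1) by (rule borel_measurable_continuous_onI)
    obtain B where B: "\<And>x. \<bar>f x\<bar> \<le> B" using f(2) unfolding bounded_iff by auto
    have c: "continuous_on UNIV (\<lambda>x. f (\<gamma> x))" by (rule continuous_on_compose2[OF f(1) \<gamma>_cont]) auto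
    have "(\<lambda>n. \<integral>x. f (\<gamma> x) \<partial>((\<nu> \<circ> id \<circ> \<kappa>) n)) \<longlonglongrightarrow> (\<integral>x. f (\<gamma> x) \<partial>M)"
    proof (rule weak_conv_imp_integral_bdd_continuous_conv[OF _ \<kappa>(2,3), where B = B])
      show "real_distribution ((\<nu> \<circ> id \<circ> \<kappa>) n)" for n using \<nu>_rd by simp
      show "isCont (\<lambda>x. f (\<gamma> x)) x" for x using c by (simp add: continuous_on_eq_continuous_at)
      show "norm (f (\<gamma> x)) \<le> B" for x using B by simp
    qed
    moreover have "(\<integral>x. f (\<gamma> x) \<partial>((\<nu> \<circ> id \<circ> \<kappa>) n)) = (\<Sum>x\<in>Z (\<kappa> n). w (\<kappa> n) x * f x)" for n
    proof -
      have "(\<integral>x. f (\<gamma> x) \<partial>\<nu> (\<kappa> n)) = (\<Sum>x\<in>Z (\<kappa> n). w (\<kappa> n) x * f (\<gamma> (s x)))" by (rule \<nu>_int) measurable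
      also have "\<dots> = (\<Sum>x\<in>Z (\<kappa> n). w (\<kappa> n) x * f x)" using s(2) R by (intro sum.cong refl) auto
      finally show ?thesis by simp
    qed
    moreover have "(\<integral>x. f (\<gamma> x) \<partial>M) = (\<integral>x. f x \<partial>L)" unfolding L_def by (rule integral_distr[symmetric]) measurable
    ultimately have sub: "(\<lambda>n. \<Sum>x\<in>Z (\<kappa> n). w (\<kappa> n) x * f x) \<longlonglongrightarrow> (\<integral>x. f x \<partial>L)" by simp
    \<comment> \<open>Helly's theorem yields the limit along \<kappa> only; convergence of the full
      sequence makes it the limit of all terms.\<close>
    obtain l where l: "(\<lambda>n. \<Sum>x\<in>Z n. w n x * f x) \<longlonglongrightarrow> l" using conv[OF f(1)] by (auto simp: convergent_def)
    have "(\<lambda>n. \<Sum>x\<in>Z (\<kappa> n). w (\<kappa> n) x * f x) \<longlonglongrightarrow> l" using LIMSEQ_subseq_LIMSEQ[OF l \<kappa>(1)] by (simp add: o_def)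
    then show ?thesis using l LIMSEQ_unique[OF sub] by blast
  qed
  then show ?thesis using L by blast
qed

lemma null_where_positive:
  fixes f :: "complex \<Rightarrow> real"
  assumes L: "borel_prob L" and f: "continuous_on UNIV f" "bounded (range f)" "\<And>x. 0 \<le> f x"
    and 0: "(\<integral>x. f x \<partial>L) = 0"
  shows "emeasure L {x. f x > 0} = 0"
proof -
  interpret L: prob_space L using L by (simp add: borel_prob_def)
  have sL: "sets L = sets borel" using L by (simp add: borel_prob_def)
  have "f \<in> borel_measurable borel" using f(1) by (rule borel_measurable_continuous_onI)
  then have fm [measurable]: "f \<in> borel_measurable L" using measurable_cong_sets[OF sL refl] by blast
  obtain B where B: "\<And>x. \<bar>f x\<bar> \<le> B" using f(2) unfolding bounded_iff by auto
  have "integrable L f" using B by (intro L.integrable_const_bound[where B = B]) auto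
  then have "AE x in L. f x = 0" using integral_nonneg_eq_0_iff_AE[of L f] f(3) 0 by simp
  then have "AE x in L. x \<notin> {x. f x > 0}" by eventually_elim auto
  moreover have "{x. f x > 0} \<in> sets L"
    unfolding sL using f(1) by (intro borel_open open_Collect_less) (auto simp: continuous_on_const)
  ultimately have "{x. f x > 0} \<in> null_sets L" by (subst AE_iff_null_sets)
  then show ?thesis by (rule null_setsD1)
qed

context cauchy_transforms
begin

theorem weak_limit:
  assumes G: "open G"
  shows "\<exists>L. borel_prob L \<and> (\<forall>f. continuous_on UNIV f \<longrightarrow> bounded (range f) \<longrightarrow>
       (\<lambda>n. \<Sum>x\<in>Z n. w n x * f x) \<longlonglongrightarrow> (\<integral>x. f x \<partial>L)) \<and>
     compact (measure_support L) \<and> mutually_singular L lborel"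
proof -
  obtain L where L: "borel_prob L" and lim: "\<And>f. continuous_on UNIV f \<Longrightarrow> bounded (range f) \<Longrightarrow>
     (\<lambda>n. \<Sum>x\<in>Z n. w n x * f x) \<longlonglongrightarrow> (\<integral>x. f x \<partial>L)"
  proof -
    have "\<exists>L. borel_prob L \<and> (\<forall>f. continuous_on UNIV f \<longrightarrow> bounded (range f) \<longrightarrow>
       (\<lambda>n. \<Sum>x\<in>Z n. w n x * f x) \<longlonglongrightarrow> (\<integral>x. f x \<partial>L))"
      by (rule limit_measure_exists) (use finite_Z w_nonneg w_sum Z_bounded weighted_sums_convergent in auto)
    then show ?thesis using that by blast
  qed
  interpret L: prob_space L using L by (simp add: borel_prob_def)
  have sL: "sets L = sets borel" using L by (simp add: borel_prob_def)
  have outside: "emeasure L {x. cmod x > R} = 0"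
  proof -
    \<comment> \<open>Zero on all the sets \<open>Z n\<close> and positive exactly where |x| > R, so
      its integral detects mass outside the disc.\<close>
    define f where "f x = min 1 (max 0 (cmod x - R))" for x
    have f: "continuous_on UNIV f" unfolding f_def[abs_def] by (intro continuous_intros)
    have fb: "bounded (range f)" by (intro boundedI[where B = 1]) (auto simp: f_def)
    have "w n x * f x = 0" if "x \<in> Z n" for n x using Z_bounded[OF that] by (simp add: f_def)
    then have "(\<lambda>n. \<Sum>x\<in>Z n. w n x * f x) = (\<lambda>n. 0)" by (intro ext sum.neutral) auto
    then have "(\<integral>x. f x \<partial>L) = 0" using lim[OF f fb] by (simp add: LIMSEQ_const_iff)
    then have "emeasure L {x. f x > 0} = 0" by (intro null_where_positive[OF L f fb]) (auto simp: f_def)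
    moreover have "{x. f x > 0} = {x. cmod x > R}" by (auto simp: f_def min_def max_def)
    ultimately show ?thesis by simp
  qed
  have supp_sub: "measure_support L \<subseteq> cball 0 R"
  proof
    fix x assume x: "x \<in> measure_support L"
    show "x \<in> cball 0 R"
    proof (rule ccontr)
      assume "x \<notin> cball 0 R"
      then have "x \<in> {x. cmod x > R}" by simp
      moreover have "open {x::complex. cmod x > R}" by (intro open_Collect_less continuous_intros)
      ultimately have "emeasure L {x. cmod x > R} > 0" using x unfolding measure_support_def by blast
      then show False using outside by simp
    qed
  qed
  have "open (- measure_support L)"
  proof -
    have "- measure_support L = \<Union>{U. open U \<and> emeasure L U = 0}" by (auto simp: measure_support_def)
    then show ?thesis by auto
  qed
  then have "closed (measure_support L)" by (simp add: closed_def)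
  then have comp: "compact (measure_support L)"
    using supp_sub compact_eq_bounded_closed bounded_subset[OF bounded_cball] by blast
  have "\<exists>\<rho>>0. emeasure L (ball z0 \<rho>) = 0" if z0: "z0 \<in> G" for z0
  proof -
    obtain \<rho> where \<rho>: "\<rho> > 0" "\<forall>f. continuous_on UNIV f \<longrightarrow> (\<forall>z. z \<notin> ball z0 \<rho> \<longrightarrow> f z = 0) \<longrightarrow> (\<lambda>n. \<Sum>x\<in>Z n. w n x * f x) \<longlonglongrightarrow> 0"
      using weighted_sums_vanish[OF z0] by blast
    define f where "f x = max 0 (\<rho> - dist z0 x)" for x
    have f: "continuous_on UNIV f" unfolding f_def[abs_def] by (intro continuous_intros)
    have fb: "bounded (range f)" using \<rho>(1) by (intro boundedI[where B = \<rho>]) (auto simp: f_def)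
    have "f z = 0" if "z \<notin> ball z0 \<rho>" for z using that by (simp add: f_def)
    then have "(\<lambda>n. \<Sum>x\<in>Z n. w n x * f x) \<longlonglongrightarrow> 0" using \<rho>(2) f by blast
    then have "(\<integral>x. f x \<partial>L) = 0" using lim[OF f fb] LIMSEQ_unique by blast
    then have "emeasure L {x. f x > 0} = 0" by (intro null_where_positive[OF L f fb]) (auto simp: f_def)
    moreover have "{x. f x > 0} = ball z0 \<rho>" by (auto simp: f_def max_def)
    ultimately show ?thesis using \<rho>(1) by auto
  qed
  then obtain \<rho> where \<rho>: "\<And>z. z \<in> G \<Longrightarrow> \<rho> z > 0" "\<And>z. z \<in> G \<Longrightarrow> emeasure L (ball z (\<rho> z)) = 0" by metis
  \<comment> \<open>The null balls are indexed by all points of \<open>G\<close>; Lindelof's theorem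
    leaves countably many with the same union.\<close>
  obtain F' where F': "F' \<subseteq> (\<lambda>z. ball z (\<rho> z)) ` G" "countable F'" "\<Union>F' = (\<Union>z\<in>G. ball z (\<rho> z))"
    using Lindelof[of "(\<lambda>z. ball z (\<rho> z)) ` G"] by auto
  have "(\<Union>U\<in>F'. U) \<in> null_sets L"
  proof (rule null_sets_UN'[OF F'(2)])
    fix U assume "U \<in> F'"
    then obtain z where "z \<in> G" "U = ball z (\<rho> z)" using F'(1) by blast
    then show "U \<in> null_sets L" using \<rho>(2) sL by (simp add: null_sets_def)
  qed
  moreover have "G \<subseteq> (\<Union>U\<in>F'. U)" using F'(3) \<rho>(1) by auto
  ultimately have GL: "emeasure L G = 0"
    using G sL by (metis borel_open null_setsD1 null_sets_subset)
  have "- G \<in> null_sets lebesgue" using negl by (simp add: negligible_iff_null_sets)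
  moreover have "- G \<in> sets lborel" using G by simp
  ultimately have "emeasure lborel (- G) = 0" by (simp add: null_sets_completion_iff null_setsD1)
  \<comment> \<open>The separating set is \<open>G\<close> itself: null for \<open>L\<close>, with a
    complement that is null for Lebesgue measure.\<close>
  then have "mutually_singular L lborel"
    unfolding mutually_singular_def using GL G sL by (intro conjI bexI[of _ G]) (auto simp: Compl_eq_Diff_UNIV)
  then show ?thesis using L lim comp by blast
qed

end

section \<open>The exceptional set\<close>

text \<open>Near each point g is biholomorphic onto an open set, so the set is locally contained in
  the image of a subset of the unit circle under a differentiable inverse.\<close>

lemma negligible_unit_modulus_set:
  assumes g: "g holomorphic_on S" and S: "open S" and d: "\<And>z. z \<in> S \<Longrightarrow> deriv g z \<noteq> 0"
  shows "negligible {z \<in> S. cmod (g z) = 1}" (is "negligible ?T")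
proof (subst locally_negligible_alt, rule ballI)
  fix z1 assume z1: "z1 \<in> ?T"
  obtain \<rho> where \<rho>: "\<rho> > 0" "ball z1 \<rho> \<subseteq> S" "inj_on g (ball z1 \<rho>)"
    using has_complex_derivative_locally_injective[OF g _ S d, of z1] z1 by blast
  obtain h where h: "h holomorphic_on (g ` ball z1 \<rho>)" "\<And>z. z \<in> ball z1 \<rho> \<Longrightarrow> h (g z) = z"
    using holomorphic_has_inverse[OF holomorphic_on_subset[OF g \<rho>(2)] open_ball \<rho>(3)] by metis
  have op: "open (g ` ball z1 \<rho>)"
    by (rule open_mapping_thm3[OF holomorphic_on_subset[OF g \<rho>(2)] open_ball \<rho>(3)])
  have "negligible (h ` (sphere 0 1 \<inter> g ` ball z1 \<rho>))"
  proof (rule negligible_differentiable_image_negligible)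
    show "negligible (sphere 0 1 \<inter> g ` ball z1 \<rho>)"
      by (rule negligible_subset[OF negligible_sphere[of 0 1]]) simp
    have "h differentiable_on g ` ball z1 \<rho>"
      using h(1) op by (auto simp: differentiable_on_def holomorphic_on_def field_differentiable_imp_differentiable)
    then show "h differentiable_on sphere 0 1 \<inter> g ` ball z1 \<rho>" by (rule differentiable_on_subset) simp
  qed simp
  moreover have "?T \<inter> ball z1 \<rho> \<subseteq> h ` (sphere 0 1 \<inter> g ` ball z1 \<rho>)"
  proof
    fix z assume z: "z \<in> ?T \<inter> ball z1 \<rho>"
    then have "h (g z) \<in> h ` (sphere 0 1 \<inter> g ` ball z1 \<rho>)" by (intro imageI) auto
    then show "z \<in> h ` (sphere 0 1 \<inter> g ` ball z1 \<rho>)" using h(2) z by simp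
  qed
  ultimately have "negligible (?T \<inter> ball z1 \<rho>)" by (rule negligible_subset)
  moreover have "openin (top_of_set ?T) (?T \<inter> ball z1 \<rho>)" by (rule openin_open_Int) simp
  ultimately show "\<exists>U. openin (top_of_set ?T) U \<and> z1 \<in> U \<and> negligible U"
    using z1 \<rho>(1) by (intro exI[of _ "?T \<inter> ball z1 \<rho>"]) auto
qed

lemma card_roots_of_separable:
  fixes p :: "complex poly"
  assumes "p \<noteq> 0" "\<And>y. poly p y = 0 \<Longrightarrow> poly (pderiv p) y \<noteq> 0"
  shows "card {y. poly p y = 0} = degree p"
proof -
  have "rsquarefree p" using assms by (simp add: rsquarefree_roots)
  then have "degree p = degree (smult (lead_coeff p) (\<Prod>z|poly p z = 0. [:-z, 1:]))"
    by (simp only: complex_poly_decompose_rsquarefree)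
  also have "\<dots> = degree (\<Prod>z|poly p z = 0. [:-z, 1:])" using assms(1) by simp
  also have "\<dots> = (\<Sum>z|poly p z = 0. degree [:-z, 1:])" by (rule degree_prod_eq_sum_degree) simp
  also have "\<dots> = card {y. poly p y = 0}" by simp
  finally show ?thesis ..
qed

section \<open>Local branches of saddle points\<close>

context heat_power
begin

text \<open>Distinct moduli of \<open>F\<close> force the branches to be distinct, so they form
  \<open>nodes\<close> at every point of the ball. Demanding this on a ball makes the set
  open.\<close>

definition good :: "complex set" where
  "good = {z0. \<exists>\<epsilon>>0. \<exists>Y. (\<forall>i\<le>d. Y i holomorphic_on ball z0 \<epsilon>) \<and>
     (\<forall>z\<in>ball z0 \<epsilon>. (\<forall>i\<le>d. poly (saddle z) (Y i z) = 0) \<and>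
       (\<forall>i\<le>d. \<forall>j\<le>d. i \<noteq> j \<longrightarrow> cmod (F z (Y i z)) \<noteq> cmod (F z (Y j z))))}"

lemma open_good: "open good"
  unfolding open_contains_ball
proof
  fix z0 assume "z0 \<in> good"
  then obtain \<epsilon> Y where e: "\<epsilon> > 0" and hol: "\<forall>i\<le>d. Y i holomorphic_on ball z0 \<epsilon>" and
     Y: "\<forall>z\<in>ball z0 \<epsilon>. (\<forall>i\<le>d. poly (saddle z) (Y i z) = 0) \<and>
       (\<forall>i\<le>d. \<forall>j\<le>d. i \<noteq> j \<longrightarrow> cmod (F z (Y i z)) \<noteq> cmod (F z (Y j z)))"
    unfolding good_def by blast
  have "ball z0 \<epsilon> \<subseteq> good"
  proof
    fix z1 assume "z1 \<in> ball z0 \<epsilon>"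
    then obtain \<delta> where \<delta>: "\<delta> > 0" "ball z1 \<delta> \<subseteq> ball z0 \<epsilon>" using open_ball[of z0 \<epsilon>] unfolding open_contains_ball by blast
    show "z1 \<in> good" unfolding good_def using \<delta> hol Y
      by (intro CollectI exI[of _ \<delta>] conjI exI[of _ Y]) (auto intro: holomorphic_on_subset)
  qed
  then show "\<exists>e>0. ball z0 e \<subseteq> good" using e by blast
qed

lemma holomorphic_F:
  assumes "Y holomorphic_on S"
  shows "(\<lambda>z. F z (Y z)) holomorphic_on S"
proof -
  have "(\<lambda>z. poly P (Y z)) holomorphic_on S"
    using holomorphic_on_compose[OF assms, of "poly P"] poly_holomorphic_on by (simp add: o_def)
  then show ?thesis unfolding F_def using assms t by (intro holomorphic_intros) auto
qed

text \<open>\<open>point_asymptotics\<close> supplies a dominating branch \<open>I z\<close> at each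
  z separately. The rate \<open>U z\<close> of \<open>V\<close> equals ln |F| on that branch and is
  continuous at z0 by \<open>V_lipschitz\<close>, whereas all other branches have a different value
  of ln |F|. Hence \<open>I\<close> is constant near z0, and the limit there is the holomorphic
  function Y (I z0) z - z.\<close>

theorem good_local_limit:
  assumes "z0 \<in> good"
  shows "\<exists>\<epsilon>>0. \<exists>M. M holomorphic_on ball z0 \<epsilon> \<and>
    (\<forall>z\<in>ball z0 \<epsilon>. (\<lambda>n. ev n 0 z [:-z, 1:] / ev n 0 z 1) \<longlonglongrightarrow> M z \<and> (\<forall>\<^sub>F n in sequentially. ev n 0 z 1 \<noteq> 0))"
proof -
  obtain \<epsilon> Y where e: "\<epsilon> > 0" and hol: "\<forall>i\<le>d. Y i holomorphic_on ball z0 \<epsilon>" and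
     Y: "\<forall>z\<in>ball z0 \<epsilon>. (\<forall>i\<le>d. poly (saddle z) (Y i z) = 0) \<and>
       (\<forall>i\<le>d. \<forall>j\<le>d. i \<noteq> j \<longrightarrow> cmod (F z (Y i z)) \<noteq> cmod (F z (Y j z)))"
    using assms unfolding good_def by blast
  have "\<exists>i\<le>d. (\<lambda>n. ln (V n 0 z) / real n) \<longlonglongrightarrow> ln (cmod (F z (Y i z))) \<and>
     (\<lambda>n. ev n 0 z [:-z, 1:] / ev n 0 z 1) \<longlonglongrightarrow> Y i z - z \<and> (\<forall>\<^sub>F n in sequentially. ev n 0 z 1 \<noteq> 0)" if z: "z \<in> ball z0 \<epsilon>" for z
  proof (rule point_asymptotics[where y = "\<lambda>i. Y i z"])
    have "inj_on (\<lambda>i. Y i z) {..d}"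
    proof (rule inj_onI)
      fix i j assume "i \<in> {..d}" "j \<in> {..d}" "Y i z = Y j z"
      then show "i = j" using Y z by (metis atMost_iff)
    qed
    then show "nodes z (\<lambda>i. Y i z)" using Y z by (simp add: nodes_def)
    show "cmod (F z (Y i z)) \<noteq> cmod (F z (Y j z))" if "i \<le> d" "j \<le> d" "i \<noteq> j" for i j
      using Y z that by blast
  qed
  then have "\<forall>z\<in>ball z0 \<epsilon>. \<exists>i. i \<le> d \<and> (\<lambda>n. ln (V n 0 z) / real n) \<longlonglongrightarrow> ln (cmod (F z (Y i z))) \<and>
     (\<lambda>n. ev n 0 z [:-z, 1:] / ev n 0 z 1) \<longlonglongrightarrow> Y i z - z \<and> (\<forall>\<^sub>F n in sequentially. ev n 0 z 1 \<noteq> 0)" by blast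
  from bchoice[OF this] obtain I where I': "\<forall>z\<in>ball z0 \<epsilon>. I z \<le> d \<and> (\<lambda>n. ln (V n 0 z) / real n) \<longlonglongrightarrow> ln (cmod (F z (Y (I z) z))) \<and>
     (\<lambda>n. ev n 0 z [:-z, 1:] / ev n 0 z 1) \<longlonglongrightarrow> Y (I z) z - z \<and> (\<forall>\<^sub>F n in sequentially. ev n 0 z 1 \<noteq> 0)" by (elim exE)
  have I: "I z \<le> d" "(\<lambda>n. ln (V n 0 z) / real n) \<longlonglongrightarrow> ln (cmod (F z (Y (I z) z)))"
     "(\<lambda>n. ev n 0 z [:-z, 1:] / ev n 0 z 1) \<longlonglongrightarrow> Y (I z) z - z" "\<forall>\<^sub>F n in sequentially. ev n 0 z 1 \<noteq> 0" if "z \<in> ball z0 \<epsilon>" for z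
    using bspec[OF I' that, THEN conjunct1] bspec[OF I' that, THEN conjunct2, THEN conjunct1]
      bspec[OF I' that, THEN conjunct2, THEN conjunct2, THEN conjunct1]
      bspec[OF I' that, THEN conjunct2, THEN conjunct2, THEN conjunct2] .
  define U where "U z = ln (cmod (F z (Y (I z) z)))" for z
  define \<rho> where "\<rho> = cmod z0 + \<epsilon>"
  have in_\<rho>: "cmod z \<le> \<rho>" if "z \<in> ball z0 \<epsilon>" for z
    using that norm_triangle_ineq2[of z z0] by (simp add: \<rho>_def dist_norm norm_minus_commute)
  from V_lipschitz[of \<rho>] obtain C where C: "C \<ge> 0" "\<forall>n z w. n \<ge> 1 \<longrightarrow> cmod z \<le> \<rho> \<longrightarrow> cmod w \<le> \<rho> \<longrightarrow> V n 0 w \<le> exp (real n * C * cmod (w - z)) * V n 0 z"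
    by blast
  have U_le: "U w \<le> C * cmod (w - z) + U z" if z: "z \<in> ball z0 \<epsilon>" and w: "w \<in> ball z0 \<epsilon>" for z w
  proof (rule LIMSEQ_le)
    show "(\<lambda>n. ln (V n 0 w) / real n) \<longlonglongrightarrow> U w" unfolding U_def by (rule I(2)[OF w])
    show "(\<lambda>n. C * cmod (w - z) + ln (V n 0 z) / real n) \<longlonglongrightarrow> C * cmod (w - z) + U z"
      unfolding U_def by (intro tendsto_add tendsto_const I(2)[OF z])
    show "\<exists>N. \<forall>n\<ge>N. ln (V n 0 w) / real n \<le> C * cmod (w - z) + ln (V n 0 z) / real n"
    proof (intro exI[of _ 1] allI impI)
      fix n :: nat assume n: "1 \<le> n"
      have V: "V n 0 z > 0" "V n 0 w > 0" using V_pos[OF n] by auto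
      have "ln (V n 0 w) \<le> ln (exp (real n * C * cmod (w - z)) * V n 0 z)"
        using C(2) n in_\<rho>[OF z] in_\<rho>[OF w] V by (subst ln_le_cancel_iff) auto
      also have "\<dots> = real n * (C * cmod (w - z)) + ln (V n 0 z)" using V by (subst ln_mult_pos) auto
      finally have "ln (V n 0 w) / real n \<le> (real n * (C * cmod (w - z)) + ln (V n 0 z)) / real n"
        by (intro divide_right_mono) auto
      then show "ln (V n 0 w) / real n \<le> C * cmod (w - z) + ln (V n 0 z) / real n"
        using n by (simp add: add_divide_distrib)
    qed
  qed
  have z0_in: "z0 \<in> ball z0 \<epsilon>" using e by simp
  have near: "\<forall>\<^sub>F z in nhds z0. z \<in> ball z0 \<epsilon>" using z0_in by (intro eventually_nhds_in_open) auto
  have U_cont: "(U \<longlongrightarrow> U z0) (nhds z0)"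
  proof (rule Lim_null_comparison[where f = "\<lambda>z. U z - U z0" and g = "\<lambda>z. C * cmod (z - z0)", THEN LIM_zero_cancel])
    show "\<forall>\<^sub>F z in nhds z0. norm (U z - U z0) \<le> C * cmod (z - z0)"
      using near
    proof eventually_elim
      case (elim z)
      then show ?case using U_le[OF elim z0_in] U_le[OF z0_in elim] by (simp add: norm_minus_commute abs_le_iff)
    qed
    have "((\<lambda>z. C * cmod (z - z0)) \<longlongrightarrow> C * cmod (z0 - z0)) (nhds z0)"
      by (intro tendsto_intros filterlim_ident)
    then show "((\<lambda>z. C * cmod (z - z0)) \<longlongrightarrow> 0) (nhds z0)" by simp
  qed
  \<comment> \<open>The values differ at z0, and both sides are continuous there, so they differ
    nearby.\<close>
  have "\<forall>\<^sub>F z in nhds z0. ln (cmod (F z (Y j z))) \<noteq> U z" if j: "j \<le> d" "j \<noteq> I z0" for j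
  proof -
    have nz: "F z (Y j z) \<noteq> 0" if "z \<in> ball z0 \<epsilon>" for z using F_nonzero Y that j(1) by blast
    have "continuous_on (ball z0 \<epsilon>) (\<lambda>z. F z (Y j z))"
      using holomorphic_F hol j(1) by (intro holomorphic_on_imp_continuous_on) auto
    then have "isCont (\<lambda>z. F z (Y j z)) z0" using z0_in by (simp add: continuous_on_eq_continuous_at)
    then have "((\<lambda>z. F z (Y j z)) \<longlongrightarrow> F z0 (Y j z0)) (nhds z0)" by (simp add: tendsto_nhds_iff isCont_def)
    then have "((\<lambda>z. ln (cmod (F z (Y j z))) - U z) \<longlongrightarrow> ln (cmod (F z0 (Y j z0))) - U z0) (nhds z0)"
      using nz[OF z0_in] by (intro tendsto_diff tendsto_ln tendsto_norm U_cont) auto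
    moreover have "ln (cmod (F z0 (Y j z0))) - U z0 \<noteq> 0"
    proof -
      have "cmod (F z0 (Y j z0)) \<noteq> cmod (F z0 (Y (I z0) z0))" using Y z0_in j I(1)[OF z0_in] by blast
      moreover have "F z0 (Y j z0) \<noteq> 0" "F z0 (Y (I z0) z0) \<noteq> 0" using F_nonzero Y z0_in j I(1)[OF z0_in] by blast+
      ultimately show ?thesis by (simp add: U_def)
    qed
    ultimately have "\<forall>\<^sub>F z in nhds z0. ln (cmod (F z (Y j z))) - U z \<noteq> 0" by (rule tendsto_imp_eventually_ne)
    then show ?thesis by eventually_elim simp
  qed
  then have "\<forall>\<^sub>F z in nhds z0. \<forall>j\<in>{..d} - {I z0}. ln (cmod (F z (Y j z))) \<noteq> U z"
    by (intro eventually_ball_finite) auto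
  with near have "\<forall>\<^sub>F z in nhds z0. z \<in> ball z0 \<epsilon> \<and> I z = I z0"
  proof eventually_elim
    case (elim z)
    then have "I z \<in> {..d}" using I(1) by simp
    then show ?case using elim by (auto simp: U_def)
  qed
  then obtain \<delta> where \<delta>: "\<delta> > 0" "\<And>z. dist z z0 < \<delta> \<Longrightarrow> z \<in> ball z0 \<epsilon> \<and> I z = I z0"
    unfolding eventually_nhds_metric by blast
  show ?thesis
  proof (intro exI[of _ \<delta>] conjI exI[of _ "\<lambda>z. Y (I z0) z - z"] ballI conjI)
    have "ball z0 \<delta> \<subseteq> ball z0 \<epsilon>" using \<delta>(2) by (auto simp: dist_commute)
    then have "Y (I z0) holomorphic_on ball z0 \<delta>" using hol I(1)[OF z0_in] by (blast intro: holomorphic_on_subset)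
    then show "(\<lambda>z. Y (I z0) z - z) holomorphic_on ball z0 \<delta>" by (intro holomorphic_intros)
    show "(\<lambda>n. ev n 0 z [:-z, 1:] / ev n 0 z 1) \<longlonglongrightarrow> Y (I z0) z - z" if "z \<in> ball z0 \<delta>" for z
      using I(3)[of z] \<delta>(2)[of z] that by (auto simp: dist_commute)
    show "\<forall>\<^sub>F n in sequentially. ev n 0 z 1 \<noteq> 0" if "z \<in> ball z0 \<delta>" for z
      using I(4)[of z] \<delta>(2)[of z] that by (auto simp: dist_commute)
  qed (rule \<delta>(1))
qed

text \<open>The saddle equation solved for z: the saddle points belonging to z are the preimages of
  z off the zeros of \<open>q\<close>, and their local branches are local inverses of this
  map.\<close>

definition \<phi> :: "complex \<Rightarrow> complex" where
  "\<phi> y = y + t * poly r y / (of_nat a * poly q y)"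

text \<open>The numerator of \<open>\<phi>'\<close>; its zeros are the double saddle points.\<close>

definition crit :: "complex poly" where
  "crit = smult (of_nat a) (q * q) + smult t (pderiv r * q - r * pderiv q)"

lemma saddle_zero_iff: "poly (saddle z) y = 0 \<longleftrightarrow> poly q y \<noteq> 0 \<and> \<phi> y = z"
proof (cases "poly q y = 0")
  case True
  then show ?thesis using coprime[OF True] t by (simp add: poly_saddle)
next
  case False
  then show ?thesis using a by (auto simp: poly_saddle \<phi>_def field_simps)
qed

lemma crit_nonzero: "crit \<noteq> 0"
proof
  assume 0: "crit = 0"
  have d1: "d \<ge> 1" using deg_r by simp
  have "degree (smult t (pderiv r * q - r * pderiv q)) < 2 * d"
  proof -
    have "degree (pderiv r * q) < 2 * d"
      by (rule le_less_trans[OF degree_mult_le]) (use deg_r deg_q in \<open>simp add: degree_pderiv\<close>)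
    moreover have "degree (r * pderiv q) < 2 * d"
      by (rule le_less_trans[OF degree_mult_le]) (use deg_r deg_q in \<open>simp add: degree_pderiv\<close>)
    ultimately have "degree (pderiv r * q - r * pderiv q) < 2 * d" by (rule degree_diff_less)
    then show ?thesis using t by simp
  qed
  then have "coeff (smult t (pderiv r * q - r * pderiv q)) (2 * d) = 0" by (rule coeff_eq_0)
  then have "coeff crit (2 * d) = of_nat a * coeff (q * q) (2 * d)"
    unfolding crit_def coeff_add by (simp only: coeff_smult) simp
  also have "coeff (q * q) (2 * d) = 1"
    using coeff_mult_degree_sum[of q q] lead_q deg_q by (simp add: mult_2)
  finally show False using 0 a by simp
qed

lemma deriv_\<phi>:
  assumes "poly q y \<noteq> 0"
  shows "(\<phi> has_field_derivative poly crit y / (of_nat a * poly q y ^ 2)) (at y)"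
proof -
  have "(\<phi> has_field_derivative 1 + ((t * poly (pderiv r) y) * (of_nat a * poly q y) - (t * poly r y) * (of_nat a * poly (pderiv q) y)) / (of_nat a * poly q y * (of_nat a * poly q y))) (at y)"
    unfolding \<phi>_def[abs_def] using assms a by (auto intro!: derivative_eq_intros)
  also have "1 + ((t * poly (pderiv r) y) * (of_nat a * poly q y) - (t * poly r y) * (of_nat a * poly (pderiv q) y)) / (of_nat a * poly q y * (of_nat a * poly q y)) = poly crit y / (of_nat a * poly q y ^ 2)"
    using assms a by (simp add: crit_def divide_simps) (simp add: algebra_simps power2_eq_square)
  finally show ?thesis .
qed

lemma local_inverse:
  assumes y: "poly (saddle z0) y0 = 0" "poly crit y0 \<noteq> 0"
  shows "\<exists>\<epsilon>>0. \<exists>Y. Y holomorphic_on ball z0 \<epsilon> \<and> Y z0 = y0 \<and> (\<forall>z\<in>ball z0 \<epsilon>. poly (saddle z) (Y z) = 0)"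
proof -
  define S where "S = {y. poly q y \<noteq> 0}"
  have S: "open S"
  proof -
    have "S = - {y. poly q y = 0}" by (auto simp: S_def)
    moreover have "closed {y. poly q y = 0}" by (intro finite_imp_closed poly_roots_finite q_nz)
    ultimately show ?thesis by (simp add: open_Compl)
  qed
  have hol: "\<phi> holomorphic_on S"
    unfolding holomorphic_on_open[OF S] using deriv_\<phi> by (auto simp: S_def)
  have y0: "y0 \<in> S" "\<phi> y0 = z0" using y(1) by (auto simp: saddle_zero_iff S_def)
  have "deriv \<phi> y0 = poly crit y0 / (of_nat a * poly q y0 ^ 2)"
    using deriv_\<phi> y0(1) by (intro DERIV_imp_deriv) (auto simp: S_def)
  then have dn: "deriv \<phi> y0 \<noteq> 0" using y(2) y0(1) a by (simp add: S_def)
  obtain \<rho> where \<rho>: "\<rho> > 0" "ball y0 \<rho> \<subseteq> S" "open (\<phi> ` ball y0 \<rho>)" "inj_on \<phi> (ball y0 \<rho>)"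
    using has_complex_derivative_locally_invertible[OF hol y0(1) S dn] by blast
  obtain Y where Y: "Y holomorphic_on (\<phi> ` ball y0 \<rho>)" "\<And>y. y \<in> ball y0 \<rho> \<Longrightarrow> Y (\<phi> y) = y"
    using holomorphic_has_inverse[OF holomorphic_on_subset[OF hol \<rho>(2)] open_ball \<rho>(4)] by metis
  have "z0 \<in> \<phi> ` ball y0 \<rho>" using y0(2) \<rho>(1) by (intro image_eqI[of _ _ y0]) auto
  then obtain \<epsilon> where \<epsilon>: "\<epsilon> > 0" "ball z0 \<epsilon> \<subseteq> \<phi> ` ball y0 \<rho>" using \<rho>(3) open_contains_ball by blast
  show ?thesis
  proof (intro exI[of _ \<epsilon>] conjI exI[of _ Y] ballI)
    show "Y holomorphic_on ball z0 \<epsilon>" using Y(1) \<epsilon>(2) by (rule holomorphic_on_subset)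
    show "Y z0 = y0" using Y(2)[of y0] \<rho>(1) y0(2) by simp
    fix z assume "z \<in> ball z0 \<epsilon>"
    then obtain y where y: "y \<in> ball y0 \<rho>" "z = \<phi> y" using \<epsilon>(2) by blast
    then show "poly (saddle z) (Y z) = 0" using Y(2)[of y] \<rho>(2) by (auto simp: saddle_zero_iff S_def)
  qed (rule \<epsilon>(1))
qed

text \<open>At a saddle point the derivative of \<open>F\<close> in y vanishes, so the derivative of
  the branch drops out and only the dependence on the explicit z remains.\<close>

lemma deriv_F:
  assumes S: "open S" "Y holomorphic_on S" "\<And>z. z \<in> S \<Longrightarrow> poly (saddle z) (Y z) = 0" and z: "z \<in> S"
  shows "((\<lambda>z. F z (Y z)) has_field_derivative - (of_nat a / t) * (Y z - z) * F z (Y z)) (at z)"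
proof -
  obtain Y' where Y': "(Y has_field_derivative Y') (at z)" using S(2) z unfolding holomorphic_on_open[OF S(1)] by blast
  have q: "poly q (Y z) \<noteq> 0" using S(3)[OF z] by (simp add: saddle_zero_iff)
  have "poly q (Y z) * poly (pderiv P) (Y z) = poly r (Y z) * poly P (Y z)"
    using log_deriv by (metis poly_mult)
  moreover have "poly r (Y z) = - (of_nat a / t) * (Y z - z) * poly q (Y z)"
    using S(3)[OF z] t by (simp add: poly_saddle field_simps eq_neg_iff_add_eq_0)
  ultimately have "poly q (Y z) * poly (pderiv P) (Y z) = poly q (Y z) * (- (of_nat a / t) * (Y z - z) * poly P (Y z))"
    by (simp only: mult_ac)
  then have dP: "poly (pderiv P) (Y z) = - (of_nat a / t) * (Y z - z) * poly P (Y z)"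
    by (rule mult_left_cancel[OF q, THEN iffD1])
  have "((\<lambda>z. F z (Y z)) has_field_derivative
     poly (pderiv P) (Y z) * Y' * exp (of_nat a * (Y z - z) ^ 2 / (2 * t)) +
     poly P (Y z) * (exp (of_nat a * (Y z - z) ^ 2 / (2 * t)) * (of_nat a / t * (Y z - z) * (Y' - 1)))) (at z)"
    unfolding F_def using Y' t by (auto intro!: derivative_eq_intros simp: field_simps power2_eq_square)
  also have "poly (pderiv P) (Y z) * Y' * exp (of_nat a * (Y z - z) ^ 2 / (2 * t)) +
     poly P (Y z) * (exp (of_nat a * (Y z - z) ^ 2 / (2 * t)) * (of_nat a / t * (Y z - z) * (Y' - 1)))
     = - (of_nat a / t) * (Y z - z) * F z (Y z)"
  proof -
    have "(- k * u * p) * y * e + p * (e * (k * u * (y - 1))) = - k * u * (p * e)" for k u p y e :: complex by algebra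
    then show ?thesis unfolding dP F_def .
  qed
  finally show ?thesis .
qed

text \<open>A multiple root of \<open>saddle z0\<close> would be a zero of \<open>crit\<close>.
  Otherwise there are d + 1 simple roots; each extends through a local inverse of
  \<open>\<phi>\<close>, and they stay distinct by continuity.\<close>

lemma noncritical_local_roots:
  assumes "z0 \<notin> \<phi> ` {y. poly crit y = 0}"
  shows "\<exists>\<epsilon>>0. \<exists>Y. (\<forall>i\<le>d. Y i holomorphic_on ball z0 \<epsilon>) \<and> (\<forall>z\<in>ball z0 \<epsilon>. (\<forall>i\<le>d. poly (saddle z) (Y i z) = 0) \<and>
     (\<forall>i\<le>d. \<forall>j\<le>d. i \<noteq> j \<longrightarrow> Y i z \<noteq> Y j z))"
proof -
  have sad_nz: "saddle z0 \<noteq> 0" using degree_saddle[of z0] by auto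
  have crit_nz: "poly crit y \<noteq> 0" if "poly (saddle z0) y = 0" for y
    using assms that by (auto simp: saddle_zero_iff)
  have "poly (pderiv (saddle z0)) y \<noteq> 0" if y: "poly (saddle z0) y = 0" for y
  proof
    assume 0: "poly (pderiv (saddle z0)) y = 0"
    have "pderiv (saddle z0) = smult t (pderiv r) + smult (of_nat a) ([:-z0, 1:] * pderiv q + q)"
      unfolding saddle_def pderiv_add pderiv_smult by (subst pderiv_mult) (simp add: pderiv_pCons)
    then have e1: "t * poly (pderiv r) y + of_nat a * ((y - z0) * poly (pderiv q) y + poly q y) = 0"
      using 0 by (simp only: poly_add poly_smult poly_mult) (simp add: algebra_simps)
    have e2: "t * poly r y + of_nat a * (y - z0) * poly q y = 0" using y by (simp add: poly_saddle)
    have "poly crit y = of_nat a * poly q y * poly q y + t * (poly (pderiv r) y * poly q y - poly r y * poly (pderiv q) y)"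
      by (simp add: crit_def)
    \<comment> \<open>Eliminating y - z0: \<open>poly q y\<close> times the first equation minus
      \<open>poly (pderiv q) y\<close> times the second.\<close>
    also have "\<dots> = 0" using e1 e2 by algebra
    finally show False using crit_nz[OF y] by simp
  qed
  then have card: "card {y. poly (saddle z0) y = 0} = Suc d"
    using card_roots_of_separable[OF sad_nz] degree_saddle by simp
  have "finite {y. poly (saddle z0) y = 0}" by (rule poly_roots_finite[OF sad_nz])
  then obtain y where "bij_betw y {0..<Suc d} {y. poly (saddle z0) y = 0}"
    using ex_bij_betw_nat_finite card by metis
  then have y: "inj_on y {..d}" "\<And>i. i \<le> d \<Longrightarrow> poly (saddle z0) (y i) = 0"
    by (auto simp: bij_betw_def atLeast0LessThan lessThan_Suc_atMost)
  have "\<exists>\<epsilon> Y. i \<le> d \<longrightarrow> \<epsilon> > 0 \<and> Y holomorphic_on ball z0 \<epsilon> \<and> Y z0 = y i \<and> (\<forall>z\<in>ball z0 \<epsilon>. poly (saddle z) (Y z) = 0)" for i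
    using local_inverse[OF y(2) crit_nz[OF y(2)], of i] by blast
  then obtain E Y where EY: "\<And>i. i \<le> d \<Longrightarrow> E i > 0" "\<And>i. i \<le> d \<Longrightarrow> Y i holomorphic_on ball z0 (E i)"
    "\<And>i. i \<le> d \<Longrightarrow> Y i z0 = y i" "\<And>i z. i \<le> d \<Longrightarrow> z \<in> ball z0 (E i) \<Longrightarrow> poly (saddle z) (Y i z) = 0"
    by metis
  have lim: "(Y i \<longlongrightarrow> y i) (nhds z0)" if "i \<le> d" for i
  proof -
    have "isCont (Y i) z0" using holomorphic_on_imp_continuous_on[OF EY(2)[OF that]] EY(1)[OF that]
      by (simp add: continuous_on_eq_continuous_at)
    then show ?thesis using EY(3)[OF that] by (simp add: isCont_def tendsto_nhds_iff)
  qed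
  have "\<forall>\<^sub>F z in nhds z0. Y i z \<noteq> Y j z" if "i \<le> d" "j \<le> d" "i \<noteq> j" for i j
  proof -
    have "((\<lambda>z. Y i z - Y j z) \<longlongrightarrow> y i - y j) (nhds z0)" using lim that by (intro tendsto_diff) auto
    moreover have "y i - y j \<noteq> 0" using inj_onD[OF y(1), of i j] that by auto
    ultimately have "\<forall>\<^sub>F z in nhds z0. Y i z - Y j z \<noteq> 0" by (rule tendsto_imp_eventually_ne)
    then show ?thesis by eventually_elim simp
  qed
  then have "\<forall>\<^sub>F z in nhds z0. \<forall>i\<in>{..d}. \<forall>j\<in>{..d}-{i}. Y i z \<noteq> Y j z"
    by (intro eventually_ball_finite ballI) auto
  moreover have "\<forall>\<^sub>F z in nhds z0. \<forall>i\<in>{..d}. z \<in> ball z0 (E i)"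
    using EY(1) by (intro eventually_ball_finite ballI eventually_nhds_in_open) auto
  ultimately have "\<forall>\<^sub>F z in nhds z0. (\<forall>i\<in>{..d}. \<forall>j\<in>{..d}-{i}. Y i z \<noteq> Y j z) \<and> (\<forall>i\<in>{..d}. z \<in> ball z0 (E i))"
    by (rule eventually_conj)
  then obtain \<epsilon> where \<epsilon>: "\<epsilon> > 0" "\<And>z. dist z z0 < \<epsilon> \<Longrightarrow> (\<forall>i\<in>{..d}. \<forall>j\<in>{..d}-{i}. Y i z \<noteq> Y j z) \<and> (\<forall>i\<in>{..d}. z \<in> ball z0 (E i))"
    unfolding eventually_nhds_metric by blast
  show ?thesis
  proof (intro exI[of _ \<epsilon>] conjI exI[of _ Y] allI impI ballI)
    fix i assume i: "i \<le> d"
    have "ball z0 \<epsilon> \<subseteq> ball z0 (E i)" using \<epsilon>(2) i by (auto simp: dist_commute)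
    then show "Y i holomorphic_on ball z0 \<epsilon>" using EY(2)[OF i] by (blast intro: holomorphic_on_subset)
  next
    fix z i assume z: "z \<in> ball z0 \<epsilon>" and i: "i \<le> d"
    then have "z \<in> ball z0 (E i)" using \<epsilon>(2)[of z] by (simp add: dist_commute)
    then show "poly (saddle z) (Y i z) = 0" by (rule EY(4)[OF i])
  next
    fix z i j assume "z \<in> ball z0 \<epsilon>" "i \<le> d" "j \<le> d" "i \<noteq> j"
    then show "Y i z \<noteq> Y j z" using \<epsilon>(2)[of z] by (simp add: dist_commute)
  qed (rule \<epsilon>(1))
qed

text \<open>Apart from the finitely many values of \<open>\<phi>\<close> at zeros of
  \<open>crit\<close>, distinct branches exist locally, and a nearby point can fail to be good only
  if two of them have equal |F|. By \<open>deriv_F\<close> the quotient of the two values has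
  logarithmic derivative (a/t) times the difference of the branches, which is nonzero, so
  \<open>negligible_unit_modulus_set\<close> applies.\<close>

theorem negligible_not_good: "negligible (- good)"
proof -
  let ?C = "\<phi> ` {y. poly crit y = 0}"
  have "finite ?C" by (intro finite_imageI poly_roots_finite crit_nonzero)
  then have negC: "negligible ?C" by (rule negligible_finite)
  have "negligible (- good - ?C)"
  proof (subst locally_negligible_alt, rule ballI)
    fix z0 assume z0: "z0 \<in> - good - ?C"
    then obtain \<epsilon> Y where e: "\<epsilon> > 0" and hol: "\<forall>i\<le>d. Y i holomorphic_on ball z0 \<epsilon>"
      and Y: "\<forall>z\<in>ball z0 \<epsilon>. (\<forall>i\<le>d. poly (saddle z) (Y i z) = 0) \<and> (\<forall>i\<le>d. \<forall>j\<le>d. i \<noteq> j \<longrightarrow> Y i z \<noteq> Y j z)"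
      using noncritical_local_roots[of z0] by blast
    define B where "B = ball z0 \<epsilon>"
    define T where "T i j = {z \<in> B. cmod (F z (Y i z) / F z (Y j z)) = 1}" for i j
    have Fnz: "F z (Y i z) \<noteq> 0" if "z \<in> B" "i \<le> d" for z i using F_nonzero Y that by (auto simp: B_def)
    have holF: "(\<lambda>z. F z (Y i z)) holomorphic_on B" if "i \<le> d" for i using hol that by (auto simp: B_def intro: holomorphic_F)
    have negT: "negligible (T i j)" if ij: "i \<le> d" "j \<le> d" "i \<noteq> j" for i j
      unfolding T_def
    proof (rule negligible_unit_modulus_set)
      show "(\<lambda>z. F z (Y i z) / F z (Y j z)) holomorphic_on B"
        using Fnz ij by (intro holomorphic_on_divide holF) auto
      show "open B" by (simp add: B_def)
      fix z assume z: "z \<in> B"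
      have D: "((\<lambda>z. F z (Y k z)) has_field_derivative - (of_nat a / t) * (Y k z - z) * F z (Y k z)) (at z)" if "k \<le> d" for k
        by (rule deriv_F[of B]) (use hol Y that z in \<open>auto simp: B_def\<close>)
      have "((\<lambda>z. F z (Y i z) / F z (Y j z)) has_field_derivative
         (- (of_nat a / t) * (Y i z - z) * F z (Y i z) * F z (Y j z) - F z (Y i z) * (- (of_nat a / t) * (Y j z - z) * F z (Y j z))) / (F z (Y j z) * F z (Y j z))) (at z)"
        by (rule DERIV_divide[OF D D Fnz]) (use ij z in auto)
      then have "deriv (\<lambda>z. F z (Y i z) / F z (Y j z)) z =
         (- (of_nat a / t) * (Y i z - z) * F z (Y i z) * F z (Y j z) - F z (Y i z) * (- (of_nat a / t) * (Y j z - z) * F z (Y j z))) / (F z (Y j z) * F z (Y j z))"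
        by (rule DERIV_imp_deriv)
      also have "- (of_nat a / t) * (Y i z - z) * F z (Y i z) * F z (Y j z) - F z (Y i z) * (- (of_nat a / t) * (Y j z - z) * F z (Y j z))
         = (of_nat a / t) * (Y j z - Y i z) * F z (Y i z) * F z (Y j z)" by (simp add: algebra_simps)
      finally show "deriv (\<lambda>z. F z (Y i z) / F z (Y j z)) z \<noteq> 0"
        using Fnz[OF z ij(1)] Fnz[OF z ij(2)] a t Y z ij by (auto simp: B_def)
    qed
    have "B \<inter> - good \<subseteq> (\<Union>i\<in>{..d}. \<Union>j\<in>{..d} - {i}. T i j)"
    proof
      fix z assume z: "z \<in> B \<inter> - good"
      show "z \<in> (\<Union>i\<in>{..d}. \<Union>j\<in>{..d} - {i}. T i j)"
      proof (rule ccontr)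
        assume no: "z \<notin> (\<Union>i\<in>{..d}. \<Union>j\<in>{..d} - {i}. T i j)"
        have "\<forall>\<^sub>F w in nhds z. cmod (F w (Y i w)) \<noteq> cmod (F w (Y j w))" if ij: "i \<le> d" "j \<le> d" "i \<noteq> j" for i j
        proof -
          have lim: "((\<lambda>w. F w (Y k w)) \<longlongrightarrow> F z (Y k z)) (nhds z)" if "k \<le> d" for k
          proof -
            have "isCont (\<lambda>w. F w (Y k w)) z" using holomorphic_on_imp_continuous_on[OF holF[OF that]] z
              by (auto simp: continuous_on_eq_continuous_at B_def)
            then show ?thesis by (simp add: isCont_def tendsto_nhds_iff)
          qed
          have "z \<notin> T i j" using no ij by auto
          then have "cmod (F z (Y i z)) - cmod (F z (Y j z)) \<noteq> 0"
            using z Fnz[of z j] ij by (auto simp: T_def norm_divide)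
          moreover have "((\<lambda>w. cmod (F w (Y i w)) - cmod (F w (Y j w))) \<longlongrightarrow> cmod (F z (Y i z)) - cmod (F z (Y j z))) (nhds z)"
            using ij by (intro tendsto_diff tendsto_norm lim)
          ultimately have "\<forall>\<^sub>F w in nhds z. cmod (F w (Y i w)) - cmod (F w (Y j w)) \<noteq> 0"
            by (rule tendsto_imp_eventually_ne[rotated])
          then show ?thesis by eventually_elim simp
        qed
        then have "\<forall>\<^sub>F w in nhds z. \<forall>i\<in>{..d}. \<forall>j\<in>{..d} - {i}. cmod (F w (Y i w)) \<noteq> cmod (F w (Y j w))"
          by (intro eventually_ball_finite ballI) auto
        moreover have "\<forall>\<^sub>F w in nhds z. w \<in> B" using z by (intro eventually_nhds_in_open) (auto simp: B_def)
        ultimately have "\<forall>\<^sub>F w in nhds z. (\<forall>i\<in>{..d}. \<forall>j\<in>{..d} - {i}. cmod (F w (Y i w)) \<noteq> cmod (F w (Y j w))) \<and> w \<in> B"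
          by (rule eventually_conj)
        then obtain \<delta> where \<delta>: "\<delta> > 0" "\<And>w. dist w z < \<delta> \<Longrightarrow> (\<forall>i\<in>{..d}. \<forall>j\<in>{..d} - {i}. cmod (F w (Y i w)) \<noteq> cmod (F w (Y j w))) \<and> w \<in> B"
          unfolding eventually_nhds_metric by blast
        have "ball z \<delta> \<subseteq> B" using \<delta>(2) by (auto simp: dist_commute)
        then have "z \<in> good" unfolding good_def
        proof (intro CollectI exI[of _ \<delta>] conjI exI[of _ Y] ballI allI impI)
          fix i assume "i \<le> d"
          then show "Y i holomorphic_on ball z \<delta>" using hol \<open>ball z \<delta> \<subseteq> B\<close> by (auto simp: B_def intro: holomorphic_on_subset)
        next
          fix w i assume "w \<in> ball z \<delta>" "i \<le> d"
          then show "poly (saddle w) (Y i w) = 0" using Y \<open>ball z \<delta> \<subseteq> B\<close> by (auto simp: B_def)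
        next
          fix w i j assume "w \<in> ball z \<delta>" "i \<le> d" "j \<le> d" "i \<noteq> j"
          then show "cmod (F w (Y i w)) \<noteq> cmod (F w (Y j w))" using \<delta>(2)[of w] by (simp add: dist_commute)
        qed (rule \<delta>(1))
        then show False using z by simp
      qed
    qed
    moreover have "negligible (\<Union>i\<in>{..d}. \<Union>j\<in>{..d} - {i}. T i j)"
      using negT by (intro negligible_Union) (auto intro!: negligible_Union)
    ultimately have "negligible (B \<inter> - good)" by (rule negligible_subset[rotated])
    then have "negligible ((- good - ?C) \<inter> B)" by (rule negligible_subset) auto
    moreover have "openin (top_of_set (- good - ?C)) ((- good - ?C) \<inter> B)" by (rule openin_open_Int) (simp add: B_def)
    ultimately show "\<exists>U. openin (top_of_set (- good - ?C)) U \<and> z0 \<in> U \<and> negligible U"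
      using z0 e by (intro exI[of _ "(- good - ?C) \<inter> B"]) (auto simp: B_def)
  qed
  then have "negligible ((- good - ?C) \<union> ?C)" using negC by (rule negligible_Un)
  then show ?thesis by (rule negligible_subset) auto
qed

end

section \<open>Zero distributions of heat-evolved powers\<close>

lemma sum_mset_eq_sum_count:
  fixes f :: "'a \<Rightarrow> complex"
  assumes "finite S" "set_mset A \<subseteq> S"
  shows "(\<Sum>x\<in>#A. f x) = (\<Sum>x\<in>S. of_nat (count A x) * f x)"
  using assms(2)
proof (induction A)
  case (add a A)
  have "(\<Sum>x\<in>S. of_nat (count (add_mset a A) x) * f x) = (\<Sum>x\<in>S. of_nat (count A x) * f x + (if x = a then f x else 0))"
    by (intro sum.cong refl) (simp add: distrib_right)
  also have "\<dots> = (\<Sum>x\<in>S. of_nat (count A x) * f x) + f a"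
    using add.prems assms(1) by (simp add: sum.distrib)
  finally show ?case using add by simp
qed simp

lemma logarithmic_derivative_sum:
  fixes p :: "complex poly"
  assumes "poly p z \<noteq> 0"
  shows "(\<Sum>x | poly p x = 0. of_nat (order x p) / (z - x)) = poly (pderiv p) z / poly p z"
proof -
  have p0: "p \<noteq> 0" using assms by auto
  have "(\<Sum>x\<in>#A. 1 / (z - x)) = (\<Sum>x\<in>set_mset A. of_nat (count A x) / (z - x))" for A
    by (subst sum_mset_eq_sum_count[of "set_mset A"]) simp_all
  then have "(\<Sum>x\<in>#proots p. 1 / (z - x)) = (\<Sum>x | poly p x = 0. of_nat (order x p) / (z - x))"
    using p0 by simp
  then show ?thesis using poly_deriv_logarithmic[OF assms] assms by simp
qed

lemma sum_order_roots:
  fixes p :: "complex poly"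
  assumes "p \<noteq> 0"
  shows "(\<Sum>x | poly p x = 0. order x p) = degree p"
proof -
  have "size (proots p) = (\<Sum>x\<in>set_mset (proots p). count (proots p) x)" by (rule size_multiset_overloaded_eq)
  then show ?thesis using assms by (simp add: size_proots_complex)
qed

lemma integral_zero_distribution:
  fixes f :: "complex \<Rightarrow> real"
  assumes "p \<noteq> 0" "continuous_on UNIV f"
  shows "(\<integral>x. f x \<partial>zero_distribution N p) = (\<Sum>x | poly p x = 0. real (order x p) / real N * f x)"
  unfolding zero_distribution_def
  by (rule integral_distr_point_measure)
     (use assms poly_roots_finite in \<open>auto intro: borel_measurable_continuous_onI\<close>)

section \<open>Scaling and rotation of the variable\<close>

lemma pcompose_scale:
  "pcompose (pcompose p [:0, c:]) [:0, c':] = pcompose p [:0, c * c' :: complex:]"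
  by (simp add: pcompose_assoc[symmetric] pcompose_pCons mult.commute)

lemma pcompose_power_poly: "pcompose (p ^ n) q = pcompose (p :: complex poly) q ^ n"
  by (induction n) (simp_all add: pcompose_mult pcompose_1)

lemma order_pcompose_scale_le:
  fixes p :: "complex poly"
  assumes "c \<noteq> 0" "p \<noteq> 0"
  shows "order (c * z) p \<le> order z (pcompose p [:0, c:])"
proof -
  have "[:- (c * z), 1:] ^ order (c * z) p dvd p" by (rule order_1)
  then obtain u where "p = [:- (c * z), 1:] ^ order (c * z) p * u" by (elim dvdE)
  then have "pcompose p [:0, c:] = pcompose ([:- (c * z), 1:] ^ order (c * z) p * u) [:0, c:]" by (rule arg_cong)
  also have "\<dots> = (pcompose [:- (c * z), 1:] [:0, c:]) ^ order (c * z) p * pcompose u [:0, c:]"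
    by (simp only: pcompose_mult pcompose_power_poly)
  also have "pcompose [:- (c * z), 1:] [:0, c:] = [:- z, 1:] * [:c:]"
    by (simp add: pcompose_pCons)
  also have "([:- z, 1:] * [:c:]) ^ order (c * z) p * pcompose u [:0, c:] = [:- z, 1:] ^ order (c * z) p * ([:c:] ^ order (c * z) p * pcompose u [:0, c:])"
    by (simp only: power_mult_distrib mult.assoc)
  finally have "[:- z, 1:] ^ order (c * z) p dvd pcompose p [:0, c:]" by (rule dvdI)
  moreover have "pcompose (pcompose p [:0, c:]) [:0, inverse c:] = p" unfolding pcompose_scale using assms(1) by (simp add: pcompose_idR)
  then have "pcompose p [:0, c:] \<noteq> 0" using assms(2) by auto
  ultimately show ?thesis by (simp add: order_divides)
qed

lemma order_pcompose_scale:
  fixes p :: "complex poly"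
  assumes "c \<noteq> 0" "p \<noteq> 0"
  shows "order z (pcompose p [:0, c:]) = order (c * z) p"
proof (rule antisym)
  have inv: "pcompose (pcompose p [:0, c:]) [:0, inverse c:] = p" unfolding pcompose_scale using assms(1) by (simp add: pcompose_idR)
  then have nz: "pcompose p [:0, c:] \<noteq> 0" using assms(2) by auto
  have "order (inverse c * (c * z)) (pcompose p [:0, c:]) \<le> order (c * z) (pcompose (pcompose p [:0, c:]) [:0, inverse c:])"
    using assms(1) nz by (intro order_pcompose_scale_le) auto
  then show "order z (pcompose p [:0, c:]) \<le> order (c * z) p" using assms(1) by (simp add: inv mult.assoc[symmetric])
qed (rule order_pcompose_scale_le[OF assms])

lemma higher_pderiv_pcompose_scale:
  "(pderiv ^^ k) (pcompose p [:0, c:]) = smult (c ^ k) (pcompose ((pderiv ^^ k) p) [:0, c :: complex:])"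
  by (induction k) (simp_all add: pderiv_smult pderiv_pcompose pderiv_pCons mult.commute)

text \<open>Under z \<mapsto> c z every pair of derivatives produces a factor c^2, so scaling the
  variable amounts to scaling time by c^2. A rotation by half an angle rotates time by the full
  angle.\<close>

lemma heat_evolution_pcompose_scale:
  assumes "c \<noteq> 0"
  shows "heat_evolution s (pcompose p [:0, c:]) = pcompose (heat_evolution (c\<^sup>2 * s) p) [:0, c:]"
proof -
  have "degree (pcompose p [:0, c:]) = degree p" using assms by (simp add: degree_pcompose)
  then have "heat_evolution s (pcompose p [:0, c:]) = (\<Sum>k\<le>degree p. smult ((- s) ^ k / fact k) ((pderiv ^^ (2 * k)) (pcompose p [:0, c:])))"
    by (simp add: heat_evolution_def)
  also have "\<dots> = (\<Sum>k\<le>degree p. pcompose (smult ((- (c\<^sup>2 * s)) ^ k / fact k) ((pderiv ^^ (2 * k)) p)) [:0, c:])"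
  proof (rule sum.cong[OF refl])
    fix k
    have "(- s) ^ k / fact k * c ^ (2 * k) = (- (c\<^sup>2 * s)) ^ k / fact k"
    proof -
      have "- (c\<^sup>2 * s) = c\<^sup>2 * (- s)" by simp
      then have "(- (c\<^sup>2 * s)) ^ k = c ^ (2 * k) * (- s) ^ k" by (simp only: power_mult_distrib power_mult)
      then show ?thesis by simp
    qed
    then show "smult ((- s) ^ k / fact k) ((pderiv ^^ (2 * k)) (pcompose p [:0, c:])) = pcompose (smult ((- (c\<^sup>2 * s)) ^ k / fact k) ((pderiv ^^ (2 * k)) p)) [:0, c:]"
      by (simp only: higher_pderiv_pcompose_scale smult_smult pcompose_smult)
  qed
  finally show ?thesis by (simp add: heat_evolution_def pcompose_sum)
qed

lemma integral_zero_distribution_scale: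
  fixes f :: "complex \<Rightarrow> real"
  assumes c: "c \<noteq> 0" and p: "p \<noteq> 0" and f: "continuous_on UNIV f"
  shows "(\<integral>x. f (x * c) \<partial>zero_distribution N (pcompose p [:0, c:])) = (\<integral>x. f x \<partial>zero_distribution N p)"
proof -
  have "pcompose (pcompose p [:0, c:]) [:0, inverse c:] = p" unfolding pcompose_scale using c by (simp add: pcompose_idR)
  then have nz: "pcompose p [:0, c:] \<noteq> 0" using p by auto
  have "(\<integral>x. f (x * c) \<partial>zero_distribution N (pcompose p [:0, c:])) =
     (\<Sum>x | poly (pcompose p [:0, c:]) x = 0. real (order x (pcompose p [:0, c:])) / real N * f (x * c))"
    by (rule integral_zero_distribution[OF nz]) (rule continuous_on_compose2[OF f], auto intro!: continuous_intros)
  also have "\<dots> = (\<Sum>x | poly p x = 0. real (order x p) / real N * f x)"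
    using c by (intro sum.reindex_bij_witness[where i = "\<lambda>x. x / c" and j = "\<lambda>x. c * x"])
      (auto simp: poly_pcompose order_pcompose_scale[OF c p] mult.commute)
  also have "\<dots> = (\<integral>x. f x \<partial>zero_distribution N p)" by (rule integral_zero_distribution[OF p f, symmetric])
  finally show ?thesis .
qed

lemma weakly_converges_distr:
  fixes M M' :: "nat \<Rightarrow> complex measure"
  assumes M: "weakly_converges M L" and g: "continuous_on UNIV (g :: complex \<Rightarrow> complex)"
    and eq: "\<And>n f. n \<ge> 1 \<Longrightarrow> continuous_on UNIV f \<Longrightarrow> (\<integral>x. f (g x) \<partial>M n) = (\<integral>x. (f x :: real) \<partial>M' n)"
  shows "weakly_converges M' (distr L borel g)"
proof -
  have L: "prob_space L" "sets L = sets borel" using M by (auto simp: weakly_converges_def borel_prob_def)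
  have gm: "g \<in> measurable L borel"
    using borel_measurable_continuous_onI[OF g] measurable_cong_sets[OF L(2) refl] by blast
  have "borel_prob (distr L borel g)" unfolding borel_prob_def using prob_space.prob_space_distr[OF L(1) gm] by simp
  moreover have "(\<lambda>n. \<integral>x. f x \<partial>M' n) \<longlonglongrightarrow> (\<integral>x. f x \<partial>distr L borel g)"
    if f: "continuous_on UNIV f" "bounded (range f)" for f :: "complex \<Rightarrow> real"
  proof -
    have "continuous_on UNIV (\<lambda>x. f (g x))" by (rule continuous_on_compose2[OF f(1) g]) auto
    moreover have "bounded (range (\<lambda>x. f (g x)))" by (rule bounded_subset[OF f(2)]) auto
    ultimately have "(\<lambda>n. \<integral>x. f (g x) \<partial>M n) \<longlonglongrightarrow> (\<integral>x. f (g x) \<partial>L)"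
      using M by (simp add: weakly_converges_def)
    moreover have "\<forall>\<^sub>F n in sequentially. (\<integral>x. f (g x) \<partial>M n) = (\<integral>x. f x \<partial>M' n)"
      using eventually_ge_at_top[of 1] by eventually_elim (rule eq[OF _ f(1)])
    ultimately have "(\<lambda>n. \<integral>x. f x \<partial>M' n) \<longlonglongrightarrow> (\<integral>x. f (g x) \<partial>L)" by (rule Lim_transform_eventually)
    moreover have "(\<integral>x. f (g x) \<partial>L) = (\<integral>x. f x \<partial>distr L borel g)"
      using f(1) by (intro integral_distr[symmetric] gm borel_measurable_continuous_onI)
    ultimately show ?thesis by simp
  qed
  ultimately show ?thesis by (simp add: weakly_converges_def)
qed

section \<open>From logarithmic derivatives to limiting zero distributions\<close>

lemma empirical_zeros_limit:
  fixes p :: "nat \<Rightarrow> complex poly" and M :: "nat \<Rightarrow> complex measure"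
  assumes p: "\<And>n. n \<ge> 1 \<Longrightarrow> degree (p n) = a * n" and a: "a \<ge> 1"
    and M: "\<And>n. n \<ge> 1 \<Longrightarrow> M n = zero_distribution (a * n) (p n)"
    and R: "\<And>n z. n \<ge> 1 \<Longrightarrow> poly (p n) z = 0 \<Longrightarrow> cmod z \<le> R"
    and G: "open G" "negligible (- G)"
    and lim: "\<And>z0. z0 \<in> G \<Longrightarrow> \<exists>\<epsilon>>0. \<exists>m. m holomorphic_on ball z0 \<epsilon> \<and> (\<forall>z\<in>ball z0 \<epsilon>.
       (\<lambda>n. poly (pderiv (p n)) z / (of_nat (a * n) * poly (p n) z)) \<longlonglongrightarrow> m z \<and> (\<forall>\<^sub>F n in sequentially. poly (p n) z \<noteq> 0))"
  shows "\<exists>\<mu>. weakly_converges M \<mu> \<and> compact (measure_support \<mu>) \<and> mutually_singular \<mu> lborel"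
proof -
  have nz: "p (Suc n) \<noteq> 0" for n using p[of "Suc n"] a by auto
  \<comment> \<open>The degree is known from index 1 on, so the sequence is shifted by one to have
    probability weights at every index.\<close>
  define Z where "Z n = {x. poly (p (Suc n)) x = 0}" for n
  define w where "w n x = real (order x (p (Suc n))) / real (a * Suc n)" for n x
  interpret cauchy_transforms Z w R G
  proof
    fix n x
    show "finite (Z n)" unfolding Z_def by (rule poly_roots_finite[OF nz])
    show "0 \<le> w n x" by (simp add: w_def)
    show "(\<Sum>x\<in>Z n. w n x) = 1"
    proof -
      have "(\<Sum>x\<in>Z n. w n x) = real (\<Sum>x\<in>Z n. order x (p (Suc n))) / real (a * Suc n)"
        by (simp add: w_def sum_divide_distrib del: of_nat_mult)
      also have "\<dots> = real (a * Suc n) / real (a * Suc n)" unfolding Z_def sum_order_roots[OF nz] using p[of "Suc n"] by simp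
      also have "\<dots> = 1" using a by (intro divide_self) (simp del: of_nat_mult)
      finally show ?thesis .
    qed
    show "cmod x \<le> R" if "x \<in> Z n" using that R[of "Suc n" x] by (simp add: Z_def)
  next
    fix z0 assume "z0 \<in> G"
    then obtain \<epsilon> m where \<epsilon>: "\<epsilon> > 0" "m holomorphic_on ball z0 \<epsilon>" and
      m: "\<forall>z\<in>ball z0 \<epsilon>. (\<lambda>n. poly (pderiv (p n)) z / (of_nat (a * n) * poly (p n) z)) \<longlonglongrightarrow> m z \<and> (\<forall>\<^sub>F n in sequentially. poly (p n) z \<noteq> 0)"
      using lim by blast
    have "(\<lambda>n. \<Sum>x\<in>Z n. of_real (w n x) / (z - x)) \<longlonglongrightarrow> m z" if z: "z \<in> ball z0 \<epsilon>" for z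
    proof (rule Lim_transform_eventually)
      show "(\<lambda>n. poly (pderiv (p (Suc n))) z / (of_nat (a * Suc n) * poly (p (Suc n)) z)) \<longlonglongrightarrow> m z"
        using LIMSEQ_Suc m z by blast
      have "\<forall>\<^sub>F n in sequentially. poly (p n) z \<noteq> 0" using m z by blast
      then have "\<forall>\<^sub>F n in sequentially. poly (p (Suc n)) z \<noteq> 0" using eventually_sequentially_Suc[of "\<lambda>n. poly (p n) z \<noteq> 0"] by simp
      then show "\<forall>\<^sub>F n in sequentially. poly (pderiv (p (Suc n))) z / (of_nat (a * Suc n) * poly (p (Suc n)) z) = (\<Sum>x\<in>Z n. of_real (w n x) / (z - x))"
      proof eventually_elim
        case (elim n)
        have "(\<Sum>x\<in>Z n. of_real (w n x) / (z - x)) = (\<Sum>x | poly (p (Suc n)) x = 0. of_nat (order x (p (Suc n))) / (z - x)) / of_nat (a * Suc n)"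
          unfolding Z_def w_def sum_divide_distrib by (intro sum.cong refl) simp
        then show ?case unfolding logarithmic_derivative_sum[OF elim] by (simp add: mult.commute)
      qed
    qed
    then show "\<exists>\<epsilon>>0. \<exists>M. M holomorphic_on ball z0 \<epsilon> \<and> (\<forall>z\<in>ball z0 \<epsilon>. (\<lambda>n. \<Sum>x\<in>Z n. of_real (w n x) / (z - x)) \<longlonglongrightarrow> M z)"
      using \<epsilon> by blast
  qed (rule G(2))
  obtain \<mu> where \<mu>: "borel_prob \<mu>" "\<forall>f. continuous_on UNIV f \<longrightarrow> bounded (range f) \<longrightarrow> (\<lambda>n. \<Sum>x\<in>Z n. w n x * f x) \<longlonglongrightarrow> (\<integral>x. f x \<partial>\<mu>)"
    "compact (measure_support \<mu>)" "mutually_singular \<mu> lborel"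
    using weak_limit[OF G(1)] by blast
  have "(\<lambda>n. \<integral>x. f x \<partial>M n) \<longlonglongrightarrow> (\<integral>x. f x \<partial>\<mu>)" if f: "continuous_on UNIV f" "bounded (range f)" for f :: "complex \<Rightarrow> real"
  proof (rule LIMSEQ_imp_Suc)
    have "(\<integral>x. f x \<partial>M (Suc n)) = (\<Sum>x\<in>Z n. w n x * f x)" for n
      using M[of "Suc n"] integral_zero_distribution[OF nz f(1), of "a * Suc n" n] by (simp add: Z_def w_def)
    then show "(\<lambda>n. \<integral>x. f x \<partial>M (Suc n)) \<longlonglongrightarrow> (\<integral>x. f x \<partial>\<mu>)" using \<mu>(2) f by simp
  qed
  then show ?thesis using \<mu> by (auto simp: weakly_converges_def)
qed

lemma heat_power_limit:
  fixes lam :: "nat \<Rightarrow> complex" and m :: "nat \<Rightarrow> nat"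
  assumes d: "d \<ge> 1" and inj: "inj_on lam {1..d}" and m: "\<forall>j\<in>{1..d}. m j \<ge> 1"
    and P: "P = (\<Prod>j=1..d. [:- lam j, 1:] ^ m j)" and a: "a = (\<Sum>j=1..d. m j)"
  shows "\<exists>\<mu>. weakly_converges (empirical_zeros a (\<lambda>n. P ^ n) t) \<mu> \<and> compact (measure_support \<mu>) \<and> mutually_singular \<mu> lborel"
proof -
  have a1: "a \<ge> 1"
  proof -
    have "m 1 \<le> a" unfolding a using d by (intro member_le_sum) auto
    moreover have "1 \<le> m 1" using m d by simp
    ultimately show ?thesis by linarith
  qed
  have deg_P: "degree P = a"
    unfolding P a by (subst degree_prod_eq_sum_degree) (auto simp: degree_power_eq)
  have lead_P: "lead_coeff P = 1" unfolding P by (simp add: lead_coeff_prod lead_coeff_power)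
  have P0: "P \<noteq> 0" using lead_P by auto
  have root_P: "poly P z = 0 \<longleftrightarrow> z \<in> lam ` {1..d}" for z
  proof -
    have "poly P z = 0 \<longleftrightarrow> (\<exists>j\<in>{1..d}. (z - lam j) ^ m j = 0)" by (simp add: P poly_prod)
    also have "\<dots> \<longleftrightarrow> (\<exists>j\<in>{1..d}. z = lam j)"
      using m by (intro bex_cong refl) (auto simp: Suc_le_eq)
    finally show ?thesis by auto
  qed
  define \<Lambda> where "\<Lambda> = (\<Sum>j=1..d. cmod (lam j))"
  have \<Lambda>: "cmod z \<le> \<Lambda>" if "poly P z = 0" for z
    using that unfolding root_P \<Lambda>_def by (auto intro: member_le_sum)
  define p where "p n = heat_evolution (t / (2 * of_nat a * of_nat n)) (P ^ n)" for n
  have deg_p: "degree (p n) = a * n" for n by (simp add: p_def degree_power_eq P0 deg_P mult.commute)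
  \<comment> \<open>Time t / (2 a n) and degree a n give 8 |\<tau>| times the degree equal to 4 |t|
    for every n, the square of 2 sqrt |t|; the summand 1 keeps the radius positive at t = 0.\<close>
  have roots: "cmod z \<le> \<Lambda> + (2 * sqrt (cmod t) + 1)" if n: "n \<ge> 1" and z: "poly (p n) z = 0" for n z
  proof -
    have "cmod z < \<Lambda> + (2 * sqrt (cmod t) + 1)"
    proof (rule heat_evolution_zero_bound[where p = "P ^ n"])
      show "poly (heat_evolution (t / (2 * of_nat a * of_nat n)) (P ^ n)) z = 0" using z by (simp add: p_def)
      show "cmod x \<le> \<Lambda>" if "poly (P ^ n) x = 0" for x using that \<Lambda> n by simp
      have "8 * cmod (t / (2 * of_nat a * of_nat n)) * real (degree (P ^ n)) = 4 * cmod t"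
        using a1 n by (simp add: degree_power_eq P0 deg_P norm_divide norm_mult field_simps)
      also have "\<dots> = (2 * sqrt (cmod t)) ^ 2" by (simp add: power_mult_distrib)
      also have "\<dots> \<le> (2 * sqrt (cmod t) + 1) ^ 2" by (intro power_mono) auto
      finally show "8 * cmod (t / (2 * of_nat a * of_nat n)) * real (degree (P ^ n)) \<le> (2 * sqrt (cmod t) + 1) ^ 2" .
      show "0 \<le> \<Lambda>" by (simp add: \<Lambda>_def sum_nonneg)
      show "0 < 2 * sqrt (cmod t) + 1" by (intro add_nonneg_pos) auto
    qed (use P0 in simp)
    then show ?thesis by simp
  qed
  have "\<exists>G. open G \<and> negligible (- G) \<and> (\<forall>z0\<in>G. \<exists>\<epsilon>>0. \<exists>m. m holomorphic_on ball z0 \<epsilon> \<and> (\<forall>z\<in>ball z0 \<epsilon>.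
       (\<lambda>n. poly (pderiv (p n)) z / (of_nat (a * n) * poly (p n) z)) \<longlonglongrightarrow> m z \<and> (\<forall>\<^sub>F n in sequentially. poly (p n) z \<noteq> 0)))"
  proof (cases "t = 0")
    case True
    \<comment> \<open>The logarithmic derivative of \<open>P ^ n\<close> is n times that of
      \<open>P\<close>, so the normalised sequence is constant from n = 1 on, and only the zeros of
      \<open>P\<close> are exceptional.\<close>
    have p_eq: "p n = P ^ n" for n by (simp add: p_def True)
    show ?thesis
    proof (intro exI[of _ "- (lam ` {1..d})"] conjI ballI)
      show op: "open (- (lam ` {1..d}))" by (intro open_Compl finite_imp_closed) simp
      show "negligible (- (- (lam ` {1..d})))" by (simp add: negligible_finite)
      fix z0 assume "z0 \<in> - (lam ` {1..d})"
      then obtain \<epsilon> where \<epsilon>: "\<epsilon> > 0" "ball z0 \<epsilon> \<subseteq> - (lam ` {1..d})" using op open_contains_ball by blast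
      have Pnz: "poly P z \<noteq> 0" if "z \<in> ball z0 \<epsilon>" for z using root_P that \<epsilon>(2) by auto
      show "\<exists>\<epsilon>>0. \<exists>m. m holomorphic_on ball z0 \<epsilon> \<and> (\<forall>z\<in>ball z0 \<epsilon>.
         (\<lambda>n. poly (pderiv (p n)) z / (of_nat (a * n) * poly (p n) z)) \<longlonglongrightarrow> m z \<and> (\<forall>\<^sub>F n in sequentially. poly (p n) z \<noteq> 0))"
      proof (intro exI[of _ \<epsilon>] conjI exI[of _ "\<lambda>z. poly (pderiv P) z / (of_nat a * poly P z)"] ballI)
        show "(\<lambda>z. poly (pderiv P) z / (of_nat a * poly P z)) holomorphic_on ball z0 \<epsilon>"
          using Pnz a1 by (intro holomorphic_intros) auto
        fix z assume z: "z \<in> ball z0 \<epsilon>"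
        have "poly (pderiv (p n)) z / (of_nat (a * n) * poly (p n) z) = poly (pderiv P) z / (of_nat a * poly P z)" if n: "n \<ge> 1" for n
        proof -
          obtain k where k: "n = Suc k" using n by (cases n) auto
          have "(of_nat (Suc k) * poly P z ^ k) * poly (pderiv P) z / ((of_nat (Suc k) * poly P z ^ k) * (of_nat a * poly P z)) = poly (pderiv P) z / (of_nat a * poly P z)"
            using Pnz[OF z] by (intro mult_divide_mult_cancel_left) (simp del: of_nat_Suc)
          moreover have "poly (pderiv (P ^ Suc k)) z = (of_nat (Suc k) * poly P z ^ k) * poly (pderiv P) z"
            unfolding pderiv_power_Suc by (simp del: of_nat_Suc)
          moreover have "of_nat (a * Suc k) * poly (P ^ Suc k) z = (of_nat (Suc k) * poly P z ^ k) * (of_nat a * poly P z)"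
            by (simp only: of_nat_mult poly_power power_Suc poly_mult mult_ac)
          ultimately show ?thesis unfolding p_eq k by (simp only:)
        qed
        then show "(\<lambda>n. poly (pderiv (p n)) z / (of_nat (a * n) * poly (p n) z)) \<longlonglongrightarrow> poly (pderiv P) z / (of_nat a * poly P z)"
          by (intro tendsto_eventually eventually_sequentiallyI[of 1])
        show "\<forall>\<^sub>F n in sequentially. poly (p n) z \<noteq> 0" using Pnz[OF z] by (simp add: p_eq)
      qed (rule \<epsilon>(1))
    qed
  next
    case False
    define q where "q = (\<Prod>j=1..d. [:- lam j, 1:])"
    \<comment> \<open>The cofactors of the linear factors of \<open>q\<close>. \<open>r\<close> is
      then the numerator of the logarithmic derivative of \<open>P\<close> over \<open>q\<close>,
      and at \<open>lam k\<close> only its term k survives, which is nonzero because the zeros are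
      distinct.\<close>
    define l where "l j = (\<Prod>i\<in>{1..d} - {j}. [:- lam i, 1:])" for j
    define r where "r = (\<Sum>j=1..d. smult (of_nat (m j)) (l j))"
    have q_split: "q = [:- lam j, 1:] * l j" if "j \<in> {1..d}" for j
      unfolding q_def l_def using that by (intro prod.remove) auto
    have deg_l: "degree (l j) = d - 1" if "j \<in> {1..d}" for j
      unfolding l_def using that by (subst degree_prod_eq_sum_degree) auto
    have l_zero: "poly (l j) (lam k) = 0" if "k \<in> {1..d} - {j}" for j k
      unfolding l_def poly_prod using that by (intro prod_zero) auto
    interpret heat_power P q r a d t
    proof
      show "degree q = d" unfolding q_def by (subst degree_prod_eq_sum_degree) auto
      show "lead_coeff q = 1" unfolding q_def by (simp add: lead_coeff_prod)
      have "degree r \<le> d - 1" unfolding r_def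
        by (intro degree_sum_le) (auto intro!: order.trans[OF degree_smult_le] simp: deg_l)
      then show "degree r < d" using d by simp
      show "q * pderiv P = r * P"
      proof -
        have "pderiv P = (\<Sum>j=1..d. (\<Prod>i\<in>{1..d} - {j}. [:- lam i, 1:] ^ m i) * pderiv ([:- lam j, 1:] ^ m j))"
          unfolding P by (rule pderiv_prod)
        then have "q * pderiv P = (\<Sum>j=1..d. q * ((\<Prod>i\<in>{1..d} - {j}. [:- lam i, 1:] ^ m i) * pderiv ([:- lam j, 1:] ^ m j)))"
          by (simp only: sum_distrib_left)
        also have "\<dots> = (\<Sum>j=1..d. smult (of_nat (m j)) (l j) * P)"
        proof (rule sum.cong[OF refl])
          fix j assume j: "j \<in> {1..d}"
          obtain k where k: "m j = Suc k" using m j by (metis Suc_le_D One_nat_def)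
          have "pderiv ([:- lam j, 1:] ^ m j) = smult (of_nat (m j)) ([:- lam j, 1:] ^ k)"
            unfolding k pderiv_power_Suc by (simp add: pderiv_pCons)
          then have "q * ((\<Prod>i\<in>{1..d} - {j}. [:- lam i, 1:] ^ m i) * pderiv ([:- lam j, 1:] ^ m j)) =
             smult (of_nat (m j)) (l j) * ([:- lam j, 1:] ^ m j * (\<Prod>i\<in>{1..d} - {j}. [:- lam i, 1:] ^ m i))"
            unfolding q_split[OF j] k power_Suc by (simp only: mult_smult_left mult_smult_right mult_ac)
          also have "[:- lam j, 1:] ^ m j * (\<Prod>i\<in>{1..d} - {j}. [:- lam i, 1:] ^ m i) = P"
            unfolding P using j by (intro prod.remove[symmetric]) auto
          finally show "q * ((\<Prod>i\<in>{1..d} - {j}. [:- lam i, 1:] ^ m i) * pderiv ([:- lam j, 1:] ^ m j)) = smult (of_nat (m j)) (l j) * P" .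
        qed
        finally show ?thesis by (simp only: r_def sum_distrib_right)
      qed
      have root_q: "poly q y = 0 \<longleftrightarrow> y \<in> lam ` {1..d}" for y
        by (auto simp: q_def poly_prod)
      show "poly q y = 0" if "poly P y = 0" for y using that root_q root_P by simp
      fix y assume "poly q y = 0"
      then obtain k where k: "k \<in> {1..d}" "y = lam k" using root_q by blast
      have "poly r y = (\<Sum>j=1..d. of_nat (m j) * poly (l j) (lam k))" by (simp add: r_def poly_sum k(2))
      also have "\<dots> = of_nat (m k) * poly (l k) (lam k)"
        using k(1) l_zero by (subst sum.remove[of _ k]) auto
      also have "\<dots> \<noteq> 0"
      proof -
        have "poly (l k) (lam k) \<noteq> 0" unfolding l_def poly_prod using k(1) inj by (auto dest: inj_onD)
        moreover have "m k \<noteq> 0" using m k(1) by force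
        ultimately show ?thesis by simp
      qed
      finally show "poly r y \<noteq> 0" .
    qed (use False a1 deg_P lead_P in auto)
    have ev1: "ev n 0 z 1 = poly (p n) z" for n z by (simp add: ev_def p_def)
    \<comment> \<open>The ratio in \<open>good_local_limit\<close> is therefore -t times the
      normalised logarithmic derivative. At n = 0 both sides are 0, since division by zero gives
      0.\<close>
    have evz: "ev n 0 z [:-z, 1:] = - (t / (of_nat a * of_nat n)) * poly (pderiv (p n)) z" for n z
    proof -
      have "ev n 0 z [:-z, 1:] = - 2 * (t / (2 * of_nat a * of_nat n)) * poly (pderiv (p n)) z"
        unfolding ev_def poly_heat_shift_mult by (simp add: p_def heat_evolution_pderiv)
      then show ?thesis by simp
    qed
    show ?thesis
    proof (intro exI[of _ good] conjI ballI open_good negligible_not_good)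
      fix z0 assume "z0 \<in> good"
      then obtain \<epsilon> m where \<epsilon>: "\<epsilon> > 0" "m holomorphic_on ball z0 \<epsilon>" and
        lim: "\<forall>z\<in>ball z0 \<epsilon>. (\<lambda>n. ev n 0 z [:-z, 1:] / ev n 0 z 1) \<longlonglongrightarrow> m z \<and> (\<forall>\<^sub>F n in sequentially. ev n 0 z 1 \<noteq> 0)"
        using good_local_limit by blast
      show "\<exists>\<epsilon>>0. \<exists>m. m holomorphic_on ball z0 \<epsilon> \<and> (\<forall>z\<in>ball z0 \<epsilon>.
         (\<lambda>n. poly (pderiv (p n)) z / (of_nat (a * n) * poly (p n) z)) \<longlonglongrightarrow> m z \<and> (\<forall>\<^sub>F n in sequentially. poly (p n) z \<noteq> 0))"
      proof (intro exI[of _ \<epsilon>] conjI exI[of _ "\<lambda>z. - (1 / t) * m z"] ballI)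
        show "(\<lambda>z. - (1 / t) * m z) holomorphic_on ball z0 \<epsilon>" using \<epsilon>(2) by (intro holomorphic_intros)
        fix z assume z: "z \<in> ball z0 \<epsilon>"
        have "(\<lambda>n. - (1 / t) * (ev n 0 z [:-z, 1:] / ev n 0 z 1)) \<longlonglongrightarrow> - (1 / t) * m z"
          using lim z by (intro tendsto_mult tendsto_const) auto
        moreover have "- (1 / t) * (ev n 0 z [:-z, 1:] / ev n 0 z 1) = poly (pderiv (p n)) z / (of_nat (a * n) * poly (p n) z)" for n
          unfolding evz ev1 using False by simp
        ultimately show "(\<lambda>n. poly (pderiv (p n)) z / (of_nat (a * n) * poly (p n) z)) \<longlonglongrightarrow> - (1 / t) * m z" by simp
        show "\<forall>\<^sub>F n in sequentially. poly (p n) z \<noteq> 0" using lim z unfolding ev1 by blast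
      qed (rule \<epsilon>(1))
    qed
  qed
  then obtain G where G: "open G" "negligible (- G)" "\<And>z0. z0 \<in> G \<Longrightarrow> \<exists>\<epsilon>>0. \<exists>m. m holomorphic_on ball z0 \<epsilon> \<and> (\<forall>z\<in>ball z0 \<epsilon>.
       (\<lambda>n. poly (pderiv (p n)) z / (of_nat (a * n) * poly (p n) z)) \<longlonglongrightarrow> m z \<and> (\<forall>\<^sub>F n in sequentially. poly (p n) z \<noteq> 0))"
    by blast
  show ?thesis
    by (rule empirical_zeros_limit[OF deg_p a1 _ roots G]) (simp add: empirical_zeros_def p_def)
qed

theorem theorem2p1:
  fixes d :: nat and lam :: "nat \<Rightarrow> complex" and m :: "nat \<Rightarrow> nat"
    and P :: "complex poly" and a :: nat and t :: complex
  assumes "d \<ge> 1"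
    and "inj_on lam {1..d}"
    and "\<forall>j\<in>{1..d}. m j \<ge> 1"
    and "P = (\<Prod>j=1..d. [:- lam j, 1:] ^ m j)"
    and "a = (\<Sum>j=1..d. m j)"
  shows "\<exists>\<mu> :: complex measure.
    weakly_converges (empirical_zeros a (\<lambda>n. P ^ n) t) \<mu> \<and>
    compact (measure_support \<mu>) \<and>
    mutually_singular \<mu> lborel \<and>
    (\<forall>\<theta>::real. t = complex_of_real (cmod t) * cis \<theta> \<longrightarrow>
       (let Mtilde = empirical_zeros a (\<lambda>n. pcompose (P ^ n) [:0, cis (\<theta> / 2):])
                       (complex_of_real (cmod t))
        in (\<exists>\<nu>. weakly_converges Mtilde \<nu>) \<and>
           (\<forall>\<nu>. weakly_converges Mtilde \<nu> \<longrightarrow> \<mu> = distr \<nu> borel (\<lambda>z. z * cis (\<theta> / 2)))))"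
proof -
  obtain \<mu> where \<mu>: "weakly_converges (empirical_zeros a (\<lambda>n. P ^ n) t) \<mu>" "compact (measure_support \<mu>)" "mutually_singular \<mu> lborel"
    using heat_power_limit[OF assms] by blast
  have "(\<exists>\<nu>. weakly_converges Mtilde \<nu>) \<and> (\<forall>\<nu>. weakly_converges Mtilde \<nu> \<longrightarrow> \<mu> = distr \<nu> borel (\<lambda>z. z * c))"
    if \<theta>: "t = complex_of_real (cmod t) * cis \<theta>" and c_def: "c = cis (\<theta> / 2)"
      and Mt: "Mtilde = empirical_zeros a (\<lambda>n. pcompose (P ^ n) [:0, c:]) (complex_of_real (cmod t))" for \<theta> c Mtilde
  proof -
    have c: "c \<noteq> 0" by (simp add: c_def)
    \<comment> \<open>Scaling the variable by c multiplies time by c^2, which carries |t| to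
      t.\<close>
    have c2: "c\<^sup>2 * complex_of_real (cmod t) = t"
    proof -
      have "c\<^sup>2 = cis \<theta>" by (simp add: c_def power2_eq_square cis_mult)
      then show ?thesis using \<theta> by (metis mult.commute)
    qed
    have P0: "P ^ n \<noteq> 0" for n unfolding assms(4) by (simp add: prod_zero_iff)
    have hp: "heat_evolution s (P ^ n) \<noteq> 0" for s n
      using lead_coeff_heat_evolution[of s "P ^ n"] P0[of n] by (metis leading_coeff_0_iff)
    have scale: "(\<integral>x. f (x * c) \<partial>Mtilde n) = (\<integral>x. f x \<partial>empirical_zeros a (\<lambda>n. P ^ n) t n)"
      if "continuous_on UNIV f" for f :: "complex \<Rightarrow> real" and n
    proof -
      have "c\<^sup>2 * (complex_of_real (cmod t) / (2 * of_nat a * of_nat n)) = t / (2 * of_nat a * of_nat n)"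
        by (simp only: times_divide_eq_right c2)
      then have "heat_evolution (complex_of_real (cmod t) / (2 * of_nat a * of_nat n)) (pcompose (P ^ n) [:0, c:]) =
         pcompose (heat_evolution (t / (2 * of_nat a * of_nat n)) (P ^ n)) [:0, c:]"
        unfolding heat_evolution_pcompose_scale[OF c] by (rule arg_cong)
      then show ?thesis unfolding Mt empirical_zeros_def
        using integral_zero_distribution_scale[OF c hp that] by simp
    qed
    have scale': "(\<integral>x. f (x * inverse c) \<partial>empirical_zeros a (\<lambda>n. P ^ n) t n) = (\<integral>x. f x \<partial>Mtilde n)"
      if "continuous_on UNIV f" for f :: "complex \<Rightarrow> real" and n
    proof -
      have "continuous_on UNIV (\<lambda>x. f (x * inverse c))"
        by (rule continuous_on_compose2[OF that]) (auto intro!: continuous_intros)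
      from scale[OF this, of n] show ?thesis using c by (simp add: mult.assoc)
    qed
    \<comment> \<open>The rotated sequence inherits a limit from \<mu> through the inverse rotation.
      Conversely, rotating any of its limits gives a limit of the original sequence, which is \<mu>
      by uniqueness.\<close>
    have "weakly_converges Mtilde (distr \<mu> borel (\<lambda>x. x * inverse c))"
      by (rule weakly_converges_distr[OF \<mu>(1)]) (auto intro!: continuous_intros scale')
    moreover have "\<mu> = distr \<nu> borel (\<lambda>z. z * c)" if "weakly_converges Mtilde \<nu>" for \<nu>
      by (rule weakly_converges_unique[OF \<mu>(1)], rule weakly_converges_distr[OF that]) (auto intro!: continuous_intros scale)
    ultimately show ?thesis by blast
  qed
  then show ?thesis using \<mu> unfolding Let_def by blast
qed

end
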